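(* Let $1\le p,q,u,v,p_1,q_1\le\infty$ with $p<q$ and $u>v$, let $\alpha>2$, and let $X$, $G$ and $J:X\to G$ be as defined in the context. Then there are constants $c_1,\dots,c_4>0$ and $n_0\in\mathbb{N}$ such that for all $n\ge n_0$ $$c_1n^{(-\alpha+1/p-1/q+1/u-1/v)/2}+c_1n^{-\alpha/2}\le e_n^{\mathrm{ran}}(J,B_X,G)$$ $$\le c_2n^{(-\alpha+1/p-1/q+1/u-1/v)/2}(\log(n+1))^{1/v-1/u}+c_2n^{-\alpha/2}(\log(n+1))^{1/p-1/q}$$ and $$c_3n^{(-\alpha+1/p-1/q)/2}\le e_n^{\mathrm{ran-non}}(J,B_X,G)\le e_n^{\mathrm{det-non}}(J,B_X,G)\le2e_n^{\mathrm{det}}(J,B_X,G)\le c_4n^{(-\alpha+1/p-1/q)/2}.$$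
   Context: $\mathbb{N}=\{1,2,\dots\}$, $\mathbb{N}_0=\mathbb{N}\cup\{0\}$, $\mathbb{K}\in\{\mathbb{R},\mathbb{C}\}$, $\log=\log_2$, $1/\infty=0$, $B_X$ is the closed unit ball of a normed space $X$. Spaces and problem. For $N\in\mathbb{N}$, $1\le p\le\infty$, $L_p^N$ is the space of functions $f:\{1,\dots,N\}\to\mathbb{K}$ with norm $\big(\frac1N\sum_{i=1}^N|f(i)|^p\big)^{1/p}$ if $p<\infty$ and $\max_i|f(i)|$ if $p=\infty$. $L_p^{N_1}(L_u^{N_2})$ is the space of all $f:\{1,\dots,N_1\}\times\{1,\dots,N_2\}\to\mathbb{K}$ with norm $\big\|(\|f_i\|_{L_u^{N_2}})_{i=1}^{N_1}\big\|_{L_p^{N_1}}$, where $f_i=(f(i,j))_{j=1}^{N_2}$. Put $N_k=2^k$ for $k\in\mathbb{N}_0$ and let $J^{N_k,N_k}:L_p^{N_k}(L_u^{N_k})\to L_q^{N_k}(L_v^{N_k})$, $J^{N_k,N_k}f=f$, be the identical embedding. Let $$X=\Big(\bigoplus_{k=0}^\infty L_p^{N_k}(L_u^{N_k})\Big)_{\ell_{p_1}},\qquad G=\Big(\bigoplus_{k=0}^\infty L_q^{N_k}(L_v^{N_k})\Big)_{\ell_{q_1}},$$ where $\big(\bigoplus_kX_k\big)_{\ell_r}$ is the space of sequences $(x_k)_{k=0}^\infty$, $x_k\in X_k$, with finite norm $\big\|(\|x_k\|_{X_k})_{k=0}^\infty\big\|_{\ell_r}$, and $$J:X\to G,\qquad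 J\big((x_k)_{k=0}^\infty\big)=\big(2^{-\alpha k}J^{N_k,N_k}x_k\big)_{k=0}^\infty.$$ The numerical problem considered is $(B_X,G,J,\mathbb{K},\Lambda)$, where $\Lambda$ consists of all functionals $(x_l)_{l=0}^\infty\mapsto x_k(i,j)$ with $k\in\mathbb{N}_0$, $1\le i,j\le N_k$ (standard information). Algorithms and minimal errors. A numerical problem is a tuple $(F,G,S,K,\Lambda)$: $F$ a nonempty set, $G$ a Banach space, $S:F\to G$ a map, $K$ a nonempty set, $\Lambda$ a nonempty set of maps $F\to K$. A deterministic algorithm is a tuple $A=((L_i)_{i\ge1},(\tau_i)_{i\ge0},(\varphi_i)_{i\ge0})$ with $L_1\in\Lambda$, $\tau_0\in\{0,1\}$, $\varphi_0\in G$ and arbitrary maps $L_{i+1}:K^i\to\Lambda$, $\tau_i:K^i\to\{0,1\}$, $\varphi_i:K^i\to G$ $(i\ge1)$. For $f\in F$ let $\lambda_1=L_1$, $\lambda_i=L_i(\lambda_1(f),\dots,\lambda_{i-1}(f))$ $(i\ge2)$. $\mathrm{card}(A,f)$ is the smallest $n\ge0$ with $\tau_n(\lambda_1(f),\dots,\lambda_n(f))=1$ (for $n=0$: $\tau_0=1$), and $\infty$ if there is none. The output is $A(f)=\varphi_n(\lambda_1(f),\dots,\lambda_n(f))$ if $n=\mathrm{card}(A,f)<\infty$ (with $A(f)=\varphi_0$ for $n=0$) and $A(f)=\varphi_0$ if $\mathrm{card}(A,f)=\infty$. $A$ is non-adaptive if all $L_i$ and all $\tau_i$ are constant. For $n\in\mathbb{N}_0$,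 $e_n^{\mathrm{det}}(S,F,G)$ (resp. $e_n^{\mathrm{det-non}}(S,F,G)$) is the infimum of $\sup_{f\in F}\|S(f)-A(f)\|_G$ over all (resp. all non-adaptive) deterministic algorithms with $\sup_{f\in F}\mathrm{card}(A,f)\le n$. A randomized algorithm is $A=((\Omega,\Sigma,\mathbb{P}),(A_\omega)_{\omega\in\Omega})$ with $(\Omega,\Sigma,\mathbb{P})$ a probability space and each $A_\omega$ a deterministic algorithm, such that for every $f\in F$ the map $\omega\mapsto\mathrm{card}(A_\omega,f)$ is measurable and $\omega\mapsto A_\omega(f)$ is Borel measurable and almost surely separably valued; it is non-adaptive if every $A_\omega$ is. $e_n^{\mathrm{ran}}(S,F,G)$ (resp. $e_n^{\mathrm{ran-non}}(S,F,G)$) is the infimum of $\sup_{f\in F}\mathbb{E}\|S(f)-A_\omega(f)\|_G$ over all (resp. all non-adaptive) randomized algorithms with $\sup_{f\in F}\mathbb{E}\,\mathrm{card}(A_\omega,f)\le n$. *)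

theory Defs
  imports "HOL-Analysis.Analysis" "HOL-Probability.Probability"
begin

section \<open>Numerical problems and deterministic algorithms\<close>

text \<open>
  A numerical problem \<open>(F, G, S, K, \<Lambda>)\<close>.  The normed space \<open>G\<close> is given by its carrier \<open>Gset\<close> and
  its norm \<open>Gnorm\<close>; only norms of differences enter the error definitions.
\<close>

record ('f, 'g, 'k) num_problem =
  Fset :: "'f set"
  Gset :: "'g set"
  Gnorm :: "'g \<Rightarrow> real"
  Sol :: "'f \<Rightarrow> 'g"
  Kset :: "'k set"
  Info :: "('f \<Rightarrow> 'k) set"

text \<open>
  The families \<open>(L\<^sub>i)\<close>, \<open>(\<tau>\<^sub>i)\<close>, \<open>(\<phi>\<^sub>i)\<close> are each merged into one function on lists:
  \<open>L\<^sub>i\<close> is \<open>query\<close> on lists of length \<open>i - 1\<close>, while \<open>\<tau>\<^sub>i\<close> and \<open>\<phi>\<^sub>i\<close> are \<open>stop\<close> and \<open>result\<close> on lists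
  of length \<open>i\<close> (all with entries in \<open>K\<close>).
\<close>

record ('f, 'g, 'k) algorithm =
  query :: "'k list \<Rightarrow> 'f \<Rightarrow> 'k"
  stop :: "'k list \<Rightarrow> bool"
  result :: "'k list \<Rightarrow> 'g"

definition det_algorithm :: "('f, 'g, 'k) num_problem \<Rightarrow> ('f, 'g, 'k) algorithm \<Rightarrow> bool" where
  "det_algorithm P A \<longleftrightarrow> (\<forall>z\<in>lists (Kset P). query A z \<in> Info P \<and> result A z \<in> Gset P)"

definition nonadaptive :: "('f, 'g, 'k) num_problem \<Rightarrow> ('f, 'g, 'k) algorithm \<Rightarrow> bool" where
  "nonadaptive P A \<longleftrightarrow> (\<forall>z\<in>lists (Kset P). \<forall>z'\<in>lists (Kset P). length z = length z' \<longrightarrow>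
     query A z = query A z' \<and> stop A z = stop A z')"

primrec info :: "('f, 'g, 'k) algorithm \<Rightarrow> 'f \<Rightarrow> nat \<Rightarrow> 'k list" where
  "info A f 0 = []"
| "info A f (Suc n) = info A f n @ [query A (info A f n) f]"

definition cost :: "('f, 'g, 'k) algorithm \<Rightarrow> 'f \<Rightarrow> enat" where
  "cost A f = (if \<exists>n. stop A (info A f n) then enat (LEAST n. stop A (info A f n)) else \<infinity>)"

definition answer :: "('f, 'g, 'k) algorithm \<Rightarrow> 'f \<Rightarrow> 'g" where
  "answer A f = (case cost A f of enat n \<Rightarrow> result A (info A f n) | \<infinity> \<Rightarrow> result A [])"

definition det_cost :: "('f, 'g, 'k) num_problem \<Rightarrow> ('f, 'g, 'k) algorithm \<Rightarrow> enat" where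
  "det_cost P A = (SUP f\<in>Fset P. cost A f)"

definition det_error :: "('f, 'g::minus, 'k) num_problem \<Rightarrow> ('f, 'g, 'k) algorithm \<Rightarrow> ennreal" where
  "det_error P A = (SUP f\<in>Fset P. ennreal (Gnorm P (Sol P f - answer A f)))"

definition e_det :: "('f, 'g::minus, 'k) num_problem \<Rightarrow> nat \<Rightarrow> ennreal" where
  "e_det P n = (INF A\<in>{A. det_algorithm P A \<and> det_cost P A \<le> enat n}. det_error P A)"

definition e_det_non :: "('f, 'g::minus, 'k) num_problem \<Rightarrow> nat \<Rightarrow> ennreal" where
  "e_det_non P n =
     (INF A\<in>{A. det_algorithm P A \<and> nonadaptive P A \<and> det_cost P A \<le> enat n}. det_error P A)"


section \<open>Randomized algorithms\<close>

definition Gopen :: "('f, 'g::minus, 'k) num_problem \<Rightarrow> 'g set \<Rightarrow> bool" where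
  "Gopen P U \<longleftrightarrow> U \<subseteq> Gset P \<and> (\<forall>x\<in>U. \<exists>\<epsilon>>0. \<forall>y\<in>Gset P. Gnorm P (y - x) < \<epsilon> \<longrightarrow> y \<in> U)"

definition Gborel :: "('f, 'g::minus, 'k) num_problem \<Rightarrow> 'g measure" where
  "Gborel P = sigma (Gset P) {U. Gopen P U}"

definition Gseparable :: "('f, 'g::minus, 'k) num_problem \<Rightarrow> 'g set \<Rightarrow> bool" where
  "Gseparable P H \<longleftrightarrow> (\<exists>D. countable D \<and> D \<subseteq> H \<and> H \<subseteq> Gset P \<and>
     (\<forall>x\<in>H. \<forall>\<epsilon>>0. \<exists>d\<in>D. Gnorm P (x - d) < \<epsilon>))"

definition ran_algorithm ::
  "('f, 'g::minus, 'k) num_problem \<Rightarrow> 'w measure \<Rightarrow> ('w \<Rightarrow> ('f, 'g, 'k) algorithm) \<Rightarrow> bool" where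
  "ran_algorithm P M A \<longleftrightarrow> prob_space M \<and> (\<forall>\<omega>\<in>space M. det_algorithm P (A \<omega>)) \<and>
     (\<forall>f\<in>Fset P.
        (\<lambda>\<omega>. cost (A \<omega>) f) \<in> measurable M (count_space UNIV) \<and>
        (\<lambda>\<omega>. answer (A \<omega>) f) \<in> measurable M (Gborel P) \<and>
        (\<exists>H. Gseparable P H \<and> (AE \<omega> in M. answer (A \<omega>) f \<in> H)))"

definition ran_nonadaptive ::
  "('f, 'g, 'k) num_problem \<Rightarrow> 'w measure \<Rightarrow> ('w \<Rightarrow> ('f, 'g, 'k) algorithm) \<Rightarrow> bool" where
  "ran_nonadaptive P M A \<longleftrightarrow> (\<forall>\<omega>\<in>space M. nonadaptive P (A \<omega>))"

definition ran_cost ::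
  "('f, 'g, 'k) num_problem \<Rightarrow> 'w measure \<Rightarrow> ('w \<Rightarrow> ('f, 'g, 'k) algorithm) \<Rightarrow> ennreal" where
  "ran_cost P M A = (SUP f\<in>Fset P. \<integral>\<^sup>+\<omega>. ennreal_of_enat (cost (A \<omega>) f) \<partial>M)"

definition ran_error ::
  "('f, 'g::minus, 'k) num_problem \<Rightarrow> 'w measure \<Rightarrow> ('w \<Rightarrow> ('f, 'g, 'k) algorithm) \<Rightarrow> ennreal" where
  "ran_error P M A =
     (SUP f\<in>Fset P. \<integral>\<^sup>+\<omega>. ennreal (Gnorm P (Sol P f - answer (A \<omega>) f)) \<partial>M)"

text \<open>
  HOL cannot take the infimum over probability spaces on all types, so the sample spaces below are
  sets of deterministic algorithms.  This loses nothing: by the lemmas \<open>e_ran_le\<close> and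
  \<open>e_ran_non_le\<close>, the infima are lower bounds for randomized algorithms over every sample type.
\<close>

definition e_ran :: "('f, 'g::minus, 'k) num_problem \<Rightarrow> nat \<Rightarrow> ennreal" where
  "e_ran P n = Inf {ran_error P M A | (M :: ('f, 'g, 'k) algorithm measure) A.
     ran_algorithm P M A \<and> ran_cost P M A \<le> of_nat n}"

definition e_ran_non :: "('f, 'g::minus, 'k) num_problem \<Rightarrow> nat \<Rightarrow> ennreal" where
  "e_ran_non P n = Inf {ran_error P M A | (M :: ('f, 'g, 'k) algorithm measure) A.
     ran_algorithm P M A \<and> ran_nonadaptive P M A \<and> ran_cost P M A \<le> of_nat n}"

lemma nn_integral_distr_le:
  assumes T: "T \<in> measurable M N"
  shows "(\<integral>\<^sup>+x. h x \<partial>distr M N T) \<le> (\<integral>\<^sup>+\<omega>. h (T \<omega>) \<partial>M)"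
  unfolding nn_integral_def[of "distr M N T"]
proof (rule SUP_least, clarify)
  fix g assume g: "simple_function (distr M N T) g" and le: "g \<le> h"
  have "g \<in> borel_measurable N"
    using borel_measurable_simple_function[OF g] by simp
  then have "integral\<^sup>S (distr M N T) g = (\<integral>\<^sup>+\<omega>. g (T \<omega>) \<partial>M)"
    using T nn_integral_distr[OF T, of g] nn_integral_eq_simple_integral[OF g] by simp
  also have "\<dots> \<le> (\<integral>\<^sup>+\<omega>. h (T \<omega>) \<partial>M)"
    using le by (intro nn_integral_mono) (auto simp: le_fun_def)
  finally show "integral\<^sup>S (distr M N T) g \<le> (\<integral>\<^sup>+\<omega>. h (T \<omega>) \<partial>M)" .
qed

lemma ran_algorithm_transfer:
  fixes P :: "('f, 'g::minus, 'k) num_problem" and M :: "'w measure"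
  assumes A: "ran_algorithm P M A"
  obtains M' :: "('f, 'g, 'k) algorithm measure"
  where "ran_algorithm P M' (\<lambda>a. a)" "ran_cost P M' (\<lambda>a. a) \<le> ran_cost P M A"
    "ran_error P M' (\<lambda>a. a) \<le> ran_error P M A" "space M' = A ` space M"
proof -
  define C where "C = completion M"
  have spC: "space C = space M" by (simp add: C_def)
  interpret M: prob_space M using A by (simp add: ran_algorithm_def)
  have C: "prob_space C"
    unfolding C_def by (rule M.prob_space_completion)
  define \<A> where "\<A> = {B. B \<subseteq> A ` space M \<and> A -` B \<inter> space M \<in> sets C}"
  define N where "N = sigma (A ` space M) \<A>"
  have sa: "sigma_algebra (A ` space M) \<A>"
  proof (rule sigma_algebra_iff2[THEN iffD2], intro conjI ballI allI impI)
    show "\<A> \<subseteq> Pow (A ` space M)" by (auto simp: \<A>_def)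
    show "{} \<in> \<A>" by (auto simp: \<A>_def)
  next
    fix B assume B: "B \<in> \<A>"
    have "A -` (A ` space M - B) \<inter> space M = space C - (A -` B \<inter> space M)"
      by (auto simp: spC)
    then show "A ` space M - B \<in> \<A>" using B by (auto simp: \<A>_def)
  next
    fix B :: "nat \<Rightarrow> _" assume B: "range B \<subseteq> \<A>"
    have "A -` (\<Union>i. B i) \<inter> space M = (\<Union>i. A -` B i \<inter> space M)" by auto
    moreover have "(\<Union>i. A -` B i \<inter> space M) \<in> sets C"
      using B by (intro sets.countable_UN) (auto simp: \<A>_def)
    ultimately show "(\<Union>i. B i) \<in> \<A>" using B by (auto simp: \<A>_def)
  qed
  have spN: "space N = A ` space M" and setsN: "sets N = \<A>"
    using sa by (auto simp: N_def space_measure_of_conv sigma_algebra.sets_measure_of_eq \<A>_def)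
  have mA: "A \<in> measurable C N"
    by (rule measurableI) (auto simp: spC spN setsN \<A>_def)
  have lift: "h \<in> measurable N R" if "(\<lambda>\<omega>. h (A \<omega>)) \<in> measurable C R" for h and R :: "'b measure"
  proof (rule measurableI)
    fix x assume "x \<in> space N"
    then show "h x \<in> space R" using measurable_space[OF that] by (auto simp: spN spC)
  next
    fix B assume "B \<in> sets R"
    then have "(\<lambda>\<omega>. h (A \<omega>)) -` B \<inter> space C \<in> sets C" by (rule measurable_sets[OF that])
    moreover have "A -` (h -` B \<inter> space N) \<inter> space M = (\<lambda>\<omega>. h (A \<omega>)) -` B \<inter> space C"
      by (auto simp: spN spC)
    ultimately show "h -` B \<inter> space N \<in> sets N" by (auto simp: setsN \<A>_def spN)
  qed
  define M' where "M' = distr C N A"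
  have intle: "(\<integral>\<^sup>+a. h a \<partial>M') \<le> (\<integral>\<^sup>+\<omega>. h (A \<omega>) \<partial>M)" for h
    using nn_integral_distr_le[OF mA, of h] by (simp add: M'_def C_def nn_integral_completion)
  have "ran_algorithm P M' (\<lambda>a. a)"
    unfolding ran_algorithm_def
  proof (intro conjI ballI)
    show "prob_space M'"
      unfolding M'_def by (rule prob_space.prob_space_distr[OF C mA])
    show "det_algorithm P a" if "a \<in> space M'" for a
      using that A by (auto simp: M'_def spN ran_algorithm_def)
    fix f assume f: "f \<in> Fset P"
    have "(\<lambda>\<omega>. cost (A \<omega>) f) \<in> measurable C (count_space UNIV)"
      "(\<lambda>\<omega>. answer (A \<omega>) f) \<in> measurable C (Gborel P)"
      unfolding C_def using A f by (auto simp: ran_algorithm_def intro!: measurable_completion)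
    then show "(\<lambda>a. cost a f) \<in> measurable M' (count_space UNIV)"
      "(\<lambda>a. answer a f) \<in> measurable M' (Gborel P)"
      by (auto simp: M'_def dest: lift)
    obtain H where H: "Gseparable P H" "AE \<omega> in M. answer (A \<omega>) f \<in> H"
      using A f by (auto simp: ran_algorithm_def)
    have "{\<omega>\<in>space C. answer (A \<omega>) f \<in> H} \<in> sets C"
      unfolding C_def
      using sets.sets_Collect_neg[of "completion M" "\<lambda>\<omega>. answer (A \<omega>) f \<notin> H"]
        sets_completion_AE[where M = M and P = "\<lambda>\<omega>. answer (A \<omega>) f \<notin> H"] H(2)
      by (simp add: pred_def)
    moreover have "{\<omega>\<in>space C. answer (A \<omega>) f \<in> H} = A -` {a\<in>space N. answer a f \<in> H} \<inter> space M"
      by (auto simp: spC spN)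
    ultimately have "{a\<in>space N. answer a f \<in> H} \<in> sets N"
      by (auto simp: setsN \<A>_def spN)
    moreover have "AE \<omega> in C. answer (A \<omega>) f \<in> H"
      unfolding C_def using H(2) by (rule AE_completion)
    ultimately have "AE a in M'. answer a f \<in> H"
      unfolding M'_def by (simp add: AE_distr_iff[OF mA])
    then show "\<exists>H. Gseparable P H \<and> (AE a in M'. answer a f \<in> H)"
      using H(1) by blast
  qed
  moreover have "ran_cost P M' (\<lambda>a. a) \<le> ran_cost P M A"
    unfolding ran_cost_def by (rule SUP_mono, erule bexI[rotated], rule intle)
  moreover have "ran_error P M' (\<lambda>a. a) \<le> ran_error P M A"
    unfolding ran_error_def by (rule SUP_mono, erule bexI[rotated], rule intle)
  ultimately show thesis
    using that[of M'] by (simp add: M'_def spN)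
qed

lemma e_ran_le:
  assumes "ran_algorithm P M A" "ran_cost P M A \<le> of_nat n"
  shows "e_ran P n \<le> ran_error P M A"
proof (rule ran_algorithm_transfer[OF assms(1)])
  fix M' assume "ran_algorithm P M' (\<lambda>a. a)" "ran_cost P M' (\<lambda>a. a) \<le> ran_cost P M A"
    and le: "ran_error P M' (\<lambda>a. a) \<le> ran_error P M A"
  then have "e_ran P n \<le> ran_error P M' (\<lambda>a. a)"
    unfolding e_ran_def using assms(2) by (intro Inf_lower CollectI exI conjI) auto
  with le show ?thesis by simp
qed

lemma e_ran_non_le:
  assumes "ran_algorithm P M A" "ran_nonadaptive P M A" "ran_cost P M A \<le> of_nat n"
  shows "e_ran_non P n \<le> ran_error P M A"
proof (rule ran_algorithm_transfer[OF assms(1)])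
  fix M' assume "ran_algorithm P M' (\<lambda>a. a)" "ran_cost P M' (\<lambda>a. a) \<le> ran_cost P M A"
    and le: "ran_error P M' (\<lambda>a. a) \<le> ran_error P M A" and "space M' = A ` space M"
  then have "e_ran_non P n \<le> ran_error P M' (\<lambda>a. a)"
    unfolding e_ran_non_def using assms(2,3)
    by (intro Inf_lower CollectI exI conjI) (auto simp: ran_nonadaptive_def)
  with le show ?thesis by simp
qed


section \<open>The sequence spaces and the embedding problem\<close>

text \<open>The convention \<open>1/\<infinity> = 0\<close> is that of \<^typ>\<open>ereal\<close>.\<close>

definition recip :: "ereal \<Rightarrow> real" where
  "recip p = real_of_ereal (1 / p)"

lemma recip_simps [simp]: "recip \<infinity> = 0" "recip (ereal r) = 1 / r"
  by (auto simp: recip_def divide_ereal_def zero_ereal_def inverse_eq_divide)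

definition Lp_norm :: "ereal \<Rightarrow> nat \<Rightarrow> (nat \<Rightarrow> 'a::real_normed_vector) \<Rightarrow> real" where
  "Lp_norm p N f =
     (if p = \<infinity> then Max ((\<lambda>i. norm (f i)) ` {1..N})
      else (1 / real N * (\<Sum>i=1..N. norm (f i) powr real_of_ereal p)) powr recip p)"

definition mixed_norm ::
  "ereal \<Rightarrow> nat \<Rightarrow> ereal \<Rightarrow> nat \<Rightarrow> (nat \<Rightarrow> nat \<Rightarrow> 'a::real_normed_vector) \<Rightarrow> real" where
  "mixed_norm p N\<^sub>1 u N\<^sub>2 f = Lp_norm p N\<^sub>1 (\<lambda>i. Lp_norm u N\<^sub>2 (f i))"

definition in_ell :: "ereal \<Rightarrow> (nat \<Rightarrow> real) \<Rightarrow> bool" where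
  "in_ell r a \<longleftrightarrow> (if r = \<infinity> then bdd_above (range (\<lambda>k. \<bar>a k\<bar>))
                 else summable (\<lambda>k. \<bar>a k\<bar> powr real_of_ereal r))"

definition ell_norm :: "ereal \<Rightarrow> (nat \<Rightarrow> real) \<Rightarrow> real" where
  "ell_norm r a = (if r = \<infinity> then (SUP k. \<bar>a k\<bar>)
                 else (\<Sum>k. \<bar>a k\<bar> powr real_of_ereal r) powr recip r)"

text \<open>
  The \<open>\<ell>\<^sub>r\<close>-sum of the spaces \<open>L\<^sub>p(L\<^sub>u)\<close> of functions on \<open>{1..2^k} \<times> {1..2^k}\<close>.  The scalar field \<open>K\<close>
  is either the reals or the complex numbers, both regarded as subsets of the complex numbers;
  functions on \<open>{1..2^k} \<times> {1..2^k}\<close> are extended by zero.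
\<close>

definition sum_norm :: "ereal \<Rightarrow> ereal \<Rightarrow> ereal \<Rightarrow> (nat \<Rightarrow> nat \<Rightarrow> nat \<Rightarrow> complex) \<Rightarrow> real" where
  "sum_norm p u r x = ell_norm r (\<lambda>k. mixed_norm p (2^k) u (2^k) (x k))"

definition sum_space ::
  "complex set \<Rightarrow> ereal \<Rightarrow> ereal \<Rightarrow> ereal \<Rightarrow> (nat \<Rightarrow> nat \<Rightarrow> nat \<Rightarrow> complex) set" where
  "sum_space K p u r = {x.
     (\<forall>k i j. x k i j \<in> K) \<and>
     (\<forall>k i j. i \<notin> {1..2^k} \<or> j \<notin> {1..2^k} \<longrightarrow> x k i j = 0) \<and>
     in_ell r (\<lambda>k. mixed_norm p (2^k) u (2^k) (x k))}"

definition embedding :: "real \<Rightarrow> (nat \<Rightarrow> nat \<Rightarrow> nat \<Rightarrow> complex) \<Rightarrow> nat \<Rightarrow> nat \<Rightarrow> nat \<Rightarrow> complex" where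
  "embedding \<alpha> x = (\<lambda>k i j. of_real (2 powr (- \<alpha> * real k)) * x k i j)"

definition embedding_problem ::
  "complex set \<Rightarrow> real \<Rightarrow> ereal \<Rightarrow> ereal \<Rightarrow> ereal \<Rightarrow> ereal \<Rightarrow> ereal \<Rightarrow> ereal \<Rightarrow>
   (nat \<Rightarrow> nat \<Rightarrow> nat \<Rightarrow> complex, nat \<Rightarrow> nat \<Rightarrow> nat \<Rightarrow> complex, complex) num_problem" where
  "embedding_problem K \<alpha> p u p\<^sub>1 q v q\<^sub>1 =
     \<lparr> Fset = {x \<in> sum_space K p u p\<^sub>1. sum_norm p u p\<^sub>1 x \<le> 1},
       Gset = sum_space K q v q\<^sub>1,
       Gnorm = sum_norm q v q\<^sub>1,
       Sol = embedding \<alpha>,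
       Kset = K,
       Info = {\<lambda>x. x k i j | k i j. i \<in> {1..2^k} \<and> j \<in> {1..2^k}} \<rparr>"

end

theory Submission
  imports Defs
begin

text \<open>
  Put \<open>a = 1/p - 1/q\<close> and \<open>b = 1/v - 1/u\<close>; both lie in \<open>(0, 1]\<close>.  On level \<open>k\<close> there are \<open>N\<^sup>2 = 4^k\<close> entries,
  \<open>N = 2^k\<close>, and the identity from \<open>L\<^sub>p(L\<^sub>u)\<close> to \<open>L\<^sub>q(L\<^sub>v)\<close> has norm \<open>N powr a\<close>, attained by functions of constant
  modulus living in one single row.  Since \<open>\<alpha> > a\<close>, the weights make the levels decay geometrically, so a budget
  of \<open>n\<close> entries is spent on the levels with \<open>4^k \<le> n\<close>, and level \<open>k \<approx> (log 2 n)/2\<close> decides the order of the error.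

  \<^bold>\<open>Lower bounds.\<close>  Take a block of entries, put a constant with independent random signs on it and normalise.  An
  entry that is never queried could as well carry the opposite sign with the same answer (\<open>flip_sign\<close>), so the average
  error is at least the norm of the block times the fraction of its entries that escape the algorithm
  (\<open>block_average\<close>).  Averages over finite families of inputs bound randomized errors from below
  (\<open>average_lower_bound\<close>).  The whole level as a block gives \<open>n powr (-\<alpha>/2)\<close>.  A single entry at a random position
  gives the exponent \<open>(a - b - \<alpha>)/2\<close>, because even an adaptive algorithm cannot tell the input from zero
  before it hits the position.  A random row gives \<open>(a - \<alpha>)/2\<close> for nonadaptive algorithms: their queries do not depend
  on the input, hence leave most entries of most rows unseen.

  \<^bold>\<open>Deterministic upper bounds.\<close>  Reading all entries of the first levels and answering zero elsewhere reaches
  \<open>(a - \<alpha>)/2\<close>.  Adaption does not help: restoring the entries that an adaptive algorithm reads on the input zero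
  is a nonadaptive algorithm which is at least as good, by symmetry of the unit ball (\<open>e_det_non_le_e_det\<close>).

  \<^bold>\<open>The adaptive randomized algorithm.\<close>  The bad inputs concentrate in few rows, and adaption can find them.  Levels
  below \<open>(log 2 n)/2\<close> are read completely.  On each of the next levels the algorithm samples \<open>m\<close> random columns
  about \<open>log n\<close> times, estimates the \<open>L\<^sub>v\<close>-norm of every row by the median of the block estimates (\<open>estimate_fine\<close>), and then reads the \<open>m\<close> rows with the
  largest estimates completely.  With high probability
  the estimate is correct up to constants if the \<open>L\<^sub>v\<close>-norm of the row exceeds a multiple of \<open>m powr (-b)\<close> times its \<open>L\<^sub>u\<close>-norm.  Unread rows are therefore of one of two kinds: rows below
  that threshold, which contribute \<open>m powr (-b) * N powr a\<close>, and rows dominated by \<open>m\<close> read ones, whose norms are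
  at most of order \<open>(N/m) powr (1/p)\<close> and contribute \<open>(N/m) powr a\<close> by interpolation (\<open>unselected_norm\<close>).  Taking \<open>m\<close>
  of order \<open>N / log n\<close> near the critical level and decreasing geometrically above it keeps the total cost
  proportional to \<open>n\<close> and, because \<open>\<alpha> > 2\<close>, the total error of the order of the critical level.
\<close>

section \<open>Norms of finite and infinite sequences\<close>

text \<open>
  The unweighted norm over a finite index set.  Both the norm of \<open>L\<^sub>p\<close> on \<open>N\<close> points and the finite sections of
  the norm of a sequence space are of this form, which lets every inequality be proved once.  Inserting \<open>0\<close> in the maximum makes
  the empty family harmless.
\<close>

definition fin_norm :: "ereal \<Rightarrow> 'i set \<Rightarrow> ('i \<Rightarrow> real) \<Rightarrow> real" where
  "fin_norm r S a = (if r = \<infinity> then Max (insert 0 ((\<lambda>i. \<bar>a i\<bar>) ` S))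
                     else (\<Sum>i\<in>S. \<bar>a i\<bar> powr real_of_ereal r) powr recip r)"

lemma exponent_cases:
  assumes "1 \<le> (r::ereal)"
  obtains "r = \<infinity>" | s where "r = ereal s" "1 \<le> s"
  using assms by (cases r) (auto simp: one_ereal_def)

lemma recip_bounds:
  assumes "1 \<le> r" shows "0 \<le> recip r" "recip r \<le> 1"
  using assms by (cases rule: exponent_cases; simp)+

lemma recip_strict_mono: "1 \<le> r \<Longrightarrow> r < s \<Longrightarrow> recip s < recip r"
  by (cases r; cases s) (auto simp: one_ereal_def frac_less2)

lemma fin_norm_nonneg: "finite S \<Longrightarrow> 0 \<le> fin_norm r S a"
  by (simp add: fin_norm_def)

lemma fin_norm_le_iff_inf: "finite S \<Longrightarrow> 0 \<le> c \<Longrightarrow> fin_norm \<infinity> S a \<le> c \<longleftrightarrow> (\<forall>i\<in>S. \<bar>a i\<bar> \<le> c)"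
  by (simp add: fin_norm_def)

lemma fin_norm_coord_inf: "finite S \<Longrightarrow> i \<in> S \<Longrightarrow> \<bar>a i\<bar> \<le> fin_norm \<infinity> S a"
  by (simp add: fin_norm_def)

lemma fin_norm_le_iff:
  assumes "finite S" "0 \<le> c" "1 \<le> r"
  shows "fin_norm (ereal r) S a \<le> c \<longleftrightarrow> (\<Sum>i\<in>S. \<bar>a i\<bar> powr r) \<le> c powr r"
proof -
  define X where "X = (\<Sum>i\<in>S. \<bar>a i\<bar> powr r)"
  have X: "X \<ge> 0" unfolding X_def by (intro sum_nonneg) auto
  have e: "fin_norm (ereal r) S a = X powr (1/r)" by (simp add: fin_norm_def X_def)
  have "X powr (1/r) \<le> c" if "X \<le> c powr r"
  proof -
    have "X powr (1/r) \<le> (c powr r) powr (1/r)" by (intro powr_mono2) (use X that assms in auto)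
    then show ?thesis using assms by (simp add: powr_powr)
  qed
  moreover have "X \<le> c powr r" if "X powr (1/r) \<le> c"
  proof -
    have "(X powr (1/r)) powr r \<le> c powr r" by (intro powr_mono2) (use X that assms in auto)
    then show ?thesis using X assms by (simp add: powr_powr)
  qed
  ultimately show ?thesis unfolding e X_def[symmetric] by blast
qed

lemma fin_norm_powr:
  assumes "1 \<le> r"
  shows "fin_norm (ereal r) S a powr r = (\<Sum>i\<in>S. \<bar>a i\<bar> powr r)"
proof -
  have "(\<Sum>i\<in>S. \<bar>a i\<bar> powr r) \<ge> 0" by (intro sum_nonneg) auto
  then show ?thesis using assms by (simp add: fin_norm_def powr_powr)
qed

lemma fin_norm_mono:
  assumes "finite S" "1 \<le> r" "\<And>i. i \<in> S \<Longrightarrow> \<bar>a i\<bar> \<le> \<bar>b i\<bar>"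
  shows "fin_norm r S a \<le> fin_norm r S b"
  using \<open>1 \<le> r\<close>
proof (cases rule: exponent_cases)
  case 1
  have "\<forall>i\<in>S. \<bar>b i\<bar> \<le> fin_norm \<infinity> S b" 
    using fin_norm_coord_inf[OF assms(1), of _ b] by simp
  then show ?thesis using assms 1
    by (auto simp: fin_norm_le_iff_inf[OF assms(1) fin_norm_nonneg[OF assms(1)]] intro: order_trans)
next
  case (2 s)
  have "(\<Sum>i\<in>S. \<bar>a i\<bar> powr s) \<le> (\<Sum>i\<in>S. \<bar>b i\<bar> powr s)"
    by (intro sum_mono powr_mono2) (use assms 2 in auto)
  then show ?thesis
    using 2 assms by (simp add: fin_norm_le_iff[OF assms(1) fin_norm_nonneg] fin_norm_powr)
qed

lemma fin_norm_coord:
  assumes "finite S" "1 \<le> r" "i \<in> S"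
  shows "\<bar>a i\<bar> \<le> fin_norm r S a"
  using \<open>1 \<le> r\<close>
proof (cases rule: exponent_cases)
  case 1
  then show ?thesis
    using fin_norm_coord_inf[OF assms(1,3)] by simp
next
  case (2 s)
  have "\<bar>a i\<bar> powr s \<le> (\<Sum>i\<in>S. \<bar>a i\<bar> powr s)"
    using assms by (intro member_le_sum) auto
  also have "\<dots> = fin_norm r S a powr s" using 2 fin_norm_powr by metis
  finally show ?thesis using 2 fin_norm_nonneg[OF assms(1), of r a] by (smt (verit) powr_less_mono2 assms(1))
qed

lemma fin_norm_cmult:
  assumes "finite S" "1 \<le> r"
  shows "fin_norm r S (\<lambda>i. c * a i) = \<bar>c\<bar> * fin_norm r S a"
  using \<open>1 \<le> r\<close>
proof (cases rule: exponent_cases)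
  case 1
  have "mono (\<lambda>x. \<bar>c\<bar> * x)" by (auto simp: mono_def mult_left_mono)
  from mono_Max_commute[OF this, of "insert 0 ((\<lambda>i. \<bar>a i\<bar>) ` S)"]
  show ?thesis using assms 1 by (simp add: fin_norm_def image_image abs_mult)
next
  case (2 s)
  have "(\<Sum>i\<in>S. \<bar>c * a i\<bar> powr s) = \<bar>c\<bar> powr s * (\<Sum>i\<in>S. \<bar>a i\<bar> powr s)"
    by (simp add: abs_mult powr_mult sum_distrib_left)
  then show ?thesis using 2 by (simp add: fin_norm_def powr_mult sum_nonneg powr_powr)
qed

text \<open>
  With \<open>t\<close> the sum of all moduli, each summand of the \<open>s\<close>-th power is at most \<open>t powr (s - 1)\<close> times the modulus.
\<close>

lemma fin_norm_le_sum:
  assumes "finite S" "1 \<le> r"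
  shows "fin_norm r S a \<le> (\<Sum>i\<in>S. \<bar>a i\<bar>)"
  using \<open>1 \<le> r\<close>
proof (cases rule: exponent_cases)
  case 1
  then show ?thesis using assms by (auto simp: fin_norm_le_iff_inf sum_nonneg intro!: member_le_sum)
next
  case (2 s)
  define t where "t = (\<Sum>i\<in>S. \<bar>a i\<bar>)"
  have t: "t \<ge> 0" by (simp add: t_def sum_nonneg)
  have "\<bar>a i\<bar> powr s \<le> \<bar>a i\<bar> * t powr (s - 1)" if "i \<in> S" for i
  proof -
    have "\<bar>a i\<bar> \<le> t" unfolding t_def using assms that by (intro member_le_sum) auto
    then have "\<bar>a i\<bar> powr (s - 1) \<le> t powr (s - 1)" using 2 by (intro powr_mono2) auto
    then have "\<bar>a i\<bar> * \<bar>a i\<bar> powr (s - 1) \<le> \<bar>a i\<bar> * t powr (s - 1)" by (intro mult_left_mono) auto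
    moreover have "\<bar>a i\<bar> * \<bar>a i\<bar> powr (s - 1) = \<bar>a i\<bar> powr s" 
      using powr_mult_base[of "\<bar>a i\<bar>" "s - 1"] by simp
    ultimately show ?thesis by simp
  qed
  then have "(\<Sum>i\<in>S. \<bar>a i\<bar> powr s) \<le> (\<Sum>i\<in>S. \<bar>a i\<bar> * t powr (s - 1))" by (rule sum_mono)
  also have "\<dots> = t * t powr (s - 1)" by (simp add: t_def sum_distrib_right)
  also have "\<dots> = t powr s" using powr_mult_base[of t "s - 1"] t by simp
  finally show ?thesis using 2 assms t fin_norm_le_iff[of S t s a] by (simp add: t_def)
qed

lemma powr_convex_nonneg:
  fixes x y :: real
  assumes "1 \<le> s" "0 \<le> x" "0 \<le> y" "0 \<le> t" "t \<le> 1"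
  shows "((1 - t) * x + t * y) powr s \<le> (1 - t) * x powr s + t * y powr s"
proof -
  have *: "(c * z) powr s \<le> c * z powr s" if "0 \<le> c" "c \<le> 1" "0 \<le> z" for c z :: real
  proof (cases "c = 0")
    case False
    have "c powr s \<le> c powr 1" using that assms False by (intro powr_mono') auto
    then show ?thesis using that False by (simp add: powr_mult mult_right_mono)
  qed auto
  consider "x = 0" | "y = 0" | "x > 0" "y > 0" using assms by linarith
  then show ?thesis
  proof cases
    case 3
    then show ?thesis
      using convex_onD[OF powr_convex[OF assms(1)], of t x y] assms by simp
  qed (use *[of t y] *[of "1 - t" x] assms in auto)
qed

text \<open>
  Minkowski's inequality: after dividing both families by their norms, the sum is a multiple of a convex combination of two
  points of the unit ball, and the unit ball is convex because the power function is.
\<close>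

lemma fin_norm_triangle:
  assumes "finite S" "1 \<le> r"
  shows "fin_norm r S (\<lambda>i. a i + b i) \<le> fin_norm r S a + fin_norm r S b"
  using \<open>1 \<le> r\<close>
proof (cases rule: exponent_cases)
  case 1
  have "\<bar>a i + b i\<bar> \<le> fin_norm \<infinity> S a + fin_norm \<infinity> S b" if "i \<in> S" for i
    using fin_norm_coord[OF assms that, of a] fin_norm_coord[OF assms that, of b] 1 by auto
  then show ?thesis
    using 1 fin_norm_nonneg[OF assms(1)] by (simp add: fin_norm_le_iff_inf[OF assms(1)])
next
  case (2 s)
  define A B where "A = fin_norm r S a" and "B = fin_norm r S b"
  have AB: "A \<ge> 0" "B \<ge> 0" by (auto simp: A_def B_def assms fin_norm_nonneg)
  have zero: "c i = 0" if "fin_norm r S c = 0" "i \<in> S" for c i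
    using fin_norm_coord[OF assms that(2), of c] that by simp
  consider "A = 0" | "B = 0" | "A > 0" "B > 0" using AB by linarith
  then show ?thesis
  proof cases
    case 1
    then have "fin_norm r S (\<lambda>i. a i + b i) \<le> fin_norm r S b"
      using zero[of a] by (intro fin_norm_mono assms) (auto simp: A_def)
    then show ?thesis using AB 1 by (simp add: A_def)
  next
    case 2
    then have "fin_norm r S (\<lambda>i. a i + b i) \<le> fin_norm r S a"
      using zero[of b] by (intro fin_norm_mono assms) (auto simp: B_def)
    then show ?thesis using AB 2 by (simp add: B_def)
  next
    case 3
    define t where "t = B / (A + B)"
    have t: "0 \<le> t" "t \<le> 1" "1 - t = A / (A + B)"
      using 3 by (auto simp: t_def field_simps)
    have "\<bar>a i + b i\<bar> powr s \<le> (A + B) powr s * ((1 - t) * (\<bar>a i\<bar> / A) powr s + t * (\<bar>b i\<bar> / B) powr s)" for i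
    proof -
      have "\<bar>a i + b i\<bar> \<le> (A + B) * ((1 - t) * (\<bar>a i\<bar> / A) + t * (\<bar>b i\<bar> / B))"
        using 3 by (simp add: t(3)) (simp add: t_def distrib_left)
      then have "\<bar>a i + b i\<bar> powr s \<le> ((A + B) * ((1 - t) * (\<bar>a i\<bar> / A) + t * (\<bar>b i\<bar> / B))) powr s"
        using 2 by (intro powr_mono2) auto
      also have "\<dots> = (A + B) powr s * ((1 - t) * (\<bar>a i\<bar> / A) + t * (\<bar>b i\<bar> / B)) powr s"
        using 3 t by (simp add: powr_mult)
      also have "\<dots> \<le> (A + B) powr s * ((1 - t) * (\<bar>a i\<bar> / A) powr s + t * (\<bar>b i\<bar> / B) powr s)"
        using 2 3 t by (intro mult_left_mono powr_convex_nonneg) auto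
      finally show ?thesis .
    qed
    then have "(\<Sum>i\<in>S. \<bar>a i + b i\<bar> powr s)
      \<le> (\<Sum>i\<in>S. (A + B) powr s * ((1 - t) * (\<bar>a i\<bar> / A) powr s + t * (\<bar>b i\<bar> / B) powr s))"
      by (rule sum_mono)
    also have "\<dots> = (A + B) powr s * ((1 - t) * ((\<Sum>i\<in>S. \<bar>a i\<bar> powr s) / A powr s)
        + t * ((\<Sum>i\<in>S. \<bar>b i\<bar> powr s) / B powr s))"
      using 3 by (simp add: powr_divide sum.distrib sum_distrib_left[symmetric] sum_divide_distrib[symmetric])
    also have "\<dots> = (A + B) powr s"
      using 3 2 by (simp add: fin_norm_powr[symmetric] A_def B_def)
    finally show ?thesis
      using 2 AB by (simp add: fin_norm_le_iff[OF assms(1)] A_def B_def)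
  qed
qed

text \<open>
  Normalised norms increase with the exponent.  For finite exponents this is Young's inequality, applied to families
  that are scaled to norm one.
\<close>

lemma fin_norm_power_mean:
  assumes "finite S" "S \<noteq> {}" "1 \<le> p" "p \<le> q"
  shows "(1 / card S) powr recip p * fin_norm p S a \<le> (1 / card S) powr recip q * fin_norm q S a"
proof -
  have n: "real (card S) > 0" using assms by (simp add: card_gt_0_iff)
  have q: "1 \<le> q" using assms by simp
  define w where "w = fin_norm q S a"
  have w: "w \<ge> 0" using assms by (simp add: w_def fin_norm_nonneg)
  have main: "fin_norm p S a \<le> real (card S) powr (recip p - recip q) * w"
  proof (cases "w = 0")
    case True
    then have "a i = 0" if "i \<in> S" for i
      using fin_norm_coord[OF assms(1) q that, of a] by (simp add: w_def)
    then have "fin_norm p S a \<le> fin_norm p S (\<lambda>i. 0 * a i)" by (intro fin_norm_mono assms) auto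
    also have "\<dots> = 0" using fin_norm_cmult[of S p 0 a] assms by simp
    finally show ?thesis using True by simp
  next
    case False
    with w have w0: "w > 0" by simp
    show ?thesis using \<open>1 \<le> p\<close>
    proof (cases rule: exponent_cases)
      case 1
      then show ?thesis using assms n by (simp add: w_def)
    next
      case p: (2 s)
      show ?thesis using q
      proof (cases rule: exponent_cases)
        case 1
        have "(\<Sum>i\<in>S. \<bar>a i\<bar> powr s) \<le> (\<Sum>i\<in>S. w powr s)"
          using fin_norm_coord[OF assms(1) q, of _ a] p
          by (intro sum_mono powr_mono2) (auto simp: w_def)
        also have "\<dots> = (real (card S) powr (1/s) * w) powr s"
          using n w p by (simp add: powr_mult powr_powr)
        finally show ?thesis using 1 p w by (simp add: fin_norm_le_iff[OF assms(1)])
      next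
        case (2 t)
        have st: "s \<le> t" "1 \<le> s" "1 \<le> t" using assms 2 p by auto
        define c where "c = w / real (card S) powr (1/t)"
        have c: "c > 0" using w0 n by (simp add: c_def)
        \<comment> \<open>Young's inequality for the exponents \<open>t / s\<close> and its conjugate, applied after normalising.\<close>
        have young: "(\<bar>a i\<bar> / c) powr s \<le> (s/t) * (\<bar>a i\<bar> / c) powr t + (1 - s/t)" for i
        proof (cases "a i = 0")
          case False
          then show ?thesis
            using Youngs_inequality_0[of "s/t" "1 - s/t" "(\<bar>a i\<bar> / c) powr t" 1] st c
            by (simp add: powr_powr)
        qed (use st in auto)
        have "(\<Sum>i\<in>S. \<bar>a i\<bar> powr s) = c powr s * (\<Sum>i\<in>S. (\<bar>a i\<bar> / c) powr s)"
          using c by (simp add: powr_divide sum_divide_distrib[symmetric])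
        also have "\<dots> \<le> c powr s * (\<Sum>i\<in>S. (s/t) * (\<bar>a i\<bar> / c) powr t + (1 - s/t))"
          by (intro mult_left_mono sum_mono young) auto
        also have "(\<Sum>i\<in>S. (s/t) * (\<bar>a i\<bar> / c) powr t + (1 - s/t))
            = (s/t) * (w powr t / c powr t) + real (card S) * (1 - s/t)"
          using 2 c by (simp add: w_def fin_norm_powr sum.distrib powr_divide
              sum_distrib_left[symmetric] sum_divide_distrib[symmetric])
        also have "w powr t / c powr t = real (card S)"
          using w0 n st by (simp add: c_def powr_divide powr_powr)
        also have "(s/t) * real (card S) + real (card S) * (1 - s/t) = real (card S)"
          by (simp add: algebra_simps)
        also have "c powr s * real (card S) = (real (card S) powr (1/s - 1/t) * w) powr s"
          using n w0 st by (simp add: c_def powr_mult powr_divide powr_powr left_diff_distrib powr_diff)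
        finally show ?thesis using 2 p w by (simp add: fin_norm_le_iff[OF assms(1)])
      qed
    qed
  qed
  have "(1 / card S) powr recip p * fin_norm p S a
      \<le> (1 / card S) powr recip p * (real (card S) powr (recip p - recip q) * w)"
    by (intro mult_left_mono main) auto
  also have "\<dots> = (1 / card S) powr recip q * w"
    using n by (simp add: powr_divide powr_diff)
  finally show ?thesis by (simp add: w_def)
qed

lemma fin_norm_interpolate:
  assumes "finite S" "1 \<le> p" "p < q" "\<And>i. i \<in> S \<Longrightarrow> \<bar>a i\<bar> \<le> T" "0 < T"
  shows "fin_norm q S a \<le> T powr (1 - recip q / recip p) * fin_norm p S a powr (recip q / recip p)"
proof -
  obtain s where p: "p = ereal s" "1 \<le> s"
    using assms(2,3) by (cases p) (auto simp: one_ereal_def)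
  have q: "1 \<le> q" using assms by simp
  show ?thesis using q
  proof (cases rule: exponent_cases)
    case 1
    show ?thesis
    proof (cases "fin_norm p S a = 0")
      case True
      then have "\<bar>a i\<bar> \<le> 0" if "i \<in> S" for i
        using fin_norm_coord[OF assms(1,2) that, of a] by simp
      then show ?thesis using 1 True assms by (simp add: fin_norm_le_iff_inf)
    next
      case False
      then show ?thesis using 1 assms fin_norm_nonneg[OF assms(1), of p a]
        by (simp add: fin_norm_le_iff_inf)
    qed
  next
    case (2 t)
    have st: "s < t" using p 2 assms by simp
    have "\<bar>a i\<bar> powr t \<le> T powr (t - s) * \<bar>a i\<bar> powr s" if "i \<in> S" for i
    proof -
      have "\<bar>a i\<bar> powr t = \<bar>a i\<bar> powr (t - s) * \<bar>a i\<bar> powr s" by (simp add: powr_add[symmetric])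
      also have "\<dots> \<le> T powr (t - s) * \<bar>a i\<bar> powr s"
        using assms(4)[OF that] st by (intro mult_right_mono powr_mono2) auto
      finally show ?thesis .
    qed
    then have "(\<Sum>i\<in>S. \<bar>a i\<bar> powr t) \<le> (\<Sum>i\<in>S. T powr (t - s) * \<bar>a i\<bar> powr s)" by (rule sum_mono)
    also have "\<dots> = T powr (t - s) * fin_norm p S a powr s"
      using p by (simp add: fin_norm_powr sum_distrib_left)
    also have "\<dots> = (T powr (1 - s / t) * fin_norm p S a powr (s / t)) powr t"
      using p 2 st assms fin_norm_nonneg[OF assms(1), of p a]
      by (simp add: powr_mult powr_powr left_diff_distrib)
    finally show ?thesis
      using 2 p assms fin_norm_nonneg[OF assms(1), of p a]
      by (simp add: fin_norm_le_iff[OF assms(1)] divide_divide_eq_left)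
  qed
qed

lemma Lp_norm_fin_norm:
  assumes "1 \<le> N" "1 \<le> p"
  shows "Lp_norm p N f = (1 / real N) powr recip p * fin_norm p {1..N} (\<lambda>i. norm (f i))"
  using \<open>1 \<le> p\<close>
proof (cases rule: exponent_cases)
  case 1
  have "Max (insert 0 ((\<lambda>i. norm (f i)) ` {1..N})) = max 0 (Max ((\<lambda>i. norm (f i)) ` {1..N}))"
    using assms by (intro Max_insert) auto
  also have "\<dots> = Max ((\<lambda>i. norm (f i)) ` {1..N})"
    using assms by (intro max_absorb2) (auto simp: Max_ge_iff)
  finally show ?thesis using 1 assms by (simp add: Lp_norm_def fin_norm_def)
next
  case (2 s)
  then show ?thesis by (simp add: Lp_norm_def fin_norm_def powr_divide sum_nonneg)
qed

lemma Lp_norm_nonneg: "1 \<le> N \<Longrightarrow> 1 \<le> p \<Longrightarrow> 0 \<le> Lp_norm p N f"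
  by (simp add: Lp_norm_fin_norm fin_norm_nonneg)

lemma Lp_norm_mono:
  assumes "1 \<le> N" "1 \<le> p" "\<And>i. i \<in> {1..N} \<Longrightarrow> norm (f i) \<le> norm (g i)"
  shows "Lp_norm p N f \<le> Lp_norm p N g"
  using assms by (auto simp: Lp_norm_fin_norm intro!: mult_left_mono fin_norm_mono)

lemma Lp_norm_cong:
  assumes "1 \<le> N" "1 \<le> p" "\<And>i. i \<in> {1..N} \<Longrightarrow> norm (f i) = norm (g i)"
  shows "Lp_norm p N f = Lp_norm p N g"
  using assms by (intro antisym Lp_norm_mono) auto

lemma Lp_norm_scale:
  assumes "1 \<le> N" "1 \<le> p" "\<And>i. i \<in> {1..N} \<Longrightarrow> norm (f i) = \<bar>c\<bar> * norm (g i)"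
  shows "Lp_norm p N f = \<bar>c\<bar> * Lp_norm p N g"
proof -
  have "fin_norm p {1..N} (\<lambda>i. norm (f i)) = fin_norm p {1..N} (\<lambda>i. c * norm (g i))"
    using assms by (intro antisym fin_norm_mono) (auto simp: abs_mult)
  then show ?thesis using assms by (simp add: Lp_norm_fin_norm fin_norm_cmult)
qed

lemma Lp_norm_triangle:
  assumes "1 \<le> N" "1 \<le> p" "\<And>i. i \<in> {1..N} \<Longrightarrow> norm (f i) \<le> norm (g i) + norm (h i)"
  shows "Lp_norm p N f \<le> Lp_norm p N g + Lp_norm p N h"
proof -
  have "fin_norm p {1..N} (\<lambda>i. norm (f i)) \<le> fin_norm p {1..N} (\<lambda>i. norm (g i) + norm (h i))"
    using assms by (intro fin_norm_mono) auto
  also have "\<dots> \<le> fin_norm p {1..N} (\<lambda>i. norm (g i)) + fin_norm p {1..N} (\<lambda>i. norm (h i))"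
    using assms by (intro fin_norm_triangle) auto
  finally show ?thesis using assms
    by (simp add: Lp_norm_fin_norm mult_left_mono flip: distrib_left)
qed

lemma Lp_norm_exponent_mono:
  assumes "1 \<le> N" "1 \<le> p" "p \<le> q"
  shows "Lp_norm p N f \<le> Lp_norm q N f"
  using fin_norm_power_mean[of "{1..N}" p q "\<lambda>i. norm (f i)"] assms
  by (simp add: Lp_norm_fin_norm)

lemma Lp_norm_coord:
  assumes "1 \<le> N" "1 \<le> p" "i \<in> {1..N}"
  shows "norm (f i) \<le> real N powr recip p * Lp_norm p N f"
proof -
  have "norm (f i) \<le> fin_norm p {1..N} (\<lambda>i. norm (f i))"
    using fin_norm_coord[of "{1..N}" p i "\<lambda>i. norm (f i)"] assms by simp
  then show ?thesis using assms by (simp add: Lp_norm_fin_norm powr_divide)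
qed

lemma Lp_norm_powr:
  assumes "1 \<le> N" "1 \<le> s"
  shows "Lp_norm (ereal s) N f powr s = (\<Sum>i=1..N. norm (f i) powr s) / real N"
  using assms by (simp add: Lp_norm_fin_norm powr_mult fin_norm_powr fin_norm_nonneg powr_powr)

text \<open>
  Interpolation between \<open>L\<^sub>p\<close> and \<open>L\<^sub>\<infinity>\<close>.  With the trivial bound \<open>T = N powr (1/p)\<close> this is the norm of the
  embedding; with the smaller bound that holds for the rows left unread it is the gain of the adaptive algorithm.
\<close>

lemma Lp_norm_interpolate:
  assumes "1 \<le> N" "1 \<le> p" "p < q" "\<And>i. i \<in> {1..N} \<Longrightarrow> norm (f i) \<le> T" "0 < T"
    and "Lp_norm p N f \<le> 1"
  shows "Lp_norm q N f \<le> T powr (1 - recip q / recip p)"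
proof -
  define P where "P = fin_norm p {1..N} (\<lambda>i. norm (f i))"
  obtain s where p: "p = ereal s" "1 \<le> s"
    using assms(2,3) by (cases p) (auto simp: one_ereal_def)
  have q: "1 \<le> q" using assms by simp
  have rp: "recip p > 0" using p by simp
  have rq: "recip q \<ge> 0" by (rule recip_bounds[OF q])
  have P: "0 \<le> P" "P \<le> real N powr recip p"
    using assms by (auto simp: P_def fin_norm_nonneg Lp_norm_fin_norm powr_divide field_simps)
  have "Lp_norm q N f = (1 / real N) powr recip q * fin_norm q {1..N} (\<lambda>i. norm (f i))"
    using assms q by (simp add: Lp_norm_fin_norm)
  also have "\<dots> \<le> (1 / real N) powr recip q * (T powr (1 - recip q / recip p) * P powr (recip q / recip p))"
    unfolding P_def using assms by (intro mult_left_mono fin_norm_interpolate) auto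
  also have "P powr (recip q / recip p) \<le> (real N powr recip p) powr (recip q / recip p)"
    using P rp rq by (intro powr_mono2) auto
  also have "(real N powr recip p) powr (recip q / recip p) = real N powr recip q"
    using rp by (simp add: powr_powr)
  also have "(1 / real N) powr recip q * (T powr (1 - recip q / recip p) * real N powr recip q)
      = T powr (1 - recip q / recip p)"
    using assms by (simp add: powr_divide)
  finally show ?thesis by (simp add: mult_left_mono)
qed

lemma Lp_norm_embedding:
  assumes "1 \<le> N" "1 \<le> p" "p < q"
  shows "Lp_norm q N f \<le> real N powr (recip p - recip q) * Lp_norm p N f"
proof -
  have q: "1 \<le> q" using assms by simp
  have rp: "recip p > 0" using assms by (cases p) (auto simp: one_ereal_def)
  define c where "c = Lp_norm p N f"
  have c0: "c \<ge> 0" using assms by (simp add: c_def Lp_norm_nonneg)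
  show ?thesis
  proof (cases "c = 0")
    case True
    then have "norm (f i) \<le> 0" if "i \<in> {1..N}" for i
      using Lp_norm_coord[OF assms(1,2) that, of f] by (simp add: c_def)
    then have "Lp_norm q N f = \<bar>0\<bar> * Lp_norm q N f" using assms q by (intro Lp_norm_scale) auto
    then show ?thesis using True by (simp add: c_def)
  next
    case False
    with c0 have c: "c > 0" by simp
    let ?g = "\<lambda>i. norm (f i) / c"
    have g: "Lp_norm r N f = \<bar>c\<bar> * Lp_norm r N ?g" if "1 \<le> r" for r
      using c that assms by (intro Lp_norm_scale) auto
    have 1: "Lp_norm p N ?g = 1" using g[of p] assms c by (simp add: c_def)
    have "Lp_norm q N ?g \<le> (real N powr recip p) powr (1 - recip q / recip p)"
    proof (rule Lp_norm_interpolate[of N p q ?g])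
      show "norm (?g i) \<le> real N powr recip p" if "i \<in> {1..N}" for i
        using Lp_norm_coord[OF assms(1,2) that, of ?g] 1 by simp
    qed (use assms 1 in auto)
    also have "\<dots> = real N powr (recip p - recip q)"
      using rp by (simp add: powr_powr right_diff_distrib)
    finally show ?thesis using g[OF q] c by (simp add: mult.commute c_def[symmetric])
  qed
qed

lemma mixed_norm_nonneg:
  "1 \<le> N \<Longrightarrow> 1 \<le> p \<Longrightarrow> 1 \<le> M \<Longrightarrow> 0 \<le> mixed_norm p N u M f"
  by (simp add: mixed_norm_def Lp_norm_nonneg)

lemma mixed_norm_mono:
  assumes "1 \<le> N" "1 \<le> p" "1 \<le> M" "1 \<le> u"
    and "\<And>i j. i \<in> {1..N} \<Longrightarrow> j \<in> {1..M} \<Longrightarrow> norm (f i j) \<le> norm (g i j)"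
  shows "mixed_norm p N u M f \<le> mixed_norm p N u M g"
  unfolding mixed_norm_def using assms
  by (intro Lp_norm_mono) (auto simp: Lp_norm_nonneg intro!: Lp_norm_mono)

lemma mixed_norm_scale:
  assumes "1 \<le> N" "1 \<le> p" "1 \<le> M" "1 \<le> u"
    and "\<And>i j. i \<in> {1..N} \<Longrightarrow> j \<in> {1..M} \<Longrightarrow> norm (f i j) = \<bar>c\<bar> * norm (g i j)"
  shows "mixed_norm p N u M f = \<bar>c\<bar> * mixed_norm p N u M g"
proof -
  have "Lp_norm u M (f i) = \<bar>c\<bar> * Lp_norm u M (g i)" if "i \<in> {1..N}" for i
    using assms that by (intro Lp_norm_scale) auto
  then show ?thesis
    unfolding mixed_norm_def using assms
    by (intro Lp_norm_scale) (auto simp: Lp_norm_nonneg)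
qed

lemma mixed_norm_triangle:
  assumes "1 \<le> N" "1 \<le> p" "1 \<le> M" "1 \<le> u"
    and "\<And>i j. i \<in> {1..N} \<Longrightarrow> j \<in> {1..M} \<Longrightarrow> norm (f i j) \<le> norm (g i j) + norm (h i j)"
  shows "mixed_norm p N u M f \<le> mixed_norm p N u M g + mixed_norm p N u M h"
  unfolding mixed_norm_def using assms
  by (intro Lp_norm_triangle) (auto simp: Lp_norm_nonneg intro!: Lp_norm_triangle)

lemma mixed_norm_embedding:
  assumes "1 \<le> N" "1 \<le> p" "p < q" "1 \<le> M" "1 \<le> v" "v \<le> u"
  shows "mixed_norm q N v M f \<le> real N powr (recip p - recip q) * mixed_norm p N u M f"
proof -
  have "mixed_norm q N v M f \<le> real N powr (recip p - recip q) * mixed_norm p N v M f"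
    unfolding mixed_norm_def using assms by (intro Lp_norm_embedding) auto
  also have "mixed_norm p N v M f \<le> mixed_norm p N u M f"
    unfolding mixed_norm_def using assms
    by (intro Lp_norm_mono) (auto simp: Lp_norm_nonneg intro!: Lp_norm_exponent_mono)
  finally show ?thesis by (simp add: mult_left_mono)
qed

text \<open>
  A sequence lies in a ball of the sequence space if and only if its finite sections do; the other properties of
  the norm of a sequence space are read off from the finite case.
\<close>

lemma ell_norm_le_iff:
  assumes "1 \<le> r" "0 \<le> c"
  shows "in_ell r a \<and> ell_norm r a \<le> c \<longleftrightarrow> (\<forall>n. fin_norm r {..<n} a \<le> c)"
  using \<open>1 \<le> r\<close>
proof (cases rule: exponent_cases)
  case 1
  show ?thesis
  proof
    assume L: "in_ell r a \<and> ell_norm r a \<le> c"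
    then have "\<bar>a k\<bar> \<le> c" for k
      using 1 cSUP_upper[of k UNIV "\<lambda>k. \<bar>a k\<bar>"] by (auto simp: in_ell_def ell_norm_def)
    then show "\<forall>n. fin_norm r {..<n} a \<le> c"
      using 1 assms by (simp add: fin_norm_le_iff_inf)
  next
    assume R: "\<forall>n. fin_norm r {..<n} a \<le> c"
    have "\<bar>a k\<bar> \<le> c" for k
      using R[rule_format, of "Suc k"] 1 assms by (simp add: fin_norm_le_iff_inf)
    then show "in_ell r a \<and> ell_norm r a \<le> c"
      using 1 by (auto simp: in_ell_def ell_norm_def bdd_above_def intro!: cSUP_least)
  qed
next
  case (2 s)
  have key: "X powr (1/s) \<le> c \<longleftrightarrow> X \<le> c powr s" if "X \<ge> 0" for X
    using fin_norm_le_iff[of "{()}" c s "\<lambda>_. X powr (1/s)"] that assms 2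
    by (simp add: fin_norm_def powr_powr)
  show ?thesis
  proof
    assume L: "in_ell r a \<and> ell_norm r a \<le> c"
    then have s: "summable (\<lambda>k. \<bar>a k\<bar> powr s)" using 2 by (simp add: in_ell_def)
    have "(\<Sum>k. \<bar>a k\<bar> powr s) \<le> c powr s"
      using L 2 key[of "\<Sum>k. \<bar>a k\<bar> powr s"] s by (simp add: ell_norm_def suminf_nonneg)
    moreover have "(\<Sum>k<n. \<bar>a k\<bar> powr s) \<le> (\<Sum>k. \<bar>a k\<bar> powr s)" for n
      using s by (intro sum_le_suminf) auto
    ultimately show "\<forall>n. fin_norm r {..<n} a \<le> c"
      using 2 assms by (auto simp: fin_norm_le_iff intro: order_trans)
  next
    assume "\<forall>n. fin_norm r {..<n} a \<le> c"
    then have R: "(\<Sum>k<n. \<bar>a k\<bar> powr s) \<le> c powr s" for n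
      using 2 assms by (simp add: fin_norm_le_iff)
    have s: "summable (\<lambda>k. \<bar>a k\<bar> powr s)"
      by (rule summableI_nonneg_bounded[of _ "c powr s"]) (use R in auto)
    have "(\<Sum>k. \<bar>a k\<bar> powr s) \<le> c powr s"
      by (rule suminf_le_const[OF s]) (use R in auto)
    then show "in_ell r a \<and> ell_norm r a \<le> c"
      using s 2 key[of "\<Sum>k. \<bar>a k\<bar> powr s"] by (simp add: in_ell_def ell_norm_def suminf_nonneg)
  qed
qed

lemma ell_norm_nonneg:
  assumes "1 \<le> r" "in_ell r a" shows "0 \<le> ell_norm r a"
  using \<open>1 \<le> r\<close>
proof (cases rule: exponent_cases)
  case 1
  then have "\<bar>a 0\<bar> \<le> ell_norm r a" using assms by (auto simp: in_ell_def ell_norm_def intro: cSUP_upper)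
  then show ?thesis by linarith
qed (auto simp: ell_norm_def)

lemma fin_norm_le_ell_norm:
  assumes "1 \<le> r" "in_ell r a"
  shows "fin_norm r {..<n} a \<le> ell_norm r a"
  using ell_norm_le_iff[OF assms(1) ell_norm_nonneg[OF assms], of a] assms by simp

lemma ell_norm_coord:
  assumes "1 \<le> r" "in_ell r a" shows "\<bar>a k\<bar> \<le> ell_norm r a"
  using fin_norm_coord[of "{..<Suc k}" r k a] fin_norm_le_ell_norm[OF assms, of "Suc k"] assms by simp

lemma ell_norm_mono:
  assumes "1 \<le> r" "in_ell r b" "\<And>k. \<bar>a k\<bar> \<le> \<bar>b k\<bar>"
  shows "in_ell r a" "ell_norm r a \<le> ell_norm r b"
proof -
  have "fin_norm r {..<n} a \<le> ell_norm r b" for n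
    using fin_norm_mono[of "{..<n}" r a b] fin_norm_le_ell_norm[OF assms(1,2), of n] assms by fastforce
  then show "in_ell r a" "ell_norm r a \<le> ell_norm r b"
    using ell_norm_le_iff[OF assms(1) ell_norm_nonneg[OF assms(1,2)], of a] by auto
qed

lemma ell_norm_triangle:
  assumes "1 \<le> r" "in_ell r a" "in_ell r b" "\<And>k. \<bar>c k\<bar> \<le> \<bar>a k\<bar> + \<bar>b k\<bar>"
  shows "in_ell r c" "ell_norm r c \<le> ell_norm r a + ell_norm r b"
proof -
  have "fin_norm r {..<n} c \<le> ell_norm r a + ell_norm r b" for n
  proof -
    have abs: "fin_norm r {..<n} (\<lambda>k. \<bar>f k\<bar>) \<le> fin_norm r {..<n} f" for f
      using assms by (intro fin_norm_mono) auto
    have "fin_norm r {..<n} c \<le> fin_norm r {..<n} (\<lambda>k. \<bar>a k\<bar> + \<bar>b k\<bar>)"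
      using assms by (intro fin_norm_mono) auto
    also have "\<dots> \<le> fin_norm r {..<n} (\<lambda>k. \<bar>a k\<bar>) + fin_norm r {..<n} (\<lambda>k. \<bar>b k\<bar>)"
      using assms by (intro fin_norm_triangle) auto
    also have "\<dots> \<le> ell_norm r a + ell_norm r b"
      using abs[of a] abs[of b] fin_norm_le_ell_norm[OF assms(1,2), of n]
        fin_norm_le_ell_norm[OF assms(1,3), of n] by linarith
    finally show ?thesis .
  qed
  then show "in_ell r c" "ell_norm r c \<le> ell_norm r a + ell_norm r b"
    using ell_norm_le_iff[of r "ell_norm r a + ell_norm r b" c]
      ell_norm_nonneg[OF assms(1,2)] ell_norm_nonneg[OF assms(1,3)] assms(1) by auto
qed

lemma ell_norm_cmult:
  assumes "1 \<le> r" "in_ell r a" "\<And>k. \<bar>b k\<bar> = c * \<bar>a k\<bar>" "0 \<le> c"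
  shows "in_ell r b" "ell_norm r b \<le> c * ell_norm r a"
proof -
  have "fin_norm r {..<n} b \<le> c * ell_norm r a" for n
  proof -
    have "fin_norm r {..<n} b \<le> fin_norm r {..<n} (\<lambda>k. c * a k)"
      using assms by (intro fin_norm_mono) (auto simp: abs_mult)
    also have "\<dots> \<le> c * ell_norm r a"
      using assms fin_norm_le_ell_norm[OF assms(1,2), of n] by (simp add: fin_norm_cmult mult_left_mono)
    finally show ?thesis .
  qed
  then show "in_ell r b" "ell_norm r b \<le> c * ell_norm r a"
    using ell_norm_le_iff[of r "c * ell_norm r a" b] ell_norm_nonneg[OF assms(1,2)] assms by auto
qed

lemma ell_norm_le_suminf:
  assumes "1 \<le> r" "summable c" "\<And>k. \<bar>a k\<bar> \<le> c k"
  shows "in_ell r a" "ell_norm r a \<le> (\<Sum>k. c k)"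
proof -
  have c0: "0 \<le> c k" for k using assms(3)[of k] by linarith
  have "fin_norm r {..<n} a \<le> (\<Sum>k. c k)" for n
  proof -
    have "fin_norm r {..<n} a \<le> (\<Sum>k<n. \<bar>a k\<bar>)" using assms by (intro fin_norm_le_sum) auto
    also have "\<dots> \<le> (\<Sum>k<n. c k)" using assms by (intro sum_mono) auto
    also have "\<dots> \<le> (\<Sum>k. c k)" using assms c0 by (intro sum_le_suminf) auto
    finally show ?thesis .
  qed
  then show "in_ell r a" "ell_norm r a \<le> (\<Sum>k. c k)"
    using ell_norm_le_iff[of r "\<Sum>k. c k" a] suminf_nonneg[OF assms(2) c0] assms by auto
qed

section \<open>Geometric series\<close>

lemma summable_decay:
  assumes "c < 0" shows "summable (\<lambda>k. 2 powr (c * real k))"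
proof -
  have "summable (\<lambda>k. (2 powr c) ^ k)"
    using assms by (intro summable_geometric) (simp add: powr_less_one)
  then show ?thesis by (simp add: powr_powr[symmetric] powr_realpow)
qed

lemma tail_decay:
  assumes "c < 0"
  shows "summable (\<lambda>l. if l < k then 0 else 2 powr (c * real l))"
    and "(\<Sum>l. if l < k then 0 else 2 powr (c * real l)) = 2 powr (c * real k) * (\<Sum>l. 2 powr (c * real l))"
proof -
  let ?t = "\<lambda>l. if l < k then 0 else 2 powr (c * real l)"
  note s = summable_decay[OF assms]
  show t: "summable ?t" by (rule summable_comparison_test'[OF s, of 0]) auto
  have "(\<Sum>l. ?t l) = (\<Sum>l. ?t (l + k))"
    using suminf_split_initial_segment[OF t, of k] by simp
  also have "\<dots> = (\<Sum>l. 2 powr (c * real k) * 2 powr (c * real l))"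
    by (simp add: powr_add[symmetric] algebra_simps)
  also have "\<dots> = 2 powr (c * real k) * (\<Sum>l. 2 powr (c * real l))" by (rule suminf_mult[OF s])
  finally show "(\<Sum>l. ?t l) = 2 powr (c * real k) * (\<Sum>l. 2 powr (c * real l))" .
qed

section \<open>Runs of deterministic algorithms\<close>

definition queried :: "('f, 'g, 'k) algorithm \<Rightarrow> 'f \<Rightarrow> ('f \<Rightarrow> 'k) set" where
  "queried A f = {query A (info A f l) | l. enat l < cost A f}"

lemma length_info [simp]: "length (info A f n) = n"
  by (induction n) auto

lemma take_info: "l \<le> n \<Longrightarrow> take l (info A f n) = info A f l"
  by (induction n) (auto simp: le_Suc_eq)

lemma nth_info: "l < n \<Longrightarrow> info A f n ! l = query A (info A f l) f"
  by (induction n) (auto simp: nth_append less_Suc_eq)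

lemma cost_eq_enat_iff:
  "cost A f = enat n \<longleftrightarrow> stop A (info A f n) \<and> (\<forall>l<n. \<not> stop A (info A f l))"
proof
  assume c: "cost A f = enat n"
  then have ex: "\<exists>n. stop A (info A f n)" and n: "n = (LEAST n. stop A (info A f n))"
    by (auto simp: cost_def split: if_splits)
  show "stop A (info A f n) \<and> (\<forall>l<n. \<not> stop A (info A f l))"
    using LeastI_ex[OF ex] not_less_Least n by blast
next
  assume "stop A (info A f n) \<and> (\<forall>l<n. \<not> stop A (info A f l))"
  then have "(LEAST n. stop A (info A f n)) = n" "\<exists>n. stop A (info A f n)"
    by (auto intro!: Least_equality simp: not_less[symmetric])
  then show "cost A f = enat n" by (simp add: cost_def)
qed

lemma cost_eq_infinity_iff: "cost A f = \<infinity> \<longleftrightarrow> (\<forall>n. \<not> stop A (info A f n))"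
  by (simp add: cost_def)

lemma answer_enat: "cost A f = enat n \<Longrightarrow> answer A f = result A (info A f n)"
  by (simp add: answer_def)

lemma answer_infinity: "cost A f = \<infinity> \<Longrightarrow> answer A f = result A []"
  by (simp add: answer_def)

text \<open>
  The input enters a run only through the queried values: by induction on the steps, two inputs with the same
  queried values produce the same run.  All lower bounds rest on this.
\<close>

lemma run_determined_by_queried:
  assumes "\<And>L. L \<in> queried A f \<Longrightarrow> L g = L f"
  shows "cost A g = cost A f" "answer A g = answer A f" "queried A g = queried A f"
proof -
  have info: "info A g l = info A f l" if "enat l \<le> cost A f" for l
    using that
  proof (induction l)
    case (Suc l)
    then have l: "enat l < cost A f" by (metis Suc_ile_eq)
    then have "query A (info A f l) \<in> queried A f" by (auto simp: queried_def)
    then show ?case using Suc.IH l assms by simp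
  qed simp
  show cost: "cost A g = cost A f"
  proof (cases "cost A f")
    case (enat n)
    then have "info A g l = info A f l" if "l \<le> n" for l using info that by simp
    then have "cost A g = enat n" using enat by (simp add: cost_eq_enat_iff)
    then show ?thesis using enat by simp
  next
    case infinity
    then have "info A g l = info A f l" for l using info by simp
    then have "cost A g = \<infinity>" using infinity by (simp add: cost_eq_infinity_iff)
    then show ?thesis using infinity by simp
  qed
  show "answer A g = answer A f"
    using cost info by (cases "cost A f") (auto simp: answer_enat answer_infinity)
  show "queried A g = queried A f"
    using cost info unfolding queried_def by (metis (no_types, lifting) order_less_imp_le)
qed

lemma card_queried_le_cost:
  assumes "finite W" "inj_on c W"
  shows "of_nat (card {w\<in>W. c w \<in> queried A f}) \<le> ennreal_of_enat (cost A f)"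
proof (cases "cost A f")
  case (enat n)
  then have q: "queried A f = (\<lambda>l. query A (info A f l)) ` {..<n}" by (auto simp: queried_def)
  have "card {w\<in>W. c w \<in> queried A f} \<le> card (queried A f)"
    using assms by (intro card_inj_on_le[of c]) (auto simp: q intro: inj_on_subset)
  also have "\<dots> \<le> n" using card_image_le[of "{..<n}"] by (simp add: q)
  finally show ?thesis using enat by (simp flip: ennreal_of_nat_eq_real_of_nat)
qed auto

lemma nonadaptive_queried:
  assumes "nonadaptive P A" "det_algorithm P A"
    and "\<And>n. info A f n \<in> lists (Kset P)" "\<And>n. info A g n \<in> lists (Kset P)"
  shows "queried A f = queried A g"
proof -
  have eq: "query A (info A f n) = query A (info A g n)" "stop A (info A f n) = stop A (info A g n)" for n
    using assms unfolding nonadaptive_def by (metis length_info)+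
  have "cost A f = cost A g" by (simp add: cost_def eq)
  then show ?thesis by (simp add: queried_def eq)
qed

section \<open>The embedding problem\<close>

type_synonym levels = "nat \<Rightarrow> nat \<Rightarrow> nat \<Rightarrow> complex"

type_synonym level_algorithm = "(levels, levels, complex) algorithm"

locale mixed_embedding =
  fixes K :: "complex set" and \<alpha> :: real and p q u v p1 q1 :: ereal
  assumes K: "K = \<real> \<or> K = UNIV"
    and exps: "1 \<le> p" "1 \<le> q" "1 \<le> u" "1 \<le> v" "1 \<le> p1" "1 \<le> q1"
    and pq: "p < q" and uv: "v < u" and \<alpha>2: "2 < \<alpha>"
begin

definition P where "P = embedding_problem K \<alpha> p u p1 q v q1"
text \<open>
  \<open>2 powr (a * k)\<close> is the norm of the identity on level \<open>k\<close>, and \<open>b\<close> is the rate at which sampling inside a row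
  reveals its norm.
\<close>

definition a where "a = recip p - recip q"
definition b where "b = recip v - recip u"

lemma ab: "0 < a" "a \<le> 1" "0 < b" "b \<le> 1"
  using recip_bounds exps recip_strict_mono[OF exps(1) pq] recip_strict_mono[OF exps(4) uv]
  by (force simp: a_def b_def)+

lemma P_simps:
  "Fset P = {x \<in> sum_space K p u p1. sum_norm p u p1 x \<le> 1}"
  "Gset P = sum_space K q v q1" "Gnorm P = sum_norm q v q1"
  "Sol P = embedding \<alpha>" "Kset P = K"
  "Info P = {\<lambda>x. x k i j | k i j. i \<in> {1..2^k} \<and> j \<in> {1..2^k}}"
  by (simp_all add: P_def embedding_problem_def)

lemma K_closed: "0 \<in> K" "x \<in> K \<Longrightarrow> y \<in> K \<Longrightarrow> x - y \<in> K" "x \<in> K \<Longrightarrow> of_real c * x \<in> K"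
  "of_real c \<in> K" "x \<in> K \<Longrightarrow> - x \<in> K"
  using K by auto

abbreviation dev :: "level_algorithm \<Rightarrow> levels \<Rightarrow> real" where
  "dev A x \<equiv> Gnorm P (Sol P x - answer A x)"

lemma Fset_values: "f \<in> Fset P \<Longrightarrow> L \<in> Info P \<Longrightarrow> L f \<in> Kset P"
  by (auto simp: P_simps sum_space_def)

lemma info_in_K:
  assumes "det_algorithm P A" "f \<in> Fset P"
  shows "info A f n \<in> lists (Kset P)"
proof (induction n)
  case (Suc n)
  then have "query A (info A f n) f \<in> Kset P"
    using assms by (intro Fset_values) (auto simp: det_algorithm_def)
  then show ?case using Suc by simp
qed simp

lemma answer_in_Gset:
  assumes "det_algorithm P A" "f \<in> Fset P"
  shows "answer A f \<in> Gset P"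
  using info_in_K[OF assms] assms(1)
  by (cases "cost A f") (auto simp: det_algorithm_def answer_enat answer_infinity)

abbreviation source_norm :: "nat \<Rightarrow> (nat \<Rightarrow> nat \<Rightarrow> complex) \<Rightarrow> real" where
  "source_norm k \<equiv> mixed_norm p (2^k) u (2^k)"

abbreviation target_norm :: "nat \<Rightarrow> (nat \<Rightarrow> nat \<Rightarrow> complex) \<Rightarrow> real" where
  "target_norm k \<equiv> mixed_norm q (2^k) v (2^k)"

lemma norms_nonneg [simp]: "0 \<le> source_norm k x" "0 \<le> target_norm k x"
  using exps by (auto intro!: mixed_norm_nonneg)

lemma target_le_source: "target_norm k x \<le> 2 powr (a * real k) * source_norm k x"
  using mixed_norm_embedding[of "2^k" p q "2^k" v u x] exps pq uv
  by (simp add: a_def powr_powr[symmetric] powr_realpow[symmetric] mult.commute)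

lemma source_norm_le_1: "x \<in> Fset P \<Longrightarrow> source_norm k (x k) \<le> 1"
  using ell_norm_coord[of p1 "\<lambda>k. source_norm k (x k)" k] exps
  by (auto simp: P_simps sum_space_def sum_norm_def)

lemma in_Fset_I:
  assumes "\<And>k i j. x k i j \<in> K" "\<And>k i j. i \<notin> {1..2^k} \<or> j \<notin> {1..2^k} \<Longrightarrow> x k i j = 0"
    and "y \<in> Fset P" "\<And>k i j. norm (x k i j) \<le> norm (y k i j)"
  shows "x \<in> Fset P"
proof -
  have le: "\<bar>source_norm k (x k)\<bar> \<le> \<bar>source_norm k (y k)\<bar>" for k
    using assms exps by (simp add: mixed_norm_mono)
  show ?thesis
    using ell_norm_mono[of p1 "\<lambda>k. source_norm k (y k)" "\<lambda>k. source_norm k (x k)", OF exps(5) _ le] assms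
    by (auto simp: P_simps sum_space_def sum_norm_def)
qed

text \<open>The norms of all sequence spaces are dominated by the sum of the moduli.\<close>

lemma target_bound:
  assumes "\<And>k i j. x k i j \<in> K" "\<And>k i j. i \<notin> {1..2^k} \<or> j \<notin> {1..2^k} \<Longrightarrow> x k i j = 0"
    and "summable c" "\<And>k. target_norm k (x k) \<le> c k"
  shows "x \<in> Gset P" "Gnorm P x \<le> (\<Sum>k. c k)"
  using ell_norm_le_suminf[OF exps(6) assms(3), of "\<lambda>k. target_norm k (x k)"] assms
  by (auto simp: P_simps sum_space_def sum_norm_def)

lemma target_norm_scale: "target_norm k (\<lambda>i j. of_real c * x i j) = \<bar>c\<bar> * target_norm k x"
  using exps by (intro mixed_norm_scale) (auto simp: norm_mult)

lemma weighted_target_norm_le: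
  assumes "x \<in> Fset P"
  shows "2 powr (- \<alpha> * real k) * target_norm k (x k) \<le> 2 powr ((a - \<alpha>) * real k)"
proof -
  have "2 powr (- \<alpha> * real k) * target_norm k (x k) \<le> 2 powr (- \<alpha> * real k) * (2 powr (a * real k) * 1)"
    using order_trans[OF target_le_source[of k "x k"] mult_left_mono[OF source_norm_le_1[OF assms, of k]]]
    by (intro mult_left_mono) auto
  also have "\<dots> = 2 powr ((a - \<alpha>) * real k)"
    by (simp add: powr_add[symmetric] left_diff_distrib)
  finally show ?thesis .
qed

lemma embedding_in_Gset:
  assumes "x \<in> Fset P" shows "Sol P x \<in> Gset P"
proof (rule target_bound(1))
  show "summable (\<lambda>k. 2 powr ((a - \<alpha>) * real k))" using ab \<alpha>2 by (intro summable_decay) auto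
  show "target_norm k (Sol P x k) \<le> 2 powr ((a - \<alpha>) * real k)" for k
    using weighted_target_norm_le[OF assms, of k]
    by (simp add: P_simps embedding_def target_norm_scale)
qed (use assms K_closed in \<open>auto simp: P_simps embedding_def sum_space_def\<close>)

lemma target_triangle:
  assumes "x \<in> Gset P" "y \<in> Gset P" "\<And>k i j. norm (z k i j) \<le> norm (x k i j) + norm (y k i j)"
    and "\<And>k i j. z k i j \<in> K"
  shows "z \<in> Gset P" "Gnorm P z \<le> Gnorm P x + Gnorm P y"
proof -
  have le: "\<bar>target_norm k (z k)\<bar> \<le> \<bar>target_norm k (x k)\<bar> + \<bar>target_norm k (y k)\<bar>" for k
    using assms exps by (simp add: mixed_norm_triangle)
  have "z k i j = 0" if "i \<notin> {1..2^k} \<or> j \<notin> {1..2^k}" for k i j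
  proof -
    have "x k i j = 0" "y k i j = 0" using assms(1,2) that by (auto simp: P_simps sum_space_def)
    then show ?thesis using assms(3)[of k i j] by simp
  qed
  then show "z \<in> Gset P" "Gnorm P z \<le> Gnorm P x + Gnorm P y"
    using ell_norm_triangle[OF exps(6) _ _ le] assms
    by (auto simp: P_simps sum_space_def sum_norm_def)
qed

lemma target_diff:
  assumes "x \<in> Gset P" "y \<in> Gset P"
  shows "x - y \<in> Gset P"
  using assms by (intro target_triangle(1)[OF assms] norm_triangle_ineq4[THEN order_trans])
    (auto simp: norm_triangle_ineq4 P_simps sum_space_def K_closed)

lemma Gnorm_nonneg: "x \<in> Gset P \<Longrightarrow> 0 \<le> Gnorm P x"
  using ell_norm_nonneg[OF exps(6)] by (auto simp: P_simps sum_space_def sum_norm_def)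

lemma Gnorm_double:
  assumes "x \<in> Gset P" shows "2 * Gnorm P x \<le> Gnorm P (\<lambda>k i j. 2 * x k i j)"
proof -
  have e: "target_norm k (\<lambda>i j. 2 * x k i j) = 2 * target_norm k (x k)" for k
    using target_norm_scale[of k 2 "x k"] by simp
  have in1: "in_ell q1 (\<lambda>k. target_norm k (x k))" using assms by (simp add: P_simps sum_space_def)
  have in2: "in_ell q1 (\<lambda>k. 2 * target_norm k (x k))"
    by (rule ell_norm_cmult(1)[OF exps(6) in1, where c = 2]) auto
  have "ell_norm q1 (\<lambda>k. target_norm k (x k)) \<le> (1/2) * ell_norm q1 (\<lambda>k. 2 * target_norm k (x k))"
    by (rule ell_norm_cmult(2)[OF exps(6) in2]) auto
  then show ?thesis by (simp add: P_simps sum_norm_def e)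
qed

text \<open>The midpoint inequality: no answer can be close to both \<open>y\<close> and \<open>- y\<close>.\<close>

lemma Gnorm_midpoint:
  assumes "y \<in> Gset P" "g \<in> Gset P"
  shows "2 * Gnorm P y \<le> Gnorm P (y - g) + Gnorm P (- y - g)"
proof -
  have my: "- y \<in> Gset P"
    by (rule target_triangle(1)[OF assms(1) assms(1)])
      (use assms(1) in \<open>auto simp: P_simps sum_space_def K_closed\<close>)
  have "2 * Gnorm P y \<le> Gnorm P (\<lambda>k i j. 2 * y k i j)" by (rule Gnorm_double[OF assms(1)])
  also have "\<dots> \<le> Gnorm P (y - g) + Gnorm P (- y - g)"
  proof (rule target_triangle(2)[OF target_diff[OF assms] target_diff[OF my assms(2)]])
    show "norm (2 * y k i j) \<le> norm ((y - g) k i j) + norm ((- y - g) k i j)" for k i j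
      using norm_triangle_ineq4[of "y k i j - g k i j" "- y k i j - g k i j"] by (simp add: algebra_simps)
    show "2 * y k i j \<in> K" for k i j
      using assms(1) K_closed(3)[of "y k i j" 2] by (auto simp: P_simps sum_space_def)
  qed
  finally show ?thesis .
qed

text \<open>
  The distance to a fixed point is continuous by the triangle inequality.  Hence the error is a random variable, and
  sums of expected errors over finitely many inputs can be interchanged with the integral.
\<close>

lemma borel_measurable_error:
  assumes "s \<in> Gset P"
  shows "(\<lambda>y. Gnorm P (s - y)) \<in> borel_measurable (Gborel P)"
  unfolding borel_measurable_iff_less
proof
  fix c
  have "Gopen P {y\<in>Gset P. Gnorm P (s - y) < c}"
    unfolding Gopen_def
  proof (intro conjI ballI)
    fix x assume x: "x \<in> {y \<in> Gset P. Gnorm P (s - y) < c}"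
    show "\<exists>\<epsilon>>0. \<forall>y\<in>Gset P. Gnorm P (y - x) < \<epsilon> \<longrightarrow> y \<in> {y \<in> Gset P. Gnorm P (s - y) < c}"
    proof (intro exI[of _ "c - Gnorm P (s - x)"] conjI ballI impI)
      fix y assume y: "y \<in> Gset P" "Gnorm P (y - x) < c - Gnorm P (s - x)"
      have "Gnorm P (s - y) \<le> Gnorm P (s - x) + Gnorm P (y - x)"
      proof (rule target_triangle(2))
        show "s - x \<in> Gset P" "y - x \<in> Gset P" using x y assms by (auto intro: target_diff)
        show "norm ((s - y) k i j) \<le> norm ((s - x) k i j) + norm ((y - x) k i j)" for k i j
          using norm_triangle_ineq4[of "s k i j - x k i j" "y k i j - x k i j"] by simp
        show "(s - y) k i j \<in> K" for k i j
          using target_diff[OF assms y(1)] by (simp add: P_simps sum_space_def)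
      qed
      then show "y \<in> {y \<in> Gset P. Gnorm P (s - y) < c}" using y by simp
    qed (use x in auto)
  qed auto
  then show "{w \<in> space (Gborel P). Gnorm P (s - w) < c} \<in> sets (Gborel P)"
    by (auto simp: Gborel_def Gopen_def space_measure_of_conv intro!: sigma_sets.Basic)
qed

end

section \<open>Lower bounds for adaptive and nonadaptive algorithms\<close>

lemma Lp_norm_block:
  assumes "1 \<le> N" "1 \<le> p" "A \<subseteq> {1..N}" "A \<noteq> {}" "0 \<le> c"
    and "\<And>i. i \<in> {1..N} \<Longrightarrow> norm (f i) = (if i \<in> A then c else 0)"
  shows "Lp_norm p N f = c * (real (card A) / real N) powr recip p"
proof -
  have fin: "finite A" using assms(3) finite_subset by blast
  have "fin_norm p {1..N} (\<lambda>i. norm (f i)) = c * real (card A) powr recip p"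
    using \<open>1 \<le> p\<close>
  proof (cases rule: exponent_cases)
    case 1
    have "fin_norm p {1..N} (\<lambda>i. norm (f i)) \<le> c"
      using assms 1 by (auto simp: fin_norm_le_iff_inf)
    moreover obtain i where "i \<in> A" using assms by auto
    then have "c \<le> fin_norm p {1..N} (\<lambda>i. norm (f i))"
      using fin_norm_coord[of "{1..N}" p i "\<lambda>i. norm (f i)"] assms by (auto simp: subset_iff)
    moreover have "real (card A) powr recip p = 1"
      using 1 fin assms by (simp add: card_gt_0_iff)
    ultimately show ?thesis by simp
  next
    case (2 s)
    have "(\<Sum>i=1..N. norm (f i) powr s) = (\<Sum>i=1..N. if i \<in> A then c powr s else 0)"
      using assms by (intro sum.cong) auto
    also have "\<dots> = real (card A) * c powr s"
      using assms by (simp add: sum.If_cases Int_absorb1)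
    finally show ?thesis using 2 assms by (simp add: fin_norm_def powr_mult powr_powr)
  qed
  then show ?thesis using assms by (simp add: Lp_norm_fin_norm powr_divide)
qed

text \<open>
  Restriction to a block decreases the norm, and on the block the power mean dominates the arithmetic mean.  Arithmetic
  means are linear in the moduli, which is what averaging over random signs requires.
\<close>

lemma Lp_norm_ge_block_mean:
  assumes "1 \<le> N" "1 \<le> p" "A \<subseteq> {1..N}" "A \<noteq> {}"
  shows "(real (card A) / real N) powr recip p * ((\<Sum>i\<in>A. norm (f i)) / card A) \<le> Lp_norm p N f"
proof -
  have fin: "finite A" using assms(3) finite_subset by blast
  then have n: "real (card A) > 0" using assms by (simp add: card_gt_0_iff)
  define g where "g = (\<lambda>i. norm (f i))"
  have mean: "(\<Sum>i\<in>A. g i) / card A \<le> (1 / card A) powr recip p * fin_norm p A g"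
    using fin_norm_power_mean[OF fin assms(4), of 1 p g] assms n
    by (simp add: fin_norm_def one_ereal_def g_def recip_def sum_nonneg)
  have "fin_norm p A g \<le> fin_norm p {1..N} g"
    using \<open>1 \<le> p\<close>
  proof (cases rule: exponent_cases)
    case 1
    then show ?thesis using assms fin
      by (auto simp: fin_norm_le_iff_inf fin_norm_nonneg intro!: fin_norm_coord)
  next
    case (2 s)
    then have "(\<Sum>i\<in>A. \<bar>g i\<bar> powr s) \<le> (\<Sum>i=1..N. \<bar>g i\<bar> powr s)"
      using assms by (intro sum_mono2) auto
    then show ?thesis using 2 fin by (simp add: fin_norm_le_iff fin_norm_nonneg fin_norm_powr)
  qed
  then have "(real (card A) / real N) powr recip p * ((1 / card A) powr recip p * fin_norm p A g)
      \<le> (1 / real N) powr recip p * fin_norm p {1..N} g"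
    using n by (simp add: powr_divide) (simp add: divide_right_mono)
  moreover have "(real (card A) / real N) powr recip p * ((\<Sum>i\<in>A. g i) / card A)
      \<le> (real (card A) / real N) powr recip p * ((1 / card A) powr recip p * fin_norm p A g)"
    by (intro mult_left_mono mean) auto
  ultimately show ?thesis using assms by (simp add: Lp_norm_fin_norm g_def)
qed

lemma real_card_filter:
  "finite A \<Longrightarrow> c * real (card {x\<in>A. Q x}) = (\<Sum>x\<in>A. if Q x then c else 0)"
  by (simp flip: sum.inter_filter)

context mixed_embedding
begin

definition coord :: "nat \<Rightarrow> nat \<times> nat \<Rightarrow> levels \<Rightarrow> complex" where
  "coord k w = (\<lambda>x. x k (fst w) (snd w))"

definition grid :: "nat \<Rightarrow> (nat \<times> nat) set" where
  "grid k = {1..2^k} \<times> {1..2^k}"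

lemma inj_coord: "inj_on (coord k) W"
proof (rule inj_onI)
  fix w w' assume "coord k w = coord k w'"
  from fun_cong[OF this, of "\<lambda>k' i j. if (i, j) = w then 1 else 0"]
  show "w = w'" by (auto simp: coord_def split: if_splits)
qed

lemma card_queried_coord: "finite W \<Longrightarrow>
  of_nat (card {w\<in>W. coord k w \<in> queried A f}) \<le> ennreal_of_enat (cost A f)"
  by (intro card_queried_le_cost inj_coord)

text \<open>
  A block of constant modulus on level \<open>k\<close>.  The set \<open>T\<close> encodes the choice of signs, so that averages over random
  signs become sums over \<open>Pow W\<close>.
\<close>

definition signed :: "nat \<Rightarrow> real \<Rightarrow> (nat \<times> nat) set \<Rightarrow> (nat \<times> nat) set \<Rightarrow> levels" where
  "signed k h W T = (\<lambda>l i j. if l = k \<and> (i, j) \<in> W then (if (i, j) \<in> T then of_real h else - of_real h) else 0)"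

text \<open>
  The height at which a block of \<open>r\<close> rows and \<open>c\<close> columns has norm one in the source space.
\<close>

definition peak :: "nat \<Rightarrow> real \<Rightarrow> real \<Rightarrow> real" where
  "peak k r c = (2 ^ k / r) powr recip p * (2 ^ k / c) powr recip u"

lemma signed_in_ball:
  assumes R: "R \<subseteq> {1..2^k}" "R \<noteq> {}" and C: "C \<subseteq> {1..2^k}" "C \<noteq> {}"
  shows "signed k (peak k (card R) (card C)) (R \<times> C) T \<in> Fset P"
proof -
  define h where "h = peak k (card R) (card C)"
  define x where "x = signed k h (R \<times> C) T"
  have fin: "finite R" "finite C" using R C finite_subset by blast+
  have h: "h \<ge> 0" by (simp add: h_def peak_def)
  have row: "Lp_norm u (2^k) (x k i) = (if i \<in> R then h * (card C / 2^k) powr recip u else 0)"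
    if "i \<in> {1..2^k}" for i
  proof (cases "i \<in> R")
    case True
    then show ?thesis
      using Lp_norm_block[of "2^k" u C h "x k i"] exps C h by (auto simp: x_def signed_def)
  next
    case False
    then have "Lp_norm u (2^k) (x k i) = \<bar>0\<bar> * Lp_norm u (2^k) (x k i)"
      using exps by (intro Lp_norm_scale) (auto simp: x_def signed_def)
    then show ?thesis using False by simp
  qed
  have "source_norm k (x k) = (h * (card C / 2^k) powr recip u) * (card R / 2^k) powr recip p"
    unfolding mixed_norm_def
    using Lp_norm_block[of "2^k" p R "h * (card C / 2^k) powr recip u" "\<lambda>i. Lp_norm u (2^k) (x k i)"] exps R row h
    by simp
  also have "\<dots> = 1"
    using R C fin by (simp add: h_def peak_def powr_divide card_gt_0_iff)
  finally have k: "source_norm k (x k) = 1" .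
  have other: "source_norm l (x l) = 0" if "l \<noteq> k" for l
    using mixed_norm_scale[of "2^l" p "2^l" u "x l" 0 "x l"] that exps by (auto simp: x_def signed_def)
  have sm: "summable (\<lambda>l. if l = k then 1 else 0::real)" by simp
  have le: "\<bar>source_norm l (x l)\<bar> \<le> (if l = k then 1 else 0)" for l using k other by auto
  note ell_norm_le_suminf[OF exps(5) sm le]
  moreover have "(\<Sum>l. if l = k then 1 else 0::real) = 1"
    using suminf_finite[of "{k}" "\<lambda>l. if l = k then 1 else 0::real"] by simp
  moreover have "x l i j \<in> K" "i \<notin> {1..2^l} \<or> j \<notin> {1..2^l} \<Longrightarrow> x l i j = 0" for l i j
    using R C K_closed by (auto simp: x_def signed_def)
  ultimately have "x \<in> Fset P" by (auto simp: P_simps sum_space_def sum_norm_def)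
  then show ?thesis by (simp add: x_def h_def)
qed

lemma Gnorm_ge_block_mean:
  assumes R: "R \<subseteq> {1..2^k}" "R \<noteq> {}" and C: "C \<subseteq> {1..2^k}" "C \<noteq> {}" and y: "y \<in> Gset P"
  shows "(card R / 2^k) powr recip q * (card C / 2^k) powr recip v
           * ((\<Sum>w\<in>R \<times> C. norm (coord k w y)) / card (R \<times> C)) \<le> Gnorm P y"
proof -
  define c where "c = (card C / 2^k) powr recip v"
  have "(card R / 2^k) powr recip q * ((\<Sum>i\<in>R. c * ((\<Sum>j\<in>C. norm (y k i j)) / card C)) / card R)
     \<le> (card R / 2^k) powr recip q * ((\<Sum>i\<in>R. norm (Lp_norm v (2^k) (y k i))) / card R)"
  proof (intro mult_left_mono divide_right_mono sum_mono)
    show "c * ((\<Sum>j\<in>C. norm (y k i j)) / card C) \<le> norm (Lp_norm v (2^k) (y k i))" for i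
      using Lp_norm_ge_block_mean[of "2^k" v C "y k i"] exps C by (simp add: c_def)
  qed auto
  also have "\<dots> \<le> target_norm k (y k)"
    unfolding mixed_norm_def using Lp_norm_ge_block_mean[of "2^k" q R "\<lambda>i. Lp_norm v (2^k) (y k i)"] exps R by simp
  also have "\<dots> \<le> Gnorm P y"
    using ell_norm_coord[of q1 "\<lambda>k. target_norm k (y k)" k] exps y
    by (auto simp: P_simps sum_space_def sum_norm_def)
  also have "(\<Sum>i\<in>R. c * ((\<Sum>j\<in>C. norm (y k i j)) / card C)) / card R
      = c * ((\<Sum>w\<in>R \<times> C. norm (coord k w y)) / card (R \<times> C))"
    by (simp add: coord_def sum.cartesian_product' sum_distrib_left sum_divide_distrib card_cartesian_product
        field_simps)
  finally show ?thesis by (simp add: c_def mult.assoc)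
qed

text \<open>
  If an algorithm does not query the entry \<open>w\<close> on \<open>signed k h W T\<close>, then it gives the same answer
  when the sign at \<open>w\<close> is flipped.  Pairing both choices of the sign, unqueried entries
  contribute on average at least \<open>h\<close> to the error.
\<close>

lemma flip_sign:
  fixes \<gamma> :: complex
  assumes A: "det_algorithm P A" and fin: "finite W" and w: "w \<in> W" "W \<subseteq> grid k" and h: "0 \<le> h"
  defines "err \<equiv> \<lambda>T. norm (coord k w (signed k h W T) - \<gamma> * coord k w (answer A (signed k h W T)))"
  shows "h * card {T\<in>Pow W. coord k w \<notin> queried A (signed k h W T)} \<le> (\<Sum>T\<in>Pow W. err T)"
proof -
  (* toggling membership of w changes the sign at w only *)
  define flip where "flip T = (if w \<in> T then T - {w} else insert w T)" for T
  have flip_flip: "flip (flip T) = T" for T by (auto simp: flip_def)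
  have bij: "bij_betw flip (Pow W) (Pow W)"
    by (rule bij_betw_byWitness[where f' = flip]) (use w in \<open>auto simp: flip_flip\<close>, auto simp: flip_def split: if_splits)
  have pair: "(if coord k w \<notin> queried A (signed k h W T) then 2 * h else 0) \<le> err T + err (flip T)"
    if T: "T \<in> Pow W" for T
  proof (cases "coord k w \<in> queried A (signed k h W T)")
    case False
    have K: "info A (signed k h W T) n \<in> lists (Kset P)" for n
    proof (induction n)
      case (Suc n)
      then have "query A (info A (signed k h W T) n) \<in> Info P" using A by (simp add: det_algorithm_def)
      then have "query A (info A (signed k h W T) n) (signed k h W T) \<in> K"
        by (auto simp: P_simps signed_def K_closed)
      then show ?case using Suc by (simp add: P_simps)
    qed simp
    have "L (signed k h W (flip T)) = L (signed k h W T)"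
      if L: "L \<in> queried A (signed k h W T)" for L
    proof -
      obtain n where "L = query A (info A (signed k h W T) n)" using L by (auto simp: queried_def)
      then have "L \<in> Info P" using K A by (simp add: det_algorithm_def)
      then obtain l i j where lij: "L = (\<lambda>x. x l i j)" by (auto simp: P_simps)
      then have "\<not> (l = k \<and> (i, j) = w)" using False L by (auto simp: coord_def)
      then show ?thesis by (auto simp: lij signed_def flip_def)
    qed
    then have ans: "answer A (signed k h W (flip T)) = answer A (signed k h W T)"
      by (rule run_determined_by_queried)
    have "coord k w (signed k h W (flip T)) = - coord k w (signed k h W T)"
      "norm (coord k w (signed k h W T)) = h"
      using w h by (auto simp: coord_def signed_def flip_def)
    then have "2 * h = norm (coord k w (signed k h W T) - coord k w (signed k h W (flip T)))"
      by (metis (no_types) diff_minus_eq_add mult_2 norm_mult norm_numeral)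
    also have "\<dots> \<le> err T + err (flip T)"
      unfolding err_def ans
      using norm_triangle_ineq4[of "coord k w (signed k h W T) - \<gamma> * coord k w (answer A (signed k h W T))"
          "coord k w (signed k h W (flip T)) - \<gamma> * coord k w (answer A (signed k h W T))"] by simp
    finally show ?thesis using False by simp
  qed (simp add: err_def)
  have "2 * h * card {T\<in>Pow W. coord k w \<notin> queried A (signed k h W T)}
      = (\<Sum>T\<in>Pow W. if coord k w \<notin> queried A (signed k h W T) then 2 * h else 0)"
    using fin by (intro real_card_filter) simp
  also have "\<dots> \<le> (\<Sum>T\<in>Pow W. err T + err (flip T))" by (rule sum_mono[OF pair])
  also have "\<dots> = 2 * (\<Sum>T\<in>Pow W. err T)"
    using sum.reindex_bij_betw[OF bij, of err] by (simp add: sum.distrib)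
  finally show ?thesis by simp
qed

text \<open>
  The norm in the target space of the image of a signed block function with height \<open>peak k r c\<close>.
\<close>

definition block_scale :: "nat \<Rightarrow> real \<Rightarrow> real \<Rightarrow> real" where
  "block_scale k r c = 2 powr (- \<alpha> * real k) * (2 ^ k / r) powr a * (2 ^ k / c) powr (- b)"

text \<open>
  Summing \<open>flip_sign\<close> over the entries of a block: the average error over all signs is at least the norm of the image times
  the average fraction of unqueried entries.
\<close>

lemma block_average:
  assumes A: "det_algorithm P A"
    and R: "R \<subseteq> {1..2^k}" "R \<noteq> {}" and C: "C \<subseteq> {1..2^k}" "C \<noteq> {}"
  defines "f \<equiv> signed k (peak k (card R) (card C)) (R \<times> C)"
    and "s \<equiv> block_scale k (card R) (card C)"
  shows "s * (\<Sum>T\<in>Pow (R \<times> C). 1 - card {w\<in>R \<times> C. coord k w \<in> queried A (f T)} / card (R \<times> C))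
      \<le> (\<Sum>T\<in>Pow (R \<times> C). dev A (f T))"
proof -
  define W where "W = R \<times> C"
  define h where "h = peak k (card R) (card C)"
  define \<beta> where "\<beta> = 2 powr (- \<alpha> * real k)"
  define g where "g = (card R / 2^k) powr recip q * (card C / 2^k) powr recip v"
  have fin: "finite R" "finite C" using R C finite_subset by blast+
  then have fin: "finite R" "finite C" "finite W" by (simp_all add: W_def)
  then have pos: "real (card R) > 0" "real (card C) > 0" "real (card W) > 0"
    using R C by (auto simp: card_gt_0_iff W_def card_cartesian_product)
  have h: "h \<ge> 0" by (simp add: h_def peak_def)
  have split: "(2 ^ k / t) powr (x - y) = (2 ^ k / t) powr x * (t / 2 ^ k) powr y" if "t > 0" for t x y :: real
    using that by (simp add: powr_diff powr_divide)
  have s: "s = \<beta> * g * h"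
    using split[OF pos(1), of "recip p" "recip q"] split[OF pos(2), of "recip u" "recip v"]
    by (simp add: s_def block_scale_def h_def peak_def g_def \<beta>_def a_def b_def)
  have ball: "f T \<in> Fset P" for T unfolding f_def by (rule signed_in_ball[OF R C])
  have err: "g * ((\<Sum>w\<in>W. \<beta> * norm (coord k w (f T) - of_real (1/\<beta>) * coord k w (answer A (f T)))) / card W)
      \<le> dev A (f T)" for T
  proof -
    have "coord k w (Sol P (f T) - answer A (f T))
        = of_real \<beta> * (coord k w (f T) - of_real (1/\<beta>) * coord k w (answer A (f T)))" for w
      by (simp add: coord_def P_simps embedding_def \<beta>_def right_diff_distrib)
    then have e: "norm (coord k w (Sol P (f T) - answer A (f T)))
        = \<beta> * norm (coord k w (f T) - of_real (1/\<beta>) * coord k w (answer A (f T)))" for w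
      by (simp only: norm_mult) (simp add: \<beta>_def)
    have "Sol P (f T) - answer A (f T) \<in> Gset P"
      by (intro target_diff embedding_in_Gset answer_in_Gset A ball)
    from Gnorm_ge_block_mean[OF R C this] show ?thesis by (simp only: e g_def W_def)
  qed
  have "s * (\<Sum>T\<in>Pow W. 1 - card {w\<in>W. coord k w \<in> queried A (f T)} / card W)
      = s / card W * (\<Sum>T\<in>Pow W. real (card {w\<in>W. coord k w \<notin> queried A (f T)}))"
  proof -
    have "real (card W) = card {w\<in>W. coord k w \<in> queried A (f T)} + card {w\<in>W. coord k w \<notin> queried A (f T)}" for T
    proof -
      have "card W = card ({w\<in>W. coord k w \<in> queried A (f T)} \<union> {w\<in>W. coord k w \<notin> queried A (f T)})"
        by (rule arg_cong[where f = card]) auto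
      also have "\<dots> = card {w\<in>W. coord k w \<in> queried A (f T)} + card {w\<in>W. coord k w \<notin> queried A (f T)}"
        using fin by (intro card_Un_disjoint) auto
      finally show ?thesis by simp
    qed
    then have "1 - card {w\<in>W. coord k w \<in> queried A (f T)} / card W = card {w\<in>W. coord k w \<notin> queried A (f T)} / card W" for T
      using pos by (simp add: field_simps)
    then show ?thesis by (simp flip: sum_divide_distrib)
  qed
  also have "(\<Sum>T\<in>Pow W. real (card {w\<in>W. coord k w \<notin> queried A (f T)}))
      = (\<Sum>T\<in>Pow W. \<Sum>w\<in>W. if coord k w \<notin> queried A (f T) then 1 else 0)"
    using real_card_filter[OF fin(3), of 1] by simp
  also have "\<dots> = (\<Sum>w\<in>W. real (card {T\<in>Pow W. coord k w \<notin> queried A (f T)}))"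
    using fin real_card_filter[of "Pow W" 1] by (subst sum.swap) simp
  also have "s / card W * \<dots> = \<beta> * g / card W * (\<Sum>w\<in>W. h * real (card {T\<in>Pow W. coord k w \<notin> queried A (f T)}))"
    by (simp add: s sum_distrib_left mult_ac)
  also have "\<dots> \<le> \<beta> * g / card W * (\<Sum>w\<in>W. \<Sum>T\<in>Pow W. norm (coord k w (f T) - of_real (1/\<beta>) * coord k w (answer A (f T))))"
    using flip_sign[OF A fin(3) _ _ h, of _ k "of_real (1/\<beta>)"] R C
    by (intro mult_left_mono sum_mono) (auto simp: f_def h_def W_def grid_def g_def \<beta>_def)
  also have "\<dots> = (\<Sum>T\<in>Pow W. g * ((\<Sum>w\<in>W. \<beta> * norm (coord k w (f T) - of_real (1/\<beta>) * coord k w (answer A (f T)))) / card W))"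
    by (subst sum.swap) (simp add: sum_distrib_left sum_divide_distrib mult_ac)
  also have "\<dots> \<le> (\<Sum>T\<in>Pow W. dev A (f T))"
    by (intro sum_mono err)
  finally show ?thesis by (simp add: W_def)
qed


lemma zero_in_ball: "(\<lambda>_ _ _. 0) \<in> Fset P"
  by (rule in_Fset_I[of _ "signed 0 (peak 0 (card {1}) (card {1})) ({1} \<times> {1}) {}"])
    (use K_closed signed_in_ball[of "{1}" 0 "{1}" "{}"] in auto)

text \<open>
  For a fixed value of the random parameter a randomized algorithm is deterministic, and its worst-case error dominates its average over a
  finite family of inputs.  The cost enters the hypothesis linearly with the factor \<open>\<kappa>\<close>, so that the bound on the
  expected cost can be inserted after integration, without treating expensive runs separately.  The inputs \<open>g \<iota>\<close> at which the cost is
  measured may differ from the inputs \<open>f \<iota>\<close> at which the error is measured.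
\<close>

lemma average_lower_bound:
  assumes I: "finite I" "I \<noteq> {}" and fg: "\<And>\<iota>. \<iota> \<in> I \<Longrightarrow> f \<iota> \<in> Fset P \<and> g \<iota> \<in> Fset P" and \<kappa>: "0 \<le> \<kappa>"
    and avg: "\<And>A. det_algorithm P A \<Longrightarrow> Q A \<Longrightarrow> of_nat (card I) * ennreal s
      \<le> (\<Sum>\<iota>\<in>I. ennreal (dev A (f \<iota>)) + ennreal \<kappa> * ennreal_of_enat (cost A (g \<iota>)))"
    and M: "ran_algorithm P M A" "\<And>\<omega>. \<omega> \<in> space M \<Longrightarrow> Q (A \<omega>)" "ran_cost P M A \<le> of_nat n"
  shows "ennreal (s - \<kappa> * n) \<le> ran_error P M A"
proof -
  interpret M: prob_space M using M(1) by (simp add: ran_algorithm_def)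
  have meas: "(\<lambda>\<omega>. ennreal (dev (A \<omega>) (f \<iota>))) \<in> borel_measurable M"
    "(\<lambda>\<omega>. ennreal_of_enat (cost (A \<omega>) (g \<iota>))) \<in> borel_measurable M" if "\<iota> \<in> I" for \<iota>
  proof -
    have "(\<lambda>\<omega>. answer (A \<omega>) (f \<iota>)) \<in> measurable M (Gborel P)"
      "(\<lambda>\<omega>. cost (A \<omega>) (g \<iota>)) \<in> measurable M (count_space UNIV)"
      using M(1) fg[OF that] by (auto simp: ran_algorithm_def)
    then show "(\<lambda>\<omega>. ennreal (dev (A \<omega>) (f \<iota>))) \<in> borel_measurable M"
      "(\<lambda>\<omega>. ennreal_of_enat (cost (A \<omega>) (g \<iota>))) \<in> borel_measurable M"
      using measurable_compose[OF measurable_compose[OF _ borel_measurable_error[OF embedding_in_Gset]] measurable_ennreal]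
        fg[OF that] by (auto intro: measurable_compose)
  qed
  have "of_nat (card I) * ennreal s = (\<integral>\<^sup>+\<omega>. of_nat (card I) * ennreal s \<partial>M)"
    by (simp add: M.emeasure_space_1)
  also have "\<dots> \<le> (\<integral>\<^sup>+\<omega>. (\<Sum>\<iota>\<in>I. ennreal (dev (A \<omega>) (f \<iota>))
      + ennreal \<kappa> * ennreal_of_enat (cost (A \<omega>) (g \<iota>))) \<partial>M)"
    using M by (intro nn_integral_mono avg) (auto simp: ran_algorithm_def)
  also have "\<dots> = (\<Sum>\<iota>\<in>I. (\<integral>\<^sup>+\<omega>. ennreal (dev (A \<omega>) (f \<iota>)) \<partial>M)
      + ennreal \<kappa> * (\<integral>\<^sup>+\<omega>. ennreal_of_enat (cost (A \<omega>) (g \<iota>)) \<partial>M))"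
    using meas by (subst nn_integral_sum) (auto simp: nn_integral_add nn_integral_cmult intro!: sum.cong)
  also have "\<dots> \<le> (\<Sum>\<iota>\<in>I. ran_error P M A + ennreal \<kappa> * ran_cost P M A)"
    unfolding ran_error_def ran_cost_def using fg
    by (intro sum_mono add_mono mult_left_mono SUP_upper2[OF _ order_refl]) auto
  also have "\<dots> \<le> of_nat (card I) * (ran_error P M A + ennreal \<kappa> * of_nat n)"
    using M(3) by (auto intro!: mult_left_mono add_left_mono)
  finally have "ennreal s \<le> ran_error P M A + ennreal \<kappa> * of_nat n"
    using I by (subst (asm) ennreal_mult_le_mult_iff) (auto simp: card_gt_0_iff)
  also have "ennreal \<kappa> * of_nat n = ennreal (\<kappa> * n)"
    using \<kappa> by (simp add: ennreal_mult' ennreal_of_nat_eq_real_of_nat)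
  finally have le: "ennreal s \<le> ran_error P M A + ennreal (\<kappa> * n)" .
  have \<kappa>n: "0 \<le> \<kappa> * n" using \<kappa> by simp
  show ?thesis
    using \<kappa>n le by (cases "ran_error P M A")
      (auto simp flip: ennreal_plus simp: ennreal_le_iff2 intro!: ennreal_leI)
qed

lemma block_scale_nonneg: "0 \<le> block_scale k r c"
  by (simp add: block_scale_def)

lemma block_average_ennreal:
  assumes A: "det_algorithm P A"
    and R: "R \<subseteq> {1..2^k}" "R \<noteq> {}" and C: "C \<subseteq> {1..2^k}" "C \<noteq> {}"
  defines "f \<equiv> signed k (peak k (card R) (card C)) (R \<times> C)"
    and "s \<equiv> block_scale k (card R) (card C)"
  shows "of_nat (card (Pow (R \<times> C))) * ennreal s
      \<le> (\<Sum>T\<in>Pow (R \<times> C). ennreal (dev A (f T))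
        + ennreal (s / card (R \<times> C)) * of_nat (card {w\<in>R \<times> C. coord k w \<in> queried A (f T)}))"
proof -
  define W where "W = R \<times> C"
  define hits where "hits T = card {w\<in>W. coord k w \<in> queried A (f T)}" for T
  have s: "0 \<le> s" by (simp add: s_def block_scale_nonneg)
  have ball: "f T \<in> Fset P" for T unfolding f_def by (rule signed_in_ball[OF R C])
  have err: "0 \<le> dev A (f T)" for T
    by (intro Gnorm_nonneg target_diff embedding_in_Gset answer_in_Gset A ball)
  have "s * (\<Sum>T\<in>Pow W. 1 - hits T / card W) \<le> (\<Sum>T\<in>Pow W. dev A (f T))"
    using block_average[OF A R C] by (simp add: W_def f_def s_def hits_def)
  then have "card (Pow W) * s \<le> (\<Sum>T\<in>Pow W. dev A (f T) + s / card W * hits T)"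
    by (simp add: sum.distrib sum_subtractf right_diff_distrib sum_distrib_left[symmetric] 
        sum_divide_distrib[symmetric] mult.commute)
  then have "ennreal (card (Pow W) * s) \<le> ennreal (\<Sum>T\<in>Pow W. dev A (f T) + s / card W * hits T)"
    by (rule ennreal_leI)
  also have "\<dots> = (\<Sum>T\<in>Pow W. ennreal (dev A (f T)) + ennreal (s / card W) * of_nat (hits T))"
  proof -
    have "ennreal (s / card W * hits T) = ennreal (s / card W) * of_nat (hits T)" for T
      using s by (subst ennreal_mult) (auto simp: ennreal_of_nat_eq_real_of_nat)
    moreover have "ennreal (dev A (f T) + s / card W * hits T)
        = ennreal (dev A (f T)) + ennreal (s / card W * hits T)" for T
      using err s by (intro ennreal_plus) auto
    moreover have "0 \<le> dev A (f T) + s / card W * hits T" for T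
      using err s by (intro add_nonneg_nonneg) auto
    ultimately show ?thesis by (simp only: sum_ennreal[symmetric])
  qed
  finally show ?thesis
    using s by (simp add: W_def hits_def ennreal_mult ennreal_of_nat_eq_real_of_nat)
qed

text \<open>
  The block is the whole level: all entries are independent signs, and \<open>n\<close> queries miss the fraction \<open>1 - n / 4 ^ k\<close>.
\<close>

lemma ran_lower_grid: "ennreal (2 powr (- \<alpha> * real k) * (1 - n / 4 ^ k)) \<le> e_ran P n"
  unfolding e_ran_def
proof (intro Inf_greatest, clarify)
  fix M and A :: "_ \<Rightarrow> level_algorithm"
  assume M: "ran_algorithm P M A" "ran_cost P M A \<le> of_nat n"
  define f where "f = signed k (peak k (card {1..(2::nat)^k}) (card {1..(2::nat)^k})) (grid k)"
  define s where "s = 2 powr (- \<alpha> * real k)"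
  have s: "s = block_scale k (card {1..(2::nat)^k}) (card {1..(2::nat)^k})"
    by (simp add: s_def block_scale_def)
  have ball: "f T \<in> Fset P" for T
    unfolding f_def grid_def by (rule signed_in_ball) auto
  have card: "card (grid k) = 4 ^ k"
    by (simp add: grid_def card_cartesian_product power_mult_distrib[symmetric])
  have fin: "finite (grid k)" by (simp add: grid_def)
  have "ennreal (s - s / 4 ^ k * n) \<le> ran_error P M A"
  proof (rule average_lower_bound[where I = "Pow (grid k)" and f = f and g = f and Q = "\<lambda>_. True", OF _ _ _ _ _ M(1) _ M(2)])
    fix A :: "level_algorithm"
    assume A: "det_algorithm P A"
    have "of_nat (card (Pow (grid k))) * ennreal s \<le> (\<Sum>T\<in>Pow (grid k). ennreal (dev A (f T))
        + ennreal (s / card (grid k)) * of_nat (card {w\<in>grid k. coord k w \<in> queried A (f T)}))"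
      using block_average_ennreal[OF A, of "{1..2^k}" k "{1..2^k}"] by (simp add: s f_def grid_def)
    also have "\<dots> \<le> (\<Sum>T\<in>Pow (grid k). ennreal (dev A (f T))
        + ennreal (s / 4 ^ k) * ennreal_of_enat (cost A (f T)))"
      using card_queried_coord[OF fin] by (intro sum_mono add_left_mono) (auto simp: card intro!: mult_left_mono)
    finally show "of_nat (card (Pow (grid k))) * ennreal s \<le> (\<Sum>T\<in>Pow (grid k). ennreal (dev A (f T))
        + ennreal (s / 4 ^ k) * ennreal_of_enat (cost A (f T)))" .
  qed (auto simp: fin ball s_def)
  then show "ennreal (2 powr (- \<alpha> * real k) * (1 - n / 4 ^ k)) \<le> ran_error P M A"
    by (simp add: s_def right_diff_distrib)
qed

text \<open>
  A block chosen at random from a partition of the level.  If the queries inside the block are among those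
  made on the input zero, then on average only the fraction \<open>cost / 4 ^ k\<close> of a block is seen,
  since the blocks are disjoint.
\<close>

lemma ran_lower_blocks:
  fixes R C :: "'i \<Rightarrow> nat set" and Q and k r c :: nat
  defines "W \<equiv> \<lambda>\<iota>. R \<iota> \<times> C \<iota>"
  defines "f \<equiv> \<lambda>\<iota>. signed k (peak k r c) (W \<iota>)"
  assumes B: "finite B" "B \<noteq> {}" and RC: "\<And>\<iota>. \<iota> \<in> B \<Longrightarrow> R \<iota> \<subseteq> {1..2^k} \<and> C \<iota> \<subseteq> {1..2^k} \<and> card (R \<iota>) = r \<and> card (C \<iota>) = c"
    and rc: "0 < r" "0 < c" and disj: "disjoint_family_on W B" and total: "card B * (r * c) = 4 ^ k"
    and oblivious: "\<And>A \<iota> T. det_algorithm P A \<Longrightarrow> Q A \<Longrightarrow> \<iota> \<in> B \<Longrightarrow> f \<iota> T \<in> Fset P \<Longrightarrow>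
       {w\<in>W \<iota>. coord k w \<in> queried A (f \<iota> T)} \<subseteq> {w. coord k w \<in> queried A (\<lambda>_ _ _. 0)}"
    and M: "ran_algorithm P M A" "\<And>\<omega>. \<omega> \<in> space M \<Longrightarrow> Q (A \<omega>)" "ran_cost P M A \<le> of_nat n"
  shows "ennreal (block_scale k r c * (1 - n / 4 ^ k)) \<le> ran_error P M A"
proof -
  define s where "s = block_scale k r c"
  have s: "0 \<le> s" by (simp add: s_def block_scale_nonneg)
  define I where "I = Sigma B (\<lambda>\<iota>. Pow (W \<iota>))"
  have RC': "R \<iota> \<subseteq> {1..2^k}" "R \<iota> \<noteq> {}" "C \<iota> \<subseteq> {1..2^k}" "C \<iota> \<noteq> {}" if "\<iota> \<in> B" for \<iota>
    using RC[OF that] rc by auto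
  have ball: "f \<iota> T \<in> Fset P" if "\<iota> \<in> B" for \<iota> T
    using signed_in_ball[OF RC'[OF that], of T] RC[OF that] by (simp add: f_def W_def)
  have cardW: "card (W \<iota>) = r * c" if "\<iota> \<in> B" for \<iota>
    using RC[OF that] by (simp add: W_def card_cartesian_product)
  have fin: "finite (W \<iota>)" if "\<iota> \<in> B" for \<iota>
    using cardW[OF that] rc card_ge_0_finite by force
  have finI: "finite I" unfolding I_def using B fin by auto
  have cardI: "card I = card B * 2 ^ (r * c)"
    unfolding I_def using B fin cardW by (subst card_SigmaI) (auto simp: card_Pow)
  have "ennreal (s - s / 4 ^ k * n) \<le> ran_error P M A"
  proof (rule average_lower_bound[where I = I and f = "\<lambda>(\<iota>, T). f \<iota> T" and g = "\<lambda>_ _ _ _. 0" and Q = Q, OF _ _ _ _ _ M])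
    fix A :: "level_algorithm"
    assume A: "det_algorithm P A" "Q A"
    define hits where "hits \<iota> = card {w\<in>W \<iota>. coord k w \<in> queried A (\<lambda>_ _ _. 0)}" for \<iota>
    define cst where "cst = ennreal_of_enat (cost A (\<lambda>_ _ _. 0))"
    define err where "err \<iota> T = ennreal (dev A (f \<iota> T))" for \<iota> T
    have "(\<Sum>\<iota>\<in>B. hits \<iota>) = card (\<Union>\<iota>\<in>B. {w\<in>W \<iota>. coord k w \<in> queried A (\<lambda>_ _ _. 0)})"
      unfolding hits_def using B fin disj
      by (intro card_UN_disjoint[symmetric]) (auto simp: disjoint_family_on_def)
    also have "(\<Union>\<iota>\<in>B. {w\<in>W \<iota>. coord k w \<in> queried A (\<lambda>_ _ _. 0)})
        = {w\<in>\<Union>(W ` B). coord k w \<in> queried A (\<lambda>_ _ _. 0)}" by auto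
    finally have hits: "of_nat (\<Sum>\<iota>\<in>B. hits \<iota>) \<le> cst"
      unfolding cst_def using B fin by (simp only:) (intro card_queried_coord, auto)
    have "of_nat (card I) * ennreal s = (\<Sum>\<iota>\<in>B. of_nat (card (Pow (W \<iota>))) * ennreal s)"
      using fin cardW by (simp add: cardI card_Pow mult.assoc)
    also have "\<dots> \<le> (\<Sum>\<iota>\<in>B. \<Sum>T\<in>Pow (W \<iota>). err \<iota> T + ennreal (s / (r * c)) * of_nat (hits \<iota>))"
    proof (intro sum_mono)
      fix \<iota> assume \<iota>: "\<iota> \<in> B"
      have "of_nat (card (Pow (W \<iota>))) * ennreal s \<le> (\<Sum>T\<in>Pow (W \<iota>). err \<iota> T
          + ennreal (s / card (W \<iota>)) * of_nat (card {w\<in>W \<iota>. coord k w \<in> queried A (f \<iota> T)}))"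
        using block_average_ennreal[OF A(1) RC'[OF \<iota>]] RC[OF \<iota>] by (simp add: err_def f_def W_def s_def)
      also have "\<dots> \<le> (\<Sum>T\<in>Pow (W \<iota>). err \<iota> T + ennreal (s / (r * c)) * of_nat (hits \<iota>))"
      proof (intro sum_mono add_left_mono)
        fix T
        have "card {w\<in>W \<iota>. coord k w \<in> queried A (f \<iota> T)} \<le> hits \<iota>"
          unfolding hits_def using oblivious[OF A \<iota> ball[OF \<iota>]] fin[OF \<iota>] by (intro card_mono) auto
        then show "ennreal (s / card (W \<iota>)) * of_nat (card {w\<in>W \<iota>. coord k w \<in> queried A (f \<iota> T)})
            \<le> ennreal (s / (r * c)) * of_nat (hits \<iota>)"
          by (simp add: cardW[OF \<iota>] mult_left_mono)
      qed
      finally show "of_nat (card (Pow (W \<iota>))) * ennreal s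
          \<le> (\<Sum>T\<in>Pow (W \<iota>). err \<iota> T + ennreal (s / (r * c)) * of_nat (hits \<iota>))" .
    qed
    also have "\<dots> = (\<Sum>\<iota>\<in>B. \<Sum>T\<in>Pow (W \<iota>). err \<iota> T) + 2 ^ (r * c) * ennreal (s / (r * c)) * of_nat (\<Sum>\<iota>\<in>B. hits \<iota>)"
      using fin cardW by (simp add: sum.distrib card_Pow sum_distrib_left mult.assoc)
    also have "\<dots> \<le> (\<Sum>\<iota>\<in>B. \<Sum>T\<in>Pow (W \<iota>). err \<iota> T) + 2 ^ (r * c) * ennreal (s / (r * c)) * cst"
      using hits by (intro add_left_mono mult_left_mono) auto
    also have "2 ^ (r * c) * ennreal (s / (r * c)) = of_nat (card I) * ennreal (s / 4 ^ k)"
    proof -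
      have "2 ^ (r * c) * ennreal (s / (r * c)) = ennreal (2 ^ (r * c) * (s / (r * c)))"
        using s by (subst ennreal_mult) (auto simp: ennreal_power[symmetric])
      also have "2 ^ (r * c) * (s / (r * c)) = real (card I) * (s / 4 ^ k)"
      proof -
        have "(4::real) ^ k = real (card B) * (r * c)" using total
          by (metis of_nat_mult of_nat_numeral of_nat_power)
        moreover have "card B > 0" using B by (simp add: card_gt_0_iff)
        ultimately show ?thesis using rc by (simp add: cardI)
      qed
      also have "ennreal \<dots> = of_nat (card I) * ennreal (s / 4 ^ k)"
        using s by (subst ennreal_mult) (auto simp: ennreal_of_nat_eq_real_of_nat)
      finally show ?thesis .
    qed
    also have "(\<Sum>\<iota>\<in>B. \<Sum>T\<in>Pow (W \<iota>). err \<iota> T) + of_nat (card I) * ennreal (s / 4 ^ k) * cst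
        = (\<Sum>\<iota>T\<in>I. (case \<iota>T of (\<iota>, T) \<Rightarrow> err \<iota> T) + ennreal (s / 4 ^ k) * cst)"
      using B fin by (simp add: I_def sum.Sigma sum.distrib mult.assoc)
    finally show "of_nat (card I) * ennreal s \<le> (\<Sum>\<iota>\<in>I.
        ennreal (Gnorm P (Sol P (case \<iota> of (\<iota>, T) \<Rightarrow> f \<iota> T) - answer A (case \<iota> of (\<iota>, T) \<Rightarrow> f \<iota> T)))
        + ennreal (s / 4 ^ k) * ennreal_of_enat (cost A (\<lambda>_ _ _. 0)))"
      by (simp add: cst_def err_def case_prod_unfold)
  qed (use finI B s ball zero_in_ball in \<open>auto simp: I_def\<close>)
  then show ?thesis by (simp add: s_def right_diff_distrib)
qed

lemma ran_lower_single:
  "ennreal (2 powr ((a - b - \<alpha>) * real k) * (1 - n / 4 ^ k)) \<le> e_ran P n"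
  unfolding e_ran_def
proof (intro Inf_greatest, clarify)
  fix M and A :: "_ \<Rightarrow> level_algorithm"
  assume M: "ran_algorithm P M A" "ran_cost P M A \<le> of_nat n"
  have "ennreal (block_scale k 1 1 * (1 - n / 4 ^ k)) \<le> ran_error P M A"
  proof (rule ran_lower_blocks[where B = "grid k" and R = "\<lambda>w. {fst w}" and C = "\<lambda>w. {snd w}" and r = 1 and c = 1
        and k = k and Q = "\<lambda>_. True", simplified, OF _ _ _ _ _ _ M])
    fix A :: "level_algorithm" and w T
    assume A: "det_algorithm P A" and f: "signed k (peak k 1 1) {w} T \<in> Fset P"
    \<comment> \<open>Until the entry \<open>w\<close> is queried, the run cannot be distinguished from the run on zero.\<close>
    have "coord k w \<in> queried A (\<lambda>_ _ _. 0)"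
      if "coord k w \<in> queried A (signed k (peak k 1 1) {w} T)"
    proof (rule ccontr)
      assume n: "coord k w \<notin> queried A (\<lambda>_ _ _. 0)"
      have "queried A (signed k (peak k 1 1) {w} T) = queried A (\<lambda>_ _ _. 0)"
      proof (rule run_determined_by_queried(3))
        fix L assume L: "L \<in> queried A (\<lambda>_ _ _. 0)"
        then obtain m where "L = query A (info A (\<lambda>_ _ _. 0) m)" by (auto simp: queried_def)
        then have "L \<in> Info P" using A info_in_K[OF A zero_in_ball, of m] by (simp add: det_algorithm_def)
        then obtain l i' j' where lij: "L = (\<lambda>x. x l i' j')" by (auto simp: P_simps)
        then have "\<not> (l = k \<and> (i', j') = w)" using n L by (auto simp: coord_def)
        then show "L (signed k (peak k 1 1) {w} T) = L (\<lambda>_ _ _. 0)"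
          by (auto simp: lij signed_def)
      qed
      then show False using that n by simp
    qed
    then show "{w'. w' = w \<and> coord k w' \<in> queried A (signed k (peak k 1 1) {w} T)}
        \<subseteq> {w. coord k w \<in> queried A (\<lambda>_ _ _. 0)}" by auto
  qed (auto simp: grid_def card_cartesian_product power_mult_distrib[symmetric] disjoint_family_on_def)
  also have "block_scale k 1 1 = 2 powr ((a - b - \<alpha>) * real k)"
    by (simp add: block_scale_def powr_powr powr_add[symmetric] algebra_simps flip: powr_realpow)
  finally show "ennreal (2 powr ((a - b - \<alpha>) * real k) * (1 - n / 4 ^ k)) \<le> ran_error P M A" .
qed

text \<open>
  The rows are the blocks with the largest norm in the target space.  A nonadaptive algorithm makes the same queries on
  every input, in particular on zero.
\<close>

lemma ran_non_lower_row:
  "ennreal (2 powr ((a - \<alpha>) * real k) * (1 - n / 4 ^ k)) \<le> e_ran_non P n"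
  unfolding e_ran_non_def
proof (intro Inf_greatest, clarify)
  fix M and A :: "_ \<Rightarrow> level_algorithm"
  assume M: "ran_algorithm P M A" "ran_nonadaptive P M A" "ran_cost P M A \<le> of_nat n"
  have "ennreal (block_scale k (real 1) (real (2^k)) * (1 - n / 4 ^ k)) \<le> ran_error P M A"
  proof (rule ran_lower_blocks[where B = "{1..2^k}" and R = "\<lambda>i. {i}" and C = "\<lambda>_. {1..2^k}" and r = 1 and c = "2^k"
        and k = k and Q = "nonadaptive P", OF _ _ _ _ _ _ _ _ M(1) _ M(3)])
    fix A :: "level_algorithm" and i T
    assume A: "det_algorithm P A" "nonadaptive P A" and f: "signed k (peak k (real 1) (real (2 ^ k))) ({i} \<times> {1..2 ^ k}) T \<in> Fset P"
    show "{w \<in> {i} \<times> {1..2 ^ k}. coord k w \<in> queried A (signed k (peak k (real 1) (real (2 ^ k))) ({i} \<times> {1..2 ^ k}) T)}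
        \<subseteq> {w. coord k w \<in> queried A (\<lambda>_ _ _. 0)}"
      using nonadaptive_queried[OF A(2,1) info_in_K[OF A(1) f] info_in_K[OF A(1) zero_in_ball]] by auto
  qed (use M(2) in \<open>auto simp: power_mult_distrib[symmetric] disjoint_family_on_def ran_nonadaptive_def\<close>)
  also have "block_scale k (real 1) (real (2^k)) = 2 powr ((a - \<alpha>) * real k)"
    by (simp add: block_scale_def powr_powr powr_add[symmetric] algebra_simps flip: powr_realpow)
  finally show "ennreal (2 powr ((a - \<alpha>) * real k) * (1 - n / 4 ^ k)) \<le> ran_error P M A" .
qed


section \<open>Deterministic algorithms that restore the queried entries\<close>

definition entry :: "levels \<Rightarrow> nat \<times> nat \<times> nat \<Rightarrow> complex" where
  "entry x = (\<lambda>(k, i, j). x k i j)"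

definition entries :: "(nat \<times> nat \<times> nat) set" where
  "entries = {(k, i, j). i \<in> {1..2^k} \<and> j \<in> {1..2^k}}"

text \<open>
  The upper bounds use algorithms that ask for the entries proposed by a strategy and answer with the weighted
  entries they have seen, and zero elsewhere.  An entry may be proposed repeatedly; \<open>LEAST\<close> picks its first occurrence.
\<close>

definition fill_algorithm :: "(complex list \<Rightarrow> nat \<times> nat \<times> nat) \<Rightarrow> nat \<Rightarrow>
    level_algorithm" where
  "fill_algorithm strat n = \<lparr>query = (\<lambda>z x. entry x (strat z)), stop = (\<lambda>z. n \<le> length z),
     result = (\<lambda>z k i j. if \<exists>l<length z. strat (take l z) = (k, i, j)
       then of_real (2 powr (- \<alpha> * real k)) * z ! (LEAST l. l < length z \<and> strat (take l z) = (k, i, j))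
       else 0)\<rparr>"

definition visited :: "(complex list \<Rightarrow> nat \<times> nat \<times> nat) \<Rightarrow> nat \<Rightarrow> levels \<Rightarrow> (nat \<times> nat \<times> nat) set" where
  "visited strat n x = (\<lambda>l. strat (info (fill_algorithm strat n) x l)) ` {..<n}"

definition outside :: "(nat \<times> nat \<times> nat) set \<Rightarrow> levels \<Rightarrow> levels" where
  "outside V x = (\<lambda>k i j. if (k, i, j) \<in> V then 0 else x k i j)"

lemma target_norm_zero [simp]: "target_norm k (\<lambda>_ _. 0) = 0"
  using target_norm_scale[of k 0 "\<lambda>_ _. 0"] by simp

lemma fill_result:
  "result (fill_algorithm strat n) z k i j = (if \<exists>l<length z. strat (take l z) = (k, i, j)
     then of_real (2 powr (- \<alpha> * real k)) * z ! (LEAST l. l < length z \<and> strat (take l z) = (k, i, j))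
     else 0)"
  by (simp add: fill_algorithm_def)

lemma fill_det_algorithm:
  assumes "\<And>z. strat z \<in> entries"
  shows "det_algorithm P (fill_algorithm strat n)"
  unfolding det_algorithm_def
proof (intro ballI conjI)
  fix z assume z: "z \<in> lists (Kset P)"
  obtain k i j where "strat z = (k, i, j)" "i \<in> {1..2^k}" "j \<in> {1..2^k}"
    using assms[of z] by (auto simp: entries_def)
  then show "query (fill_algorithm strat n) z \<in> Info P"
    by (auto simp: fill_algorithm_def P_simps entry_def)
  let ?y = "result (fill_algorithm strat n) z"
  have supp: "(k, i, j) \<in> (\<lambda>l. strat (take l z)) ` {..<length z}" if "?y k i j \<noteq> 0" for k i j
  proof -
    have "\<exists>l<length z. strat (take l z) = (k, i, j)"
      using that by (metis fill_result)
    then obtain l where "l < length z" "strat (take l z) = (k, i, j)" by blast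
    then show ?thesis by (intro image_eqI[of _ _ l]) auto
  qed
  show "?y \<in> Gset P"
  proof (rule target_bound(1))
    show "?y k i j \<in> K" for k i j
    proof (cases "\<exists>l<length z. strat (take l z) = (k, i, j)")
      case True
      then have "(LEAST l. l < length z \<and> strat (take l z) = (k, i, j)) < length z"
        using LeastI_ex[of "\<lambda>l. l < length z \<and> strat (take l z) = (k, i, j)"] by blast
      then show ?thesis using True z by (auto simp: fill_algorithm_def P_simps intro!: K_closed)
    qed (auto simp: fill_algorithm_def K_closed)
    show "?y k i j = 0" if "i \<notin> {1..2^k} \<or> j \<notin> {1..2^k}" for k i j
    proof (rule ccontr)
      assume "?y k i j \<noteq> 0"
      then obtain l where "strat (take l z) = (k, i, j)" using supp by force
      then show False using assms[of "take l z"] that by (auto simp: entries_def)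
    qed
    show "summable (\<lambda>k. target_norm k (?y k))"
    proof (rule summable_finite)
      fix k assume "k \<notin> fst ` (\<lambda>l. strat (take l z)) ` {..<length z}"
      then have "(k, i, j) \<notin> (\<lambda>l. strat (take l z)) ` {..<length z}" for i j
        by (metis fst_conv image_eqI)
      then have "?y k = (\<lambda>_ _. 0)" using supp by blast
      then show "target_norm k (?y k) = 0" by simp
    qed auto
  qed simp
qed

lemma fill_cost: "cost (fill_algorithm strat n) x = enat n"
  by (simp add: cost_eq_enat_iff) (simp add: fill_algorithm_def)

lemma fill_error:
  "Sol P x - answer (fill_algorithm strat n) x = Sol P (outside (visited strat n x) x)"
proof (intro ext)
  fix k i j
  let ?A = "fill_algorithm strat n"
  have ans: "answer ?A x = result ?A (info ?A x n)" by (rule answer_enat[OF fill_cost])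
  have iff: "(\<exists>l<n. strat (take l (info ?A x n)) = (k, i, j)) \<longleftrightarrow> (k, i, j) \<in> visited strat n x"
    unfolding visited_def image_iff Bex_def lessThan_iff by (metis take_info less_imp_le)
  have eq: "info ?A x n ! (LEAST l. l < n \<and> strat (take l (info ?A x n)) = (k, i, j)) = x k i j"
    if "\<exists>l<n. strat (take l (info ?A x n)) = (k, i, j)"
  proof -
    define l where "l = (LEAST l. l < n \<and> strat (take l (info ?A x n)) = (k, i, j))"
    have l: "l < n" "strat (take l (info ?A x n)) = (k, i, j)"
      using LeastI_ex[of "\<lambda>l. l < n \<and> strat (take l (info ?A x n)) = (k, i, j)"] that by (auto simp: l_def)
    have "info ?A x n ! l = query ?A (info ?A x l) x" using l by (simp add: nth_info)
    also have "\<dots> = x k i j" using l by (simp add: take_info) (simp add: fill_algorithm_def entry_def)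
    finally show ?thesis by (simp add: l_def)
  qed
  have "result ?A (info ?A x n) k i j = (if (k, i, j) \<in> visited strat n x then of_real (2 powr (- \<alpha> * real k)) * x k i j else 0)"
    using iff eq by (subst fill_algorithm_def) simp
  then show "(Sol P x - answer ?A x) k i j = Sol P (outside (visited strat n x) x) k i j"
    by (simp add: ans P_simps embedding_def outside_def)
qed

lemma outside_in_ball: "x \<in> Fset P \<Longrightarrow> outside V x \<in> Fset P"
  by (rule in_Fset_I[of _ x]) (auto simp: outside_def K_closed P_simps sum_space_def)

lemma outside_level:
  assumes "x \<in> Fset P" "{(k, i, j) | i j. i \<in> {1..2^k} \<and> j \<in> {1..2^k}} \<subseteq> V"
  shows "outside V x k = (\<lambda>_ _. 0)"
proof (intro ext)
  fix i j
  show "outside V x k i j = 0"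
  proof (cases "i \<in> {1..2^k} \<and> j \<in> {1..2^k}")
    case True
    then have "(k, i, j) \<in> V" using assms(2) by blast
    then show ?thesis by (simp add: outside_def)
  next
    case False
    then show ?thesis using assms(1) by (auto simp: outside_def P_simps sum_space_def)
  qed
qed

lemma embedding_error_le:
  assumes "x \<in> Fset P" "summable c" "\<And>k. 2 powr (- \<alpha> * real k) * target_norm k (x k) \<le> c k"
  shows "Gnorm P (Sol P x) \<le> (\<Sum>k. c k)"
proof (rule target_bound(2)[OF _ _ assms(2)])
  show "target_norm k (Sol P x k) \<le> c k" for k
    using assms(3)[of k] by (simp add: P_simps embedding_def target_norm_scale)
qed (use assms K_closed in \<open>auto simp: P_simps embedding_def sum_space_def\<close>)

text \<open>
  Fix the entries that an algorithm reads on the input zero, and let \<open>y\<close> be the part of an input outside of them.  Then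
  neither \<open>y\<close> nor \<open>- y\<close> can be distinguished from zero, so the distance of one of their images from the answer is at least the norm
  of the image of \<open>y\<close>, which is the error of the algorithm that restores those entries.
\<close>

lemma e_det_non_le_e_det: "e_det_non P n \<le> e_det P n"
  unfolding e_det_def
proof (intro INF_greatest, clarify)
  fix A :: "level_algorithm"
  assume A: "det_algorithm P A" "det_cost P A \<le> enat n"
  define o0 where "o0 = (\<lambda>(_::nat) (_::nat) (_::nat). 0::complex)"
  have o0: "o0 \<in> Fset P" using zero_in_ball by (simp add: o0_def)
  have cost0: "cost A o0 \<le> enat n"
    using A(2) o0 by (auto simp: det_cost_def SUP_le_iff)
  have "\<exists>w. w \<in> entries \<and> query A (info A o0 l) = (\<lambda>x. entry x w)" for l
  proof -
    have "query A (info A o0 l) \<in> Info P"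
      using A(1) info_in_K[OF A(1) o0] by (simp add: det_algorithm_def)
    then obtain k i j where "query A (info A o0 l) = (\<lambda>x. x k i j)" "i \<in> {1..2^k}" "j \<in> {1..2^k}"
      by (auto simp: P_simps)
    then show ?thesis by (intro exI[of _ "(k, i, j)"]) (auto simp: entries_def entry_def)
  qed
  then obtain w where w: "\<And>l. w l \<in> entries" "\<And>l. query A (info A o0 l) = (\<lambda>x. entry x (w l))"
    by metis
  define strat where "strat z = w (length z)" for z :: "complex list"
  let ?B = "fill_algorithm strat n"
  have B: "det_algorithm P ?B" using w(1) by (intro fill_det_algorithm) (simp add: strat_def)
  have non: "nonadaptive P ?B" by (auto simp: nonadaptive_def fill_algorithm_def strat_def)
  have "det_cost P ?B \<le> enat n" by (auto simp: det_cost_def fill_cost intro: SUP_least)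
  then have "e_det_non P n \<le> det_error P ?B"
    unfolding e_det_non_def using B non by (intro INF_lower) auto
  also have "\<dots> \<le> det_error P A"
    unfolding det_error_def[of P ?B]
  proof (intro SUP_least)
    fix x assume x: "x \<in> Fset P"
    define y where "y = outside (visited strat n x) x"
    have y: "y \<in> Fset P" using x by (simp add: y_def outside_in_ball)
    have my: "- y \<in> Fset P"
      by (rule in_Fset_I[OF _ _ y]) (use y in \<open>auto simp: P_simps sum_space_def K_closed\<close>)
    have zero: "L z = L o0" if L: "L \<in> queried A o0" and z: "z = y \<or> z = - y" for L z
    proof -
      obtain l where l: "enat l < cost A o0" "L = query A (info A o0 l)"
        using L by (auto simp: queried_def)
      have "enat l < enat n" using l(1) cost0 by (rule less_le_trans)
      then have "w l \<in> visited strat n x" by (auto simp: visited_def strat_def)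
      then have "entry y (w l) = 0" by (cases "w l") (simp add: y_def outside_def entry_def)
      then have "entry z (w l) = 0" "entry o0 (w l) = 0"
        using z by (cases "w l"; auto simp: entry_def o0_def)+
      then show ?thesis by (simp add: l(2) w(2))
    qed
    have ans: "answer A y = answer A o0" "answer A (- y) = answer A o0"
      using zero by (auto intro!: run_determined_by_queried(2))
    have sneg: "Sol P (- y) = - Sol P y" by (auto simp: P_simps embedding_def fun_eq_iff)
    have Sy: "Sol P y \<in> Gset P" by (rule embedding_in_Gset[OF y])
    have "2 * Gnorm P (Sol P y) \<le> Gnorm P (Sol P y - answer A o0) + Gnorm P (- Sol P y - answer A o0)"
      by (rule Gnorm_midpoint[OF Sy answer_in_Gset[OF A(1) o0]])
    then have "Gnorm P (Sol P y) \<le> max (dev A y) (dev A (- y))"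
      by (simp add: ans sneg)
    then have "ennreal (Gnorm P (Sol P y)) \<le> max (ennreal (dev A y))
        (ennreal (dev A (- y)))"
      by (auto simp: le_max_iff_disj intro: ennreal_leI)
    also have "\<dots> \<le> det_error P A"
      unfolding det_error_def by (intro max.boundedI SUP_upper y my)
    finally show "ennreal (dev ?B x) \<le> det_error P A"
      by (simp add: fill_error y_def)
  qed
  finally show "e_det_non P n \<le> det_error P A" .
qed

lemma Gseparable_countable:
  assumes "countable H" "H \<subseteq> Gset P" shows "Gseparable P H"
proof -
  have "target_norm k (x k - x k) = 0" for x k
    using target_norm_zero[of k] by (simp add: fun_diff_def)
  then have "Gnorm P (x - x) = 0" for x
    using ell_norm_le_suminf(2)[OF exps(6), of "\<lambda>_. 0" "\<lambda>_. 0"] ell_norm_nonneg[OF exps(6), of "\<lambda>_. 0"]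
      ell_norm_le_suminf(1)[OF exps(6), of "\<lambda>_. 0" "\<lambda>_. 0"]
    by (simp add: P_simps sum_norm_def)
  then show ?thesis
    unfolding Gseparable_def using assms by (intro exI[of _ H] conjI ballI allI impI bexI) auto
qed

lemma ran_algorithm_pmf:
  assumes "\<And>\<omega>. det_algorithm P (A \<omega>)"
  shows "ran_algorithm P (measure_pmf \<mu>) A"
  unfolding ran_algorithm_def
proof (intro conjI ballI)
  fix f assume f: "f \<in> Fset P"
  have G: "space (Gborel P) = Gset P" by (auto simp: Gborel_def space_measure_of_conv)
  show "(\<lambda>\<omega>. answer (A \<omega>) f) \<in> measurable (measure_pmf \<mu>) (Gborel P)"
    using answer_in_Gset[OF assms f] by (simp add: G)
  show "\<exists>H. Gseparable P H \<and> (AE \<omega> in measure_pmf \<mu>. answer (A \<omega>) f \<in> H)"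
  proof (intro exI conjI)
    show "Gseparable P ((\<lambda>\<omega>. answer (A \<omega>) f) ` set_pmf \<mu>)"
      using answer_in_Gset[OF assms f] by (intro Gseparable_countable) auto
    show "AE \<omega> in measure_pmf \<mu>. answer (A \<omega>) f \<in> (\<lambda>\<omega>. answer (A \<omega>) f) ` set_pmf \<mu>"
      by (auto simp: AE_measure_pmf_iff)
  qed
qed (use assms in \<open>auto intro: measure_pmf.prob_space_axioms\<close>)

text \<open>
  A deterministic algorithm is a randomized one over a one-point sample space.
\<close>

lemma e_ran_non_le_e_det_non: "e_ran_non P n \<le> e_det_non P n"
  unfolding e_det_non_def
proof (intro INF_greatest, clarify)
  fix A :: "level_algorithm"
  assume A: "det_algorithm P A" "nonadaptive P A" "det_cost P A \<le> enat n"
  have "e_ran_non P n \<le> ran_error P (measure_pmf (return_pmf ())) (\<lambda>_. A)"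
  proof (rule e_ran_non_le)
    show "ran_algorithm P (measure_pmf (return_pmf ())) (\<lambda>_. A)" using A by (intro ran_algorithm_pmf)
    show "ran_nonadaptive P (measure_pmf (return_pmf ())) (\<lambda>_. A)" using A by (simp add: ran_nonadaptive_def)
    have "ennreal_of_enat (cost A f) \<le> of_nat n" if "f \<in> Fset P" for f
    proof -
      have "cost A f \<le> enat n" using A(3) that by (auto simp: det_cost_def SUP_le_iff)
      then show ?thesis by (cases "cost A f") auto
    qed
    then show "ran_cost P (measure_pmf (return_pmf ())) (\<lambda>_. A) \<le> of_nat n"
      by (simp add: ran_cost_def SUP_least measure_pmf.emeasure_space_1)
  qed
  then show "e_ran_non P n \<le> det_error P A"
    by (simp add: ran_error_def det_error_def measure_pmf.emeasure_space_1)
qed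

text \<open>
  A fixed list of queries, followed by a list computed from the values obtained.  The entry \<open>(0, 1, 1)\<close> pads the
  run when both lists are exhausted.
\<close>

definition two_stage :: "(nat \<times> nat \<times> nat) list \<Rightarrow> (complex list \<Rightarrow> (nat \<times> nat \<times> nat) list) \<Rightarrow> complex list \<Rightarrow> nat \<times> nat \<times> nat" where
  "two_stage Q sel z = (if length z < length Q then Q ! length z
     else let R = sel (take (length Q) z) in
       if length z - length Q < length R then R ! (length z - length Q) else (0, 1, 1))"

lemma two_stage_entries:
  assumes "set Q \<subseteq> entries" "\<And>z. set (sel z) \<subseteq> entries"
  shows "two_stage Q sel z \<in> entries"
proof -
  have "(0, 1, 1) \<in> entries" by (simp add: entries_def)
  moreover have "Q ! l \<in> entries" if "l < length Q" for l using that assms(1) nth_mem by blast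
  moreover have "sel z' ! l \<in> entries" if "l < length (sel z')" for l z' using that assms(2) nth_mem by blast
  ultimately show ?thesis unfolding two_stage_def Let_def by presburger
qed

lemma visited_two_stage:
  assumes "length Q + length (sel (map (entry x) Q)) \<le> n"
  shows "set Q \<union> set (sel (map (entry x) Q)) \<subseteq> visited (two_stage Q sel) n x"
proof -
  let ?A = "fill_algorithm (two_stage Q sel) n"
  have q: "query ?A z x = entry x (two_stage Q sel z)" for z by (simp add: fill_algorithm_def)
  have first: "info ?A x l = map (entry x) (take l Q)" if "l \<le> length Q" for l
    using that
  proof (induction l)
    case (Suc l)
    then have "two_stage Q sel (map (entry x) (take l Q)) = Q ! l" by (simp add: two_stage_def)
    then show ?case using Suc by (simp add: q take_Suc_conv_app_nth)
  qed simp
  have "Q ! l \<in> visited (two_stage Q sel) n x" if "l < length Q" for l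
  proof -
    have "two_stage Q sel (info ?A x l) = Q ! l" using that by (simp add: two_stage_def)
    then show ?thesis unfolding visited_def by (rule image_eqI[OF sym]) (use that assms in auto)
  qed
  moreover have "sel (map (entry x) Q) ! l \<in> visited (two_stage Q sel) n x"
    if "l < length (sel (map (entry x) Q))" for l
  proof -
    have "take (length Q) (info ?A x (length Q + l)) = map (entry x) Q"
      using first[of "length Q"] by (simp add: take_info)
    then have "two_stage Q sel (info ?A x (length Q + l)) = sel (map (entry x) Q) ! l"
      using that by (simp add: two_stage_def)
    then show ?thesis unfolding visited_def by (rule image_eqI[OF sym]) (use that assms in auto)
  qed
  ultimately show ?thesis by (force simp: in_set_conv_nth)
qed

definition level_entries :: "nat \<Rightarrow> (nat \<times> nat \<times> nat) list" where
  "level_entries k = concat (map (\<lambda>l. map (Pair l) (List.product [1..<2^l + 1] [1..<2^l + 1])) [0..<Suc k])"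

lemma set_level_entries: "set (level_entries k) = {(l, i, j). l \<le> k \<and> i \<in> {1..2^l} \<and> j \<in> {1..2^l}}"
proof -
  have "set (level_entries k) = (\<Union>l\<in>{0..<Suc k}. Pair l ` ({1..<2^l + 1} \<times> {1..<2^l + 1}))"
    by (simp add: level_entries_def del: upt_Suc)
  also have "\<dots> = {(l, i, j). l \<le> k \<and> i \<in> {1..2^l} \<and> j \<in> {1..2^l}}"
    by (simp add: set_eq_iff image_iff) (auto simp: less_Suc_eq_le)
  finally show ?thesis .
qed

lemma length_level_entries: "length (level_entries k) \<le> 2 * 4 ^ k"
proof -
  have "length (level_entries k) = (\<Sum>l<Suc k. 4 ^ l)"
    by (induction k) (auto simp: level_entries_def power_mult_distrib[symmetric])
  moreover have "(\<Sum>l<Suc k. 4 ^ l) \<le> 2 * (4::nat) ^ k"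
    by (induction k) auto
  ultimately show ?thesis by simp
qed

lemma e_det_non_upper:
  assumes "2 * 4 ^ k \<le> n"
  shows "e_det_non P n \<le> ennreal (2 powr ((a - \<alpha>) * real k) * (\<Sum>l. 2 powr ((a - \<alpha>) * real l)))"
proof -
  define strat where "strat = two_stage (level_entries k) (\<lambda>_. [])"
  let ?A = "fill_algorithm strat n"
  have "strat z \<in> entries" for z
    unfolding strat_def by (rule two_stage_entries) (auto simp: set_level_entries entries_def)
  then have A: "det_algorithm P ?A" by (rule fill_det_algorithm)
  have "nonadaptive P ?A" by (auto simp: nonadaptive_def fill_algorithm_def strat_def two_stage_def)
  moreover have "det_cost P ?A \<le> enat n" by (auto simp: det_cost_def fill_cost intro: SUP_least)
  ultimately have "e_det_non P n \<le> det_error P ?A"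
    unfolding e_det_non_def using A by (intro INF_lower) auto
  also have "\<dots> \<le> ennreal (2 powr ((a - \<alpha>) * real k) * (\<Sum>l. 2 powr ((a - \<alpha>) * real l)))"
    unfolding det_error_def
  proof (intro SUP_least ennreal_leI)
    fix x assume x: "x \<in> Fset P"
    define y where "y = outside (visited strat n x) x"
    have y: "y \<in> Fset P" using x by (simp add: y_def outside_in_ball)
    have low: "y l = (\<lambda>_ _. 0)" if "l \<le> k" for l
      unfolding y_def
    proof (rule outside_level[OF x])
      show "{(l, i, j) | i j. i \<in> {1..2^l} \<and> j \<in> {1..2^l}} \<subseteq> visited strat n x"
        using visited_two_stage[of "level_entries k" "\<lambda>_. []" x n] length_level_entries[of k] assms that
        by (auto simp: strat_def set_level_entries)
    qed
    have neg: "a - \<alpha> < 0" using ab \<alpha>2 by simp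
    have "Gnorm P (Sol P y) \<le> (\<Sum>l. if l < k then 0 else 2 powr ((a - \<alpha>) * real l))"
    proof (rule embedding_error_le[OF y tail_decay(1)[OF neg]])
      show "2 powr (- \<alpha> * real l) * target_norm l (y l) \<le> (if l < k then 0 else 2 powr ((a - \<alpha>) * real l))" for l
        using low[of l] weighted_target_norm_le[OF y, of l] by simp
    qed
    also have "\<dots> = 2 powr ((a - \<alpha>) * real k) * (\<Sum>l. 2 powr ((a - \<alpha>) * real l))"
      by (rule tail_decay(2)[OF neg])
    finally show "dev ?A x \<le> 2 powr ((a - \<alpha>) * real k) * (\<Sum>l. 2 powr ((a - \<alpha>) * real l))"
      by (simp add: fill_error y_def)
  qed
  finally show ?thesis .
qed

end

section \<open>Randomized estimation of norms\<close>

lemma pmf_markov: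
  fixes f :: "'a \<Rightarrow> real"
  assumes "finite (set_pmf p)" "\<And>x. x \<in> set_pmf p \<Longrightarrow> 0 \<le> f x" "0 < c"
  shows "measure_pmf.prob p {x. c \<le> f x} \<le> measure_pmf.expectation p f / c"
proof -
  have "c * measure_pmf.prob p {x. c \<le> f x} = measure_pmf.expectation p (\<lambda>x. c * indicator {x. c \<le> f x} x)"
    by simp
  also have "\<dots> \<le> measure_pmf.expectation p f"
    using assms by (intro integral_mono_AE integrable_measure_pmf_finite)
      (auto simp: AE_measure_pmf_iff indicator_def)
  finally show ?thesis using assms by (simp add: field_simps)
qed

definition sample_pmf :: "nat \<Rightarrow> nat \<Rightarrow> (nat \<Rightarrow> nat) pmf" where
  "sample_pmf m N = Pi_pmf {..<m} 0 (\<lambda>_. pmf_of_set {1..N})"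

lemma finite_set_Pi_pmf:
  assumes "finite A" "\<And>x. x \<in> A \<Longrightarrow> finite (set_pmf (p x))"
  shows "finite (set_pmf (Pi_pmf A d p))"
  using assms by (auto simp: set_Pi_pmf intro!: finite_PiE_dflt)

lemma finite_set_sample_pmf: "1 \<le> N \<Longrightarrow> finite (set_pmf (sample_pmf m N))"
  unfolding sample_pmf_def by (intro finite_set_Pi_pmf) auto

lemma set_sample_pmf:
  assumes "1 \<le> N" "\<omega> \<in> set_pmf (sample_pmf m N)" "s < m" shows "\<omega> s \<in> {1..N}"
  using assms by (auto simp: sample_pmf_def set_Pi_pmf PiE_dflt_def)

text \<open>
  Markov's inequality; integrability is all that is known about the upper tail.
\<close>

lemma sample_upper_tail:
  assumes "1 \<le> N" "1 \<le> m" "\<And>j. j \<in> {1..N} \<Longrightarrow> 0 \<le> g j"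
  defines "\<mu> \<equiv> (\<Sum>j=1..N. g j) / N"
  shows "measure_pmf.prob (sample_pmf m N) {\<omega>. 64 * \<mu> < (\<Sum>s<m. g (\<omega> s)) / m} \<le> 1 / 64"
proof (cases "\<mu> = 0")
  case True
  then have "g j = 0" if "j \<in> {1..N}" for j
    using that assms sum_nonneg_eq_0_iff[of "{1..N}" g] by simp
  then have "{\<omega>. 64 * \<mu> < (\<Sum>s<m. g (\<omega> s)) / m} \<inter> set_pmf (sample_pmf m N) = {}"
    using True set_sample_pmf[OF assms(1)] by (auto simp: sum.neutral)
  then have "measure_pmf.prob (sample_pmf m N) {\<omega>. 64 * \<mu> < (\<Sum>s<m. g (\<omega> s)) / m} = 0"
    by (simp add: measure_pmf_zero_iff Int_commute)
  then show ?thesis by simp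
next
  case False
  moreover have "0 \<le> \<mu>" unfolding \<mu>_def using assms(3) by (intro divide_nonneg_nonneg sum_nonneg) auto
  ultimately have \<mu>: "\<mu> > 0" by simp
  have E: "measure_pmf.expectation (sample_pmf m N) (\<lambda>\<omega>. \<Sum>s<m. g (\<omega> s)) = m * \<mu>"
    unfolding sample_pmf_def using assms
    by (subst expectation_sum_Pi_pmf) (auto intro!: integrable_measure_pmf_finite simp: integral_pmf_of_set \<mu>_def)
  have "measure_pmf.prob (sample_pmf m N) {\<omega>. 64 * \<mu> < (\<Sum>s<m. g (\<omega> s)) / m}
      \<le> measure_pmf.prob (sample_pmf m N) {\<omega>. 64 * \<mu> * m \<le> (\<Sum>s<m. g (\<omega> s))}"
    using assms(2) by (intro measure_pmf.finite_measure_mono) (auto simp: field_simps)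
  also have "\<dots> \<le> measure_pmf.expectation (sample_pmf m N) (\<lambda>\<omega>. \<Sum>s<m. g (\<omega> s)) / (64 * \<mu> * m)"
    using assms(1-3) \<mu> set_sample_pmf[OF assms(1)]
    by (intro pmf_markov finite_set_sample_pmf) (auto intro!: sum_nonneg)
  also have "\<dots> = 1 / 64" using \<mu> assms(1,2) by (simp add: E)
  finally show ?thesis .
qed

text \<open>
  Convexity puts the exponential below a chord; the slope \<open>1 / 2\<close> is enough for the tail bound that follows.
\<close>

lemma exp_minus_le_chord:
  fixes x :: real assumes "0 \<le> x" "x \<le> 1" shows "exp (- x) \<le> 1 - x / 2"
proof -
  have "1 + x + x^2 / 2 \<le> exp x" using exp_lower_Taylor_quadratic assms by blast
  then have "exp (- x) \<le> 1 / (1 + x + x^2 / 2)"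
    using assms by (simp add: exp_minus inverse_eq_divide frac_le add_pos_nonneg)
  also have "\<dots> \<le> 1 - x / 2"
  proof -
    have "x * x * x \<le> x * x * 1" using assms by (intro mult_left_mono) auto
    moreover have "x * x \<le> x * 1" using assms by (intro mult_left_mono) auto
    moreover have "(1 - x / 2) * (1 + x + x^2 / 2) = 1 + x / 2 - x * x * x / 4"
      by (simp add: field_simps power2_eq_square)
    ultimately have "1 \<le> (1 - x / 2) * (1 + x + x^2 / 2)" using assms by linarith
    then show ?thesis using assms by (simp add: divide_le_eq add_pos_nonneg)
  qed
  finally show ?thesis .
qed

text \<open>
  A Chernoff bound: sums of nonnegative variables rarely fall below a fraction of their mean, and boundedness by one
  controls the Laplace transform at \<open>-1\<close>.
\<close>

lemma sample_lower_tail: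
  assumes "1 \<le> N" "\<And>j. j \<in> {1..N} \<Longrightarrow> 0 \<le> Y j \<and> Y j \<le> 1"
  defines "y \<equiv> (\<Sum>j=1..N. Y j) / N"
  shows "measure_pmf.prob (sample_pmf m N) {\<omega>. (\<Sum>s<m. Y (\<omega> s)) \<le> m * y / 4} \<le> exp (- (m * y / 4))"
proof -
  have one: "measure_pmf.expectation (pmf_of_set {1..N}) (\<lambda>j. exp (- Y j)) \<le> exp (- (y / 2))"
  proof -
    have "(\<Sum>j=1..N. exp (- Y j)) \<le> (\<Sum>j=1..N. 1 - Y j / 2)"
      using assms by (intro sum_mono exp_minus_le_chord) auto
    also have "\<dots> = N * (1 - y / 2)"
      using assms by (simp add: y_def sum_subtractf sum_divide_distrib[symmetric] field_simps)
    finally have "(\<Sum>j=1..N. exp (- Y j)) / N \<le> 1 - y / 2"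
      using assms(1) by (simp add: divide_le_eq mult.commute)
    also have "\<dots> \<le> exp (- (y / 2))" using exp_ge_add_one_self[of "- (y / 2)"] by simp
    finally show ?thesis using assms by (simp add: integral_pmf_of_set)
  qed
  have "measure_pmf.expectation (sample_pmf m N) (\<lambda>\<omega>. \<Prod>s<m. exp (- Y (\<omega> s)))
      = (\<Prod>s<m. measure_pmf.expectation (pmf_of_set {1..N}) (\<lambda>j. exp (- Y j)))"
    unfolding sample_pmf_def using assms
    by (intro expectation_prod_Pi_pmf) (auto intro!: integrable_measure_pmf_finite)
  also have "\<dots> \<le> exp (- (y / 2)) ^ m"
    using one by (simp add: power_mono integral_nonneg)
  also have "\<dots> = exp (- (m * y / 2))" by (simp add: exp_of_nat_mult[symmetric])
  finally have E: "measure_pmf.expectation (sample_pmf m N) (\<lambda>\<omega>. exp (- (\<Sum>s<m. Y (\<omega> s)))) \<le> exp (- (m * y / 2))"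
    by (simp add: exp_sum[symmetric] sum_negf)
  have "measure_pmf.prob (sample_pmf m N) {\<omega>. (\<Sum>s<m. Y (\<omega> s)) \<le> m * y / 4}
      = measure_pmf.prob (sample_pmf m N) {\<omega>. exp (- (m * y / 4)) \<le> exp (- (\<Sum>s<m. Y (\<omega> s)))}"
    by simp
  also have "\<dots> \<le> measure_pmf.expectation (sample_pmf m N) (\<lambda>\<omega>. exp (- (\<Sum>s<m. Y (\<omega> s)))) / exp (- (m * y / 4))"
    by (intro pmf_markov finite_set_sample_pmf assms) auto
  also have "\<dots> \<le> exp (- (m * y / 2)) / exp (- (m * y / 4))"
    using E by (intro divide_right_mono) auto
  also have "\<dots> = exp (- (m * y / 4))" by (simp add: exp_diff[symmetric])
  finally show ?thesis .
qed

lemma exp_8: "64 \<le> exp (8::real)"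
proof -
  have "(2::real) ^ 8 \<le> exp 1 ^ 8"
    using exp_ge_add_one_self[of 1] by (intro power_mono) auto
  then show ?thesis by (simp add: exp_of_nat_mult[symmetric])
qed

text \<open>
  Values above \<open>m powr (1/u)\<close> times the \<open>L\<^sub>u\<close>-norm are hit by about one of \<open>m\<close> samples at most, but they carry
  little of the \<open>v\<close>-th moment; this is where the rate \<open>b\<close> comes from.
\<close>

lemma Lp_norm_tail:
  assumes N: "1 \<le> N" and v: "1 \<le> v" "ereal v < u" and m: "0 < m"
    and h: "\<And>j. j \<in> {1..N} \<Longrightarrow> 0 \<le> h j"
  defines "w \<equiv> Lp_norm u N h"
  defines "B \<equiv> w * m powr recip u"
  assumes w: "0 < w"
  shows "(\<Sum>j=1..N. if B < h j then h j powr v else 0) / N \<le> m powr (v * recip u - 1) * w powr v"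
proof -
  have u: "1 \<le> u" using v by (metis ereal_less_eq(3) less_imp_le one_ereal_def order_trans)
  show ?thesis using u
  proof (cases rule: exponent_cases)
    case 1
    have "h j \<le> B" if "j \<in> {1..N}" for j
      using Lp_norm_coord[OF N u that, of h] h[OF that] 1 m N by (simp add: B_def w_def)
    then have "(\<Sum>j=1..N. if B < h j then h j powr v else 0) = 0"
      by (intro sum.neutral) (auto simp: not_less[symmetric])
    then show ?thesis using N by simp
  next
    case (2 t)
    have t: "v < t" "1 \<le> t" using v 2 by auto
    have B: "B > 0" using w m by (simp add: B_def)
    have "(if B < h j then h j powr v else 0) \<le> B powr (v - t) * h j powr t" if "j \<in> {1..N}" for j
    proof (cases "B < h j")
      case True
      have "h j powr v = h j powr (v - t) * h j powr t" by (simp add: powr_add[symmetric])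
      also have "\<dots> \<le> B powr (v - t) * h j powr t"
        using True B t by (intro mult_right_mono powr_mono2') auto
      finally show ?thesis using True by simp
    qed auto
    then have "(\<Sum>j=1..N. if B < h j then h j powr v else 0) \<le> (\<Sum>j=1..N. B powr (v - t) * h j powr t)"
      by (rule sum_mono)
    also have "\<dots> = B powr (v - t) * (w powr t * N)"
      using Lp_norm_powr[OF N t(2), of h] N h 2 by (simp add: w_def sum_distrib_left)
    finally have "(\<Sum>j=1..N. if B < h j then h j powr v else 0) / N \<le> B powr (v - t) * w powr t"
      using N by (simp add: divide_le_eq mult.assoc)
    also have "\<dots> = m powr ((v - t) / t) * w powr v"
      using w m 2 by (simp add: B_def powr_mult powr_powr powr_add[symmetric])
    also have "(v - t) / t = v * recip u - 1" using 2 t by (simp add: diff_divide_distrib)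
    finally show ?thesis .
  qed
qed

text \<open>
  An estimate \<open>e\<close> of the \<open>v\<close>-th power of the \<open>L\<^sub>v\<close>-norm is acceptable if it is never much too large, and not much too small
  unless the \<open>L\<^sub>v\<close>-norm is negligible compared with the \<open>L\<^sub>u\<close>-norm.
\<close>

definition block_fine :: "nat \<Rightarrow> real \<Rightarrow> ereal \<Rightarrow> nat \<Rightarrow> (nat \<Rightarrow> real) \<Rightarrow> real \<Rightarrow> bool" where
  "block_fine N v u m h e \<longleftrightarrow> e \<le> 64 * Lp_norm (ereal v) N h powr v \<and>
     (64 * m powr (recip u - 1 / v) * Lp_norm u N h < Lp_norm (ereal v) N h \<longrightarrow> Lp_norm (ereal v) N h powr v / 8 \<le> e)"

text \<open>
  Too large an estimate is excluded by Markov's inequality.  For the other direction the values are truncated at the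
  level \<open>B\<close> of \<open>Lp_norm_tail\<close>: if the \<open>L\<^sub>v\<close>-norm is above the threshold, the truncated values keep half of the mean,
  and after division by \<open>B powr v\<close> the expected sum of the sample is at least \<open>32\<close>, so the Chernoff bound applies.
\<close>

lemma sample_block_fine:
  assumes N: "1 \<le> N" and v: "1 \<le> v" "ereal v < u" and m: "1 \<le> m"
    and h: "\<And>j. 0 \<le> h j"
  shows "measure_pmf.prob (sample_pmf m N) {\<omega>. \<not> block_fine N v u m h ((\<Sum>s<m. h (\<omega> s) powr v) / m)} \<le> 1 / 32"
proof -
  define M where "M = sample_pmf m N"
  define e where "e \<omega> = (\<Sum>s<m. h (\<omega> s) powr v) / m" for \<omega> :: "nat \<Rightarrow> nat"
  define w where "w = Lp_norm u N h"
  define \<mu> where "\<mu> = (\<Sum>j=1..N. h j powr v) / N"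
  define big where "big \<longleftrightarrow> 64 * m powr (recip u - 1 / v) * w < Lp_norm (ereal v) N h"
  have u: "1 \<le> u" using v by (metis ereal_less_eq(3) less_imp_le one_ereal_def order_trans)
  have \<mu>: "\<mu> = Lp_norm (ereal v) N h powr v"
    using Lp_norm_powr[OF N v(1), of h] h by (simp add: \<mu>_def)
  have up: "measure_pmf.prob M {\<omega>. 64 * \<mu> < e \<omega>} \<le> 1 / 64"
    unfolding M_def e_def \<mu>_def by (intro sample_upper_tail N m) auto
  have lo: "measure_pmf.prob M {\<omega>. big \<and> e \<omega> < \<mu> / 8} \<le> 1 / 64"
  proof (cases big)
    case True
    define B where "B = w * m powr recip u"
    define Y where "Y j = (if h j \<le> B then (h j / B) powr v else 0)" for j
    define y where "y = (\<Sum>j=1..N. Y j) / N"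
    have w0: "0 \<le> w" unfolding w_def by (rule Lp_norm_nonneg[OF N u])
    have vw: "Lp_norm (ereal v) N h \<le> w" 
      unfolding w_def using v by (intro Lp_norm_exponent_mono N) auto
    have w: "0 < w" using True w0 vw by (cases "w = 0") (auto simp: big_def)
    have B: "0 < B" using w m by (simp add: B_def)
    have big: "64 * (m powr (v * recip u - 1) * w powr v) < \<mu>"
    proof -
      have "64 * (m powr (v * recip u - 1) * w powr v) \<le> 64 powr v * (m powr (v * recip u - 1) * w powr v)"
        using powr_mono[of 1 v "64::real"] v by (intro mult_right_mono) auto
      also have "\<dots> = (64 * m powr (recip u - 1 / v) * w) powr v"
      proof -
        have "v * recip u - 1 = (recip u - 1 / v) * v" using v by (simp add: left_diff_distrib)
        then show ?thesis using v w m by (simp add: powr_mult powr_powr)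
      qed
      also have "\<dots> < \<mu>"
        unfolding \<mu> using True w v by (intro powr_less_mono2) (auto simp: big_def)
      finally show ?thesis .
    qed
    \<comment> \<open>Values above the truncation level \<open>B\<close> carry at most half of the mean.\<close>
    have half: "\<mu> / 2 \<le> B powr v * y"
    proof -
      have "(\<Sum>j=1..N. h j powr v) = (\<Sum>j=1..N. B powr v * Y j + (if B < h j then h j powr v else 0))"
        using B h by (intro sum.cong) (auto simp: Y_def powr_divide)
      then have "\<mu> = B powr v * y + (\<Sum>j=1..N. if B < h j then h j powr v else 0) / N"
        by (simp add: \<mu>_def y_def sum.distrib sum_distrib_left add_divide_distrib)
      also have "\<dots> \<le> B powr v * y + m powr (v * recip u - 1) * w powr v"
        using Lp_norm_tail[OF N v, of m h] m w h by (simp add: w_def B_def)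
      finally have "\<mu> \<le> B powr v * y + m powr (v * recip u - 1) * w powr v" .
      moreover have "0 \<le> m powr (v * recip u - 1) * w powr v" by simp
      ultimately show ?thesis using big by linarith
    qed
    have Bv: "B powr v = m * (m powr (v * recip u - 1) * w powr v)"
      using w m by (simp add: B_def powr_mult powr_powr mult.commute powr_diff)
    (* the threshold 64 was chosen to give exp (- 8) \<le> 1 / 64 here *)
    have y: "8 \<le> m * y / 4"
    proof -
      define Q where "Q = m powr (v * recip u - 1) * w powr v"
      have "B powr v * (32 * (1 / m)) = 32 * Q" using m unfolding Bv Q_def[symmetric] by simp
      also have "\<dots> \<le> B powr v * y" using big half unfolding Q_def[symmetric] by linarith
      finally have "B powr v * (32 * (1 / m)) \<le> B powr v * y" .
      then have "32 * (1 / m) \<le> y" using B mult_le_cancel_left_pos[of "B powr v"] by (metis less_irrefl powr_gt_zero)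
      then show ?thesis using m by (simp add: field_simps)
    qed
    have "measure_pmf.prob M {\<omega>. big \<and> e \<omega> < \<mu> / 8} \<le> measure_pmf.prob M {\<omega>. (\<Sum>s<m. Y (\<omega> s)) \<le> m * y / 4}"
    proof (intro measure_pmf.finite_measure_mono subsetI CollectI)
      fix \<omega> assume "\<omega> \<in> {\<omega>. big \<and> e \<omega> < \<mu> / 8}"
      then have e: "e \<omega> < \<mu> / 8" by simp
      have "B powr v * Y j \<le> h j powr v" for j
        using B h by (auto simp: Y_def powr_divide)
      then have "(\<Sum>s<m. B powr v * Y (\<omega> s)) \<le> (\<Sum>s<m. h (\<omega> s) powr v)" by (intro sum_mono) auto
      then have "B powr v * (\<Sum>s<m. Y (\<omega> s)) \<le> m * e \<omega>" using m by (simp add: e_def flip: sum_distrib_left)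
      also have "\<dots> \<le> m * (\<mu> / 8)" using e by (intro mult_left_mono) auto
      also have "\<dots> \<le> m * (B powr v * y / 4)" using half by (intro mult_left_mono) auto
      finally have "B powr v * (\<Sum>s<m. Y (\<omega> s)) \<le> B powr v * (m * y / 4)" by (simp add: mult_ac)
      then show "(\<Sum>s<m. Y (\<omega> s)) \<le> m * y / 4" using B mult_le_cancel_left_pos[of "B powr v"] by (metis less_irrefl powr_gt_zero)
    qed auto
    also have "\<dots> \<le> exp (- (m * y / 4))"
      unfolding M_def y_def using B h v
      by (intro sample_lower_tail N) (auto simp: Y_def intro!: powr_le1)
    also have "\<dots> \<le> exp (- 8)" using y by simp
    also have "\<dots> \<le> 1 / 64" using exp_8 by (simp add: exp_minus inverse_eq_divide field_simps)
    finally show ?thesis .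
  qed simp
  have "measure_pmf.prob M {\<omega>. \<not> block_fine N v u m h (e \<omega>)}
      \<le> measure_pmf.prob M ({\<omega>. 64 * \<mu> < e \<omega>} \<union> {\<omega>. big \<and> e \<omega> < \<mu> / 8})"
    by (intro measure_pmf.finite_measure_mono) (auto simp: block_fine_def \<mu> big_def w_def)
  also have "\<dots> \<le> 1 / 64 + 1 / 64"
    using up lo by (intro order_trans[OF measure_Un_le] add_mono) auto
  finally show ?thesis by (simp add: M_def e_def)
qed

text \<open>
  The largest value reached by at least half of the entries: this form of the median lies between any two bounds
  that are obeyed by a majority of the entries.
\<close>

definition median :: "nat \<Rightarrow> (nat \<Rightarrow> real) \<Rightarrow> real" where
  "median r E = Max {y \<in> E ` {..<r}. r \<le> 2 * card {t\<in>{..<r}. y \<le> E t}}"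

lemma median_between:
  assumes "2 * card {t\<in>{..<r}. \<not> (X \<le> E t \<and> E t \<le> Y)} < r"
  shows "X \<le> median r E" "median r E \<le> Y"
proof -
  let ?S = "{y \<in> E ` {..<r}. r \<le> 2 * card {t\<in>{..<r}. y \<le> E t}}"
  define G where "G = {t\<in>{..<r}. X \<le> E t \<and> E t \<le> Y}"
  have "card G + card {t\<in>{..<r}. \<not> (X \<le> E t \<and> E t \<le> Y)} = card {..<r}"
  proof -
    have "{..<r} = G \<union> {t\<in>{..<r}. \<not> (X \<le> E t \<and> E t \<le> Y)}" by (auto simp: G_def)
    then show ?thesis by (subst (2) \<open>{..<r} = _\<close>) (intro card_Un_disjoint[symmetric], auto simp: G_def)
  qed
  then have G: "r < 2 * card G" using assms by simp
  then have "card G \<noteq> 0" by linarith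
  then have "G \<noteq> {}" "finite G" using card.infinite by fastforce+
  then obtain t0 where t0: "t0 \<in> G" "\<And>t. t \<in> G \<Longrightarrow> E t0 \<le> E t"
    using ex_is_arg_min_if_finite[of G E] by (auto simp: is_arg_min_linorder)
  have "card G \<le> card {t\<in>{..<r}. E t0 \<le> E t}"
    using t0 by (intro card_mono) (auto simp: G_def)
  then have mem: "E t0 \<in> ?S" using G t0 by (auto simp: G_def)
  have fin: "finite ?S" by simp
  have "E t0 \<le> median r E" unfolding median_def by (rule Max_ge[OF fin mem])
  then show "X \<le> median r E" using t0(1) by (simp add: G_def)
  have "median r E \<in> ?S" unfolding median_def using mem by (intro Max_in fin) blast
  then have r: "r \<le> 2 * card {t\<in>{..<r}. median r E \<le> E t}" by simp
  show "median r E \<le> Y"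
  proof (rule ccontr)
    assume "\<not> median r E \<le> Y"
    then have "{t\<in>{..<r}. median r E \<le> E t} \<inter> G = {}" by (auto simp: G_def)
    then have "card {t\<in>{..<r}. median r E \<le> E t} + card G = card ({t\<in>{..<r}. median r E \<le> E t} \<union> G)"
      using \<open>finite G\<close> by (intro card_Un_disjoint[symmetric]) auto
    also have "\<dots> \<le> card {..<r}" by (intro card_mono) (auto simp: G_def)
    finally show False using r G by simp
  qed
qed

text \<open>
  Median boosting.  Each bad block contributes a factor \<open>16\<close> to a product whose expectation is at most
  \<open>2 ^ r\<close> by independence, while a bad majority makes the product at least \<open>4 ^ r\<close>.
\<close>

lemma majority_of_blocks:
  assumes "finite (set_pmf p)" "measure_pmf.prob p Bd \<le> 1 / 32"
  shows "measure_pmf.prob (Pi_pmf {..<r} d (\<lambda>_. p)) {\<omega>. r \<le> 2 * card {t\<in>{..<r}. \<omega> t \<in> Bd}} \<le> (1 / 2) ^ r"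
proof -
  let ?M = "Pi_pmf {..<r} d (\<lambda>_. p)"
  define U where "U x = (if x \<in> Bd then 16 else 1 :: real)" for x
  have U: "(\<Prod>t<r. U (\<omega> t)) = 16 ^ card {t\<in>{..<r}. \<omega> t \<in> Bd}" for \<omega>
    unfolding U_def by (subst prod.inter_filter[symmetric]) auto
  have one: "measure_pmf.expectation p U \<le> 2"
  proof -
    have "U = (\<lambda>x. 1 + 15 * indicator Bd x)" by (auto simp: U_def)
    then have "measure_pmf.expectation p U = 1 + 15 * measure_pmf.prob p Bd"
      using assms(1) by (simp add: integrable_measure_pmf_finite)
    then show ?thesis using assms(2) by simp
  qed
  have "measure_pmf.expectation ?M (\<lambda>\<omega>. \<Prod>t<r. U (\<omega> t)) = (\<Prod>t<r. measure_pmf.expectation p U)"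
    using assms by (intro expectation_prod_Pi_pmf) (auto intro!: integrable_measure_pmf_finite simp: U_def)
  also have "\<dots> \<le> 2 ^ r"
    using one by (simp add: power_mono integral_nonneg U_def)
  finally have E: "measure_pmf.expectation ?M (\<lambda>\<omega>. \<Prod>t<r. U (\<omega> t)) \<le> 2 ^ r" .
  have "measure_pmf.prob ?M {\<omega>. r \<le> 2 * card {t\<in>{..<r}. \<omega> t \<in> Bd}}
      \<le> measure_pmf.prob ?M {\<omega>. 4 ^ r \<le> (\<Prod>t<r. U (\<omega> t))}"
  proof (intro measure_pmf.finite_measure_mono subsetI CollectI)
    fix \<omega> assume "\<omega> \<in> {\<omega>. r \<le> 2 * card {t\<in>{..<r}. \<omega> t \<in> Bd}}"
    then have "(4::real) ^ r \<le> 4 ^ (2 * card {t\<in>{..<r}. \<omega> t \<in> Bd})" by (intro power_increasing) auto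
    then show "4 ^ r \<le> (\<Prod>t<r. U (\<omega> t))" by (simp add: U power_mult)
  qed auto
  also have "\<dots> \<le> measure_pmf.expectation ?M (\<lambda>\<omega>. \<Prod>t<r. U (\<omega> t)) / 4 ^ r"
    using assms by (intro pmf_markov finite_set_Pi_pmf) (auto simp: U_def intro!: prod_nonneg)
  also have "\<dots> \<le> 2 ^ r / 4 ^ r" using E by (intro divide_right_mono) auto
  also have "\<dots> = (1 / 2) ^ r" by (simp add: power_divide[symmetric])
  finally show ?thesis .
qed

definition estimate :: "nat \<Rightarrow> nat \<Rightarrow> real \<Rightarrow> (nat \<Rightarrow> nat \<Rightarrow> nat) \<Rightarrow> (nat \<Rightarrow> real) \<Rightarrow> real" where
  "estimate r m v \<omega> h = median r (\<lambda>t. (\<Sum>s<m. h (\<omega> t s) powr v) / m)"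

text \<open>
  One sample of columns serves all rows of a level, because the rows are combined by a union bound.
\<close>

definition columns_pmf :: "nat \<Rightarrow> nat \<Rightarrow> nat \<Rightarrow> (nat \<Rightarrow> nat \<Rightarrow> nat) pmf" where
  "columns_pmf r m N = Pi_pmf {..<r} (\<lambda>_. 0) (\<lambda>_. sample_pmf m N)"

lemma estimate_fine:
  assumes N: "1 \<le> N" and v: "1 \<le> v" "ereal v < u" and m: "1 \<le> m" and h: "\<And>j. 0 \<le> h j"
  shows "measure_pmf.prob (columns_pmf r m N) {\<omega>. \<not> block_fine N v u m h (estimate r m v \<omega> h)} \<le> (1 / 2) ^ r"
proof -
  define Bd where "Bd = {\<omega>. \<not> block_fine N v u m h ((\<Sum>s<m. h (\<omega> s) powr v) / m)}"
  define \<mu> where "\<mu> = Lp_norm (ereal v) N h powr v"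
  define X where "X = (if 64 * m powr (recip u - 1 / v) * Lp_norm u N h < Lp_norm (ereal v) N h then \<mu> / 8 else 0)"
  have fine: "block_fine N v u m h e \<longleftrightarrow> X \<le> e \<and> e \<le> 64 * \<mu>" if "0 \<le> e" for e
    using that by (auto simp: block_fine_def X_def \<mu>_def)
  have fine': "block_fine N v u m h e" if "X \<le> e \<and> e \<le> 64 * \<mu>" for e
    using that by (auto simp: block_fine_def X_def \<mu>_def split: if_splits)
  have "block_fine N v u m h (estimate r m v \<omega> h)" if "2 * card {t\<in>{..<r}. \<omega> t \<in> Bd} < r" for \<omega>
  proof -
    have e0: "0 \<le> (\<Sum>s<m. h (\<omega> t s) powr v) / m" for t by (intro divide_nonneg_nonneg sum_nonneg) auto
    have "2 * card {t\<in>{..<r}. \<not> (X \<le> (\<Sum>s<m. h (\<omega> t s) powr v) / m \<and> (\<Sum>s<m. h (\<omega> t s) powr v) / m \<le> 64 * \<mu>)} < r"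
      using that by (simp add: Bd_def fine[OF e0])
    from median_between[OF this] show ?thesis
      unfolding estimate_def by (intro fine') auto
  qed
  then have "{\<omega>. \<not> block_fine N v u m h (estimate r m v \<omega> h)} \<subseteq> {\<omega>. r \<le> 2 * card {t\<in>{..<r}. \<omega> t \<in> Bd}}"
    by (auto simp: not_less[symmetric])
  then have "measure_pmf.prob (columns_pmf r m N) {\<omega>. \<not> block_fine N v u m h (estimate r m v \<omega> h)}
      \<le> measure_pmf.prob (columns_pmf r m N) {\<omega>. r \<le> 2 * card {t\<in>{..<r}. \<omega> t \<in> Bd}}"
    by (intro measure_pmf.finite_measure_mono) auto
  also have "\<dots> \<le> (1 / 2) ^ r"
    unfolding columns_pmf_def Bd_def
    by (intro majority_of_blocks finite_set_sample_pmf N sample_block_fine v m h)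
  finally show ?thesis .
qed

section \<open>Selecting the largest rows\<close>

definition top_rows :: "nat \<Rightarrow> nat \<Rightarrow> (nat \<Rightarrow> real) \<Rightarrow> nat list" where
  "top_rows m N e = take m (sort_key (\<lambda>i. - e i) [1..<N + 1])"

lemma top_rows_subset: "set (top_rows m N e) \<subseteq> {1..N}"
  using set_take_subset[of m "sort_key (\<lambda>i. - e i) [1..<N + 1]"] by (auto simp: top_rows_def)

lemma length_top_rows: "length (top_rows m N e) \<le> m"
  by (simp add: top_rows_def)

lemma top_rows_unselected:
  assumes "i \<in> {1..N}" "i \<notin> set (top_rows m N e)"
  shows "card (set (top_rows m N e)) = m" "s \<in> set (top_rows m N e) \<Longrightarrow> e i \<le> e s"
proof -
  define xs where "xs = sort_key (\<lambda>i. - e i) [1..<N + 1]"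
  have xs: "set xs = {1..N}" "distinct xs" "sorted (map (\<lambda>i. - e i) xs)"
    by (auto simp: xs_def)
  have i: "i \<in> set (drop m xs)"
    using assms xs(1) append_take_drop_id[of m xs] by (metis Un_iff set_append top_rows_def xs_def)
  then have "m < length xs" by (metis drop_all empty_iff empty_set not_le)
  then show "card (set (top_rows m N e)) = m"
    using xs(2) distinct_card[of "take m xs"] unfolding top_rows_def xs_def[symmetric] by simp
  assume "s \<in> set (top_rows m N e)"
  then have s: "s \<in> set (take m xs)" by (simp only: top_rows_def xs_def)
  have "sorted (map (\<lambda>i. - e i) (take m xs @ drop m xs))" using xs(3) by simp
  then show "e i \<le> e s"
    using s i unfolding map_append sorted_append by fastforce
qed

text \<open>
  An unselected row that is not negligible has, up to the factor \<open>512 = 8 * 64\<close> lost in the estimates, a norm below those of \<open>m\<close>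
  selected rows, hence below their mean.  As the rows together have norm at most one, this forces its norm to be at most
  \<open>512 * (N / m) powr (1/p)\<close>, and interpolation turns this bound into the gain in \<open>L\<^sub>q\<close>.
\<close>

lemma unselected_norm:
  assumes N: "1 \<le> N" and m: "1 \<le> m" and p: "1 \<le> p" "p < q" and v: "1 \<le> v"
    and aw: "\<And>i. i \<in> {1..N} \<Longrightarrow> 0 \<le> A i \<and> A i \<le> W i" and W: "Lp_norm p N W \<le> 1"
    and up: "\<And>i. i \<in> {1..N} \<Longrightarrow> e i \<le> 64 * A i powr v"
    and lo: "\<And>i. i \<in> {1..N} \<Longrightarrow> \<eta> * W i < A i \<Longrightarrow> A i powr v / 8 \<le> e i"
    and \<eta>: "0 \<le> \<eta>"
  shows "Lp_norm q N (\<lambda>i. if i \<in> set (top_rows m N e) then 0 else A i)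
    \<le> \<eta> * N powr (recip p - recip q) + 512 * (N / m) powr (recip p - recip q)"
proof -
  define R where "R = set (top_rows m N e)"
  define L where "L = (\<lambda>i. if i \<in> R \<or> A i \<le> \<eta> * W i then 0 else A i)"
  have q: "1 \<le> q" using p by simp
  have W0: "0 \<le> W i" if "i \<in> {1..N}" for i using aw[OF that] by linarith
  have A1: "Lp_norm p N A \<le> 1"
    using Lp_norm_mono[OF N p(1), of A W] aw W W0 by fastforce
  have rp: "0 < recip p" using p by (cases p) (auto simp: one_ereal_def)
  have rq: "0 \<le> recip q" "recip q / recip p \<le> 1"
    using recip_bounds[OF q] recip_strict_mono[OF p] rp by auto
  have small: "L i \<le> 512 * (N / m) powr recip p" if i: "i \<in> {1..N}" for i
  proof (cases "i \<in> R \<or> A i \<le> \<eta> * W i")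
    case False
    have card: "card R = m" using top_rows_unselected(1)[OF i] False by (simp add: R_def)
    have RN: "R \<subseteq> {1..N}" "R \<noteq> {}" using top_rows_subset card m by (auto simp: R_def)
    have "A i / 512 \<le> A s" if s: "s \<in> R" for s
    proof -
      have s': "s \<in> {1..N}" using s RN by auto
      have "A i powr v / 8 \<le> e i" using lo[OF i] False by auto
      also have "\<dots> \<le> e s" using top_rows_unselected(2)[OF i, of m e s] False s by (simp add: R_def)
      also have "\<dots> \<le> 64 * A s powr v" by (rule up[OF s'])
      finally have "A i powr v \<le> 512 * A s powr v" by simp
      also have "\<dots> \<le> 512 powr v * A s powr v"
        using powr_mono[of 1 v "512::real"] v by (intro mult_right_mono) auto
      also have "\<dots> = (512 * A s) powr v" using aw[OF s'] by (simp add: powr_mult)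
      finally have "A i \<le> 512 * A s"
        using aw[OF i] aw[OF s'] v by (smt (verit) powr_less_mono2)
      then show ?thesis by simp
    qed
    then have "m * (A i / 512) \<le> (\<Sum>s\<in>R. A s)"
      using sum_bounded_below[of R "A i / 512" A] card by simp
    also have "\<dots> = (\<Sum>s\<in>R. norm (A s))" using RN aw by (intro sum.cong) auto
    finally have "A i / 512 \<le> (\<Sum>s\<in>R. norm (A s)) / card R"
      using card m by (simp add: field_simps)
    then have "(m / N) powr recip p * (A i / 512) \<le> (m / N) powr recip p * ((\<Sum>s\<in>R. norm (A s)) / card R)"
      by (intro mult_left_mono) auto
    also have "\<dots> \<le> 1" using Lp_norm_ge_block_mean[OF N p(1) RN, of A] A1 card by simp
    finally have "A i \<le> 512 * (1 / (m / N) powr recip p)" using m N by (simp add: field_simps)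
    also have "1 / (m / N) powr recip p = (N / m) powr recip p" using m N by (simp add: powr_divide)
    finally show ?thesis using False by (simp add: L_def)
  qed (simp add: L_def)
  have L0: "0 \<le> L i" "L i \<le> A i" if "i \<in> {1..N}" for i using aw[OF that] by (auto simp: L_def)
  have "Lp_norm p N L \<le> 1" using Lp_norm_mono[OF N p(1), of L A] L0 A1 by fastforce
  then have "Lp_norm q N L \<le> (512 * (N / m) powr recip p) powr (1 - recip q / recip p)"
    using small L0 N m p by (intro Lp_norm_interpolate) auto
  also have "\<dots> = 512 powr (1 - recip q / recip p) * (N / m) powr (recip p - recip q)"
    using rp by (simp add: powr_mult powr_powr right_diff_distrib)
  also have "\<dots> \<le> 512 * (N / m) powr (recip p - recip q)"
    using powr_mono[of "1 - recip q / recip p" 1 "512::real"] rq rp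
    by (intro mult_right_mono) auto
  finally have L: "Lp_norm q N L \<le> 512 * (N / m) powr (recip p - recip q)" .
  have "Lp_norm q N (\<lambda>i. if i \<in> R then 0 else A i) \<le> Lp_norm q N (\<lambda>i. \<eta> * W i) + Lp_norm q N L"
    using aw W0 \<eta> by (intro Lp_norm_triangle N q) (auto simp: L_def)
  also have "Lp_norm q N (\<lambda>i. \<eta> * W i) = \<eta> * Lp_norm q N W"
    using \<eta> Lp_norm_scale[OF N q, of "\<lambda>i. \<eta> * W i" \<eta> W] by (simp add: abs_mult)
  also have "\<dots> \<le> \<eta> * (N powr (recip p - recip q) * 1)"
    using order_trans[OF Lp_norm_embedding[OF N p, of W] mult_left_mono[OF W]] \<eta>
    by (intro mult_left_mono) auto
  finally show ?thesis using L by (simp add: R_def)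
qed

section \<open>A two-stage randomized algorithm\<close>

context mixed_embedding
begin

definition \<nu> :: real where "\<nu> = real_of_ereal v"

lemma \<nu>: "ereal \<nu> = v" "1 \<le> \<nu>" "recip v = 1 / \<nu>"
proof -
  obtain t where "v = ereal t" "1 \<le> t"
    using exps(4) uv by (cases rule: exponent_cases) auto
  moreover have "\<nu> = t" unfolding \<nu>_def using calculation by simp
  ultimately show "ereal \<nu> = v" "1 \<le> \<nu>" "recip v = 1 / \<nu>" by (simp_all only: recip_simps)
qed

definition row :: "levels \<Rightarrow> nat \<Rightarrow> nat \<Rightarrow> nat \<Rightarrow> real" where
  "row x k i = (\<lambda>j. norm (x k i j))"

lemma Lp_norm_row: "1 \<le> r \<Longrightarrow> Lp_norm r (2^k) (row x k i) = Lp_norm r (2^k) (x k i)"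
  by (intro Lp_norm_cong) (auto simp: row_def)

definition failure :: "nat \<Rightarrow> nat \<Rightarrow> levels \<Rightarrow> nat \<Rightarrow> (nat \<Rightarrow> nat \<Rightarrow> nat) set" where
  "failure r m x k = {\<omega>. \<exists>i\<in>{1..2^k}. \<not> block_fine (2^k) \<nu> u m (row x k i) (estimate r m \<nu> \<omega> (row x k i))}"

lemma prob_failure:
  assumes "1 \<le> m"
  shows "measure_pmf.prob (columns_pmf r m (2^k)) (failure r m x k) \<le> 2 ^ k * (1 / 2) ^ r"
proof -
  let ?B = "\<lambda>i. {\<omega>. \<not> block_fine (2^k) \<nu> u m (row x k i) (estimate r m \<nu> \<omega> (row x k i))}"
  have "failure r m x k = (\<Union>i\<in>{1..2^k}. ?B i)" by (auto simp: failure_def)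
  then have "measure_pmf.prob (columns_pmf r m (2^k)) (failure r m x k)
      \<le> (\<Sum>i\<in>{1..2^k}. measure_pmf.prob (columns_pmf r m (2^k)) (?B i))"
    by (simp only:) (intro measure_pmf.finite_measure_subadditive_finite, auto)
  also have "\<dots> \<le> (\<Sum>i\<in>{1..(2::nat)^k}. (1 / 2) ^ r)"
    using assms uv by (intro sum_mono estimate_fine) (auto simp: row_def \<nu>(1,2))
  finally show ?thesis by simp
qed

lemma unselected_target_norm:
  assumes x: "x \<in> Fset P" and m: "1 \<le> m" and \<omega>: "\<omega> \<notin> failure r m x k"
    and e: "\<And>i. i \<in> {1..2^k} \<Longrightarrow> e i = estimate r m \<nu> \<omega> (row x k i)"
  shows "Lp_norm q (2^k) (\<lambda>i. if i \<in> set (top_rows m (2^k) e) then 0 else Lp_norm v (2^k) (x k i))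
    \<le> 64 * m powr (- b) * 2 powr (a * real k) + 512 * (2^k / m) powr a"
proof -
  have N: "1 \<le> (2::nat)^k" by simp
  have fine: "block_fine (2^k) \<nu> u m (row x k i) (e i)" if "i \<in> {1..2^k}" for i
    using \<omega> that by (auto simp: failure_def e)
  have vu: "v \<le> u" using uv by simp
  have W1: "Lp_norm p (2^k) (\<lambda>i. Lp_norm u (2^k) (x k i)) \<le> 1"
    using source_norm_le_1[OF x, of k] by (simp add: mixed_norm_def)
  have b: "recip u - 1 / \<nu> = - b" by (simp add: b_def \<nu>(3))
  have "Lp_norm q (2^k) (\<lambda>i. if i \<in> set (top_rows m (2^k) e) then 0 else Lp_norm v (2^k) (x k i))
    \<le> (64 * m powr (- b)) * real (2^k) powr (recip p - recip q) + 512 * (real (2^k) / m) powr (recip p - recip q)"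
  proof (rule unselected_norm[OF N m exps(1) pq \<nu>(2) _ W1])
    fix i assume i: "i \<in> {1..(2::nat)^k}"
    show "0 \<le> Lp_norm v (2^k) (x k i) \<and> Lp_norm v (2^k) (x k i) \<le> Lp_norm u (2^k) (x k i)"
      using exps vu by (auto intro!: Lp_norm_nonneg Lp_norm_exponent_mono)
    have v: "Lp_norm (ereal \<nu>) (2^k) (row x k i) = Lp_norm v (2^k) (x k i)"
      and u: "Lp_norm u (2^k) (row x k i) = Lp_norm u (2^k) (x k i)"
      using exps by (simp_all add: \<nu>(1) Lp_norm_row)
    show "e i \<le> 64 * Lp_norm v (2^k) (x k i) powr \<nu>"
      using fine[OF i] by (simp add: block_fine_def v)
    show "64 * m powr (- b) * Lp_norm u (2^k) (x k i) < Lp_norm v (2^k) (x k i) \<Longrightarrow>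
        Lp_norm v (2^k) (x k i) powr \<nu> / 8 \<le> e i"
      using fine[OF i] by (simp add: block_fine_def v u b)
  qed simp
  then show ?thesis by (simp add: a_def powr_powr mult.commute flip: powr_realpow)
qed

text \<open>
  The first stage: all entries of the levels up to \<open>k0\<close>, and the sampled columns of all rows of the levels up to \<open>k1\<close>.  Columns
  outside of the grid have probability zero; filtering them makes the queries legal for every outcome.
\<close>

definition sampled :: "nat \<Rightarrow> nat \<Rightarrow> nat \<Rightarrow> (nat \<Rightarrow> nat) \<Rightarrow> (nat \<Rightarrow> nat \<Rightarrow> nat \<Rightarrow> nat) \<Rightarrow> (nat \<times> nat \<times> nat) list" where
  "sampled k0 k1 r m \<omega> = filter (\<lambda>c. c \<in> entries) (level_entries k0 @
     concat (map (\<lambda>k. map (\<lambda>(i, t, s). (k, i, \<omega> k t s)) (List.product [1..<2^k + 1] (List.product [0..<r] [0..<m k])))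
       [Suc k0..<Suc k1]))"

definition restored :: "(nat \<times> nat \<times> nat) list \<Rightarrow> complex list \<Rightarrow> levels" where
  "restored Q z = (\<lambda>k i j. case map_of (zip Q z) (k, i, j) of None \<Rightarrow> 0 | Some y \<Rightarrow> y)"

definition selected_rows :: "nat \<Rightarrow> (nat \<Rightarrow> nat) \<Rightarrow> (nat \<Rightarrow> nat \<Rightarrow> nat \<Rightarrow> nat) \<Rightarrow> levels \<Rightarrow> nat \<Rightarrow> nat list" where
  "selected_rows r m \<omega> y k = top_rows (m k) (2^k) (\<lambda>i. estimate r (m k) \<nu> (\<omega> k) (row y k i))"

definition selected :: "nat \<Rightarrow> nat \<Rightarrow> nat \<Rightarrow> (nat \<Rightarrow> nat) \<Rightarrow> (nat \<Rightarrow> nat \<Rightarrow> nat \<Rightarrow> nat) \<Rightarrow> complex list \<Rightarrow> (nat \<times> nat \<times> nat) list" where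
  "selected k0 k1 r m \<omega> z = concat (map (\<lambda>k. map (Pair k)
     (List.product (selected_rows r m \<omega> (restored (sampled k0 k1 r m \<omega>) z) k) [1..<2^k + 1])) [Suc k0..<Suc k1])"

lemma set_sampled: "set (sampled k0 k1 r m \<omega>) = entries \<inter> (set (level_entries k0) \<union>
    (\<Union>k\<in>{k0<..k1}. (\<lambda>(i, t, s). (k, i, \<omega> k t s)) ` ({1..2^k} \<times> {0..<r} \<times> {0..<m k})))"
  unfolding sampled_def set_filter
  by (simp add: Int_def conj_commute atLeastLessThanSuc_atLeastAtMost atLeastSucAtMost_greaterThanAtMost del: upt_Suc)

lemma length_sampled: "length (sampled k0 k1 r m \<omega>) \<le> 2 * 4 ^ k0 + (\<Sum>k\<in>{k0<..k1}. 2 ^ k * (r * m k))"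
proof -
  have "length (sampled k0 k1 r m \<omega>) \<le> length (level_entries k0) + (\<Sum>k\<leftarrow>[Suc k0..<Suc k1]. 2 ^ k * (r * m k))"
    unfolding sampled_def by (rule order_trans[OF length_filter_le]) (simp add: length_concat comp_def del: upt_Suc)
  also have "(\<Sum>k\<leftarrow>[Suc k0..<Suc k1]. 2 ^ k * (r * m k)) = (\<Sum>k\<in>{k0<..k1}. 2 ^ k * (r * m k))"
    by (subst sum_set_upt_conv_sum_list_nat[symmetric]) (auto intro!: sum.cong)
  finally show ?thesis using length_level_entries[of k0] by simp
qed

lemma length_selected: "length (selected k0 k1 r m \<omega> z) \<le> (\<Sum>k\<in>{k0<..k1}. 2 ^ k * m k)"
proof -
  have "length (selected k0 k1 r m \<omega> z) \<le> (\<Sum>k\<leftarrow>[Suc k0..<Suc k1]. m k * 2 ^ k)"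
    unfolding selected_def length_concat map_map comp_def
    by (intro sum_list_mono) (simp add: selected_rows_def length_top_rows)
  also have "\<dots> = (\<Sum>k\<in>{k0<..k1}. 2 ^ k * m k)"
    by (subst sum_set_upt_conv_sum_list_nat[symmetric]) (auto intro!: sum.cong)
  finally show ?thesis .
qed

lemma set_selected: "set (selected k0 k1 r m \<omega> z) = (\<Union>k\<in>{k0<..k1}. 
    Pair k ` (set (selected_rows r m \<omega> (restored (sampled k0 k1 r m \<omega>) z) k) \<times> {1..2^k}))"
  by (simp add: selected_def atLeastLessThanSuc_atLeastAtMost atLeastSucAtMost_greaterThanAtMost del: upt_Suc)

lemma selected_entries: "set (selected k0 k1 r m \<omega> z) \<subseteq> entries"
proof
  fix c assume "c \<in> set (selected k0 k1 r m \<omega> z)"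
  then obtain k i j where c: "c = (k, i, j)" "j \<in> {1..2^k}"
    and "i \<in> set (selected_rows r m \<omega> (restored (sampled k0 k1 r m \<omega>) z) k)"
    unfolding set_selected by blast
  then have "i \<in> {1..2^k}" using top_rows_subset unfolding selected_rows_def by blast
  then show "c \<in> entries" using c by (simp add: entries_def)
qed

definition choice_pmf :: "nat \<Rightarrow> nat \<Rightarrow> nat \<Rightarrow> (nat \<Rightarrow> nat) \<Rightarrow> (nat \<Rightarrow> nat \<Rightarrow> nat \<Rightarrow> nat) pmf" where
  "choice_pmf k0 k1 r m = Pi_pmf {k0<..k1} (\<lambda>_ _. 0) (\<lambda>k. columns_pmf r (m k) (2^k))"

lemma finite_set_choice_pmf: "finite (set_pmf (choice_pmf k0 k1 r m))"
  unfolding choice_pmf_def columns_pmf_def by (intro finite_set_Pi_pmf finite_set_sample_pmf) auto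

lemma set_choice_pmf:
  assumes "\<omega> \<in> set_pmf (choice_pmf k0 k1 r m)" "k \<in> {k0<..k1}" "t < r" "s < m k"
  shows "\<omega> k t s \<in> {1..2^k}"
proof -
  have "\<omega> k t \<in> set_pmf (sample_pmf (m k) (2^k))"
    using assms by (auto simp: choice_pmf_def columns_pmf_def set_Pi_pmf PiE_dflt_def)
  then show ?thesis using assms by (intro set_sample_pmf) auto
qed

text \<open>The first stage has seen every entry on which the estimates depend.\<close>

lemma estimate_restored:
  assumes "\<omega> \<in> set_pmf (choice_pmf k0 k1 r m)" "k \<in> {k0<..k1}" "i \<in> {1..2^k}"
  defines "Q \<equiv> sampled k0 k1 r m \<omega>"
  shows "estimate r (m k) \<nu> (\<omega> k) (row (restored Q (map (entry x) Q)) k i) = estimate r (m k) \<nu> (\<omega> k) (row x k i)"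
proof -
  have "row (restored Q (map (entry x) Q)) k i (\<omega> k t s) = row x k i (\<omega> k t s)" if "t < r" "s < m k" for t s
  proof -
    have "(k, i, \<omega> k t s) \<in> set Q"
    proof -
      have "(k, i, \<omega> k t s) \<in> entries"
        using set_choice_pmf[OF assms(1,2) that] assms(3) by (simp add: entries_def)
      then show ?thesis unfolding Q_def set_sampled
        using assms(2,3) that by (intro IntI UnI2 UN_I[of k] image_eqI[of _ _ "(i, t, s)"]) auto
    qed
    then show ?thesis by (simp add: row_def restored_def map_of_zip_map entry_def)
  qed
  then have eq: "(\<Sum>s<m k. row (restored Q (map (entry x) Q)) k i (\<omega> k t s) powr \<nu>) / m k
      = (\<Sum>s<m k. row x k i (\<omega> k t s) powr \<nu>) / m k" if "t < r" for t
    using that by simp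
  have cong: "median r E = median r E'" if "\<And>t. t < r \<Longrightarrow> E t = E' t" for E E' :: "nat \<Rightarrow> real"
  proof -
    have "E ` {..<r} = E' ` {..<r}" "{t\<in>{..<r}. y \<le> E t} = {t\<in>{..<r}. y \<le> E' t}" for y
      using that by auto
    then show ?thesis unfolding median_def by simp
  qed
  show ?thesis unfolding estimate_def by (rule cong[OF eq])
qed

text \<open>
  The three summands account for negligible rows, for rows dominated by the selected ones, and for a failure of the
  estimates, in which case the norm of the identity is the only available bound.
\<close>

definition level_bound :: "nat \<Rightarrow> nat \<Rightarrow> nat \<Rightarrow> real" where
  "level_bound r m k = 2 powr (- \<alpha> * real k) * (64 * m powr (- b) * 2 powr (a * real k)
     + 512 * (2^k / m) powr a + 2 powr (a * real k) * (2 ^ k * (1 / 2) ^ r))"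

text \<open>
  On every outcome the error is bounded by a sum over the levels, so its expectation splits into the failure probabilities
  of the single levels.
\<close>

lemma ran_upper:
  assumes m: "\<And>k. 1 \<le> m k"
    and n: "2 * 4 ^ k0 + (\<Sum>k\<in>{k0<..k1}. 2 ^ k * ((r + 1) * m k)) \<le> n"
  shows "e_ran P n \<le> ennreal ((\<Sum>k\<in>{k0<..k1}. level_bound r (m k) k)
      + 2 powr ((a - \<alpha>) * real k1) * (\<Sum>l. 2 powr ((a - \<alpha>) * real l)))"
proof -
  define Q where "Q = sampled k0 k1 r m"
  define sel where "sel = selected k0 k1 r m"
  define A where "A \<omega> = fill_algorithm (two_stage (Q \<omega>) (sel \<omega>)) n" for \<omega>
  define \<mu> where "\<mu> = choice_pmf k0 k1 r m"
  define C where "C k = 2 powr (- \<alpha> * real k) * (64 * m k powr (- b) * 2 powr (a * real k) + 512 * (2^k / m k) powr a)" for k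
  define D where "D k = 2 powr (- \<alpha> * real k) * 2 powr (a * real k)" for k
  define tail where "tail = 2 powr ((a - \<alpha>) * real k1) * (\<Sum>l. 2 powr ((a - \<alpha>) * real l))"
  define F where "F x \<omega> = (\<Sum>k\<in>{k0<..k1}. C k + D k * indicator {\<omega>. \<omega> k \<in> failure r (m k) x k} \<omega>) + tail" for x \<omega>
  have Qe: "set (Q \<omega>) \<subseteq> entries" for \<omega> by (auto simp: Q_def sampled_def)
  have len: "length (Q \<omega>) + length (sel \<omega> z) \<le> n" for \<omega> z
  proof -
    have "length (Q \<omega>) + length (sel \<omega> z)
        \<le> 2 * 4 ^ k0 + ((\<Sum>k\<in>{k0<..k1}. 2 ^ k * (r * m k)) + (\<Sum>k\<in>{k0<..k1}. 2 ^ k * m k))"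
      using length_sampled[of k0 k1 r m \<omega>] length_selected[of k0 k1 r m \<omega> z] by (simp add: Q_def sel_def)
    also have "\<dots> = 2 * 4 ^ k0 + (\<Sum>k\<in>{k0<..k1}. 2 ^ k * ((r + 1) * m k))"
      by (simp add: sum.distrib[symmetric] algebra_simps)
    finally show ?thesis using n by simp
  qed
  have A: "det_algorithm P (A \<omega>)" for \<omega>
    unfolding A_def by (intro fill_det_algorithm two_stage_entries Qe) (simp add: sel_def selected_entries)
  have s: "summable (\<lambda>l. 2 powr ((a - \<alpha>) * real l))" using ab \<alpha>2 by (intro summable_decay) auto
  have neg: "a - \<alpha> < 0" using ab \<alpha>2 by simp
  have error: "dev (A \<omega>) x \<le> F x \<omega>" if x: "x \<in> Fset P" and \<omega>: "\<omega> \<in> set_pmf \<mu>" for x \<omega>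
  proof -
    define V where "V = visited (two_stage (Q \<omega>) (sel \<omega>)) n x"
    define y where "y = outside V x"
    have y: "y \<in> Fset P" using x by (simp add: y_def outside_in_ball)
    have V: "set (Q \<omega>) \<union> set (sel \<omega> (map (entry x) (Q \<omega>))) \<subseteq> V"
      unfolding V_def by (rule visited_two_stage[OF len])
    have low: "y l = (\<lambda>_ _. 0)" if "l \<le> k0" for l
      unfolding y_def
      by (rule outside_level[OF x], rule subset_trans[OF _ V])
        (use that in \<open>auto simp: Q_def set_sampled set_level_entries entries_def\<close>)
    have D: "D l = 2 powr ((a - \<alpha>) * real l)" for l
      by (simp add: D_def powr_add[symmetric] left_diff_distrib)
    have trivial: "2 powr (- \<alpha> * real l) * target_norm l (y l) \<le> D l" for l
      using weighted_target_norm_le[OF y] by (simp add: D)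
    have middle: "2 powr (- \<alpha> * real k) * target_norm k (y k) \<le> C k" 
      if k: "k \<in> {k0<..k1}" and good: "\<omega> k \<notin> failure r (m k) x k" for k
    proof -
      define e where "e i = estimate r (m k) \<nu> (\<omega> k) (row (restored (Q \<omega>) (map (entry x) (Q \<omega>))) k i)" for i
      have e: "e i = estimate r (m k) \<nu> (\<omega> k) (row x k i)" if "i \<in> {1..2^k}" for i
        using estimate_restored[OF \<omega>[unfolded \<mu>_def] k that] by (simp add: e_def Q_def)
      have "target_norm k (y k) \<le> Lp_norm q (2^k) (\<lambda>i. if i \<in> set (top_rows (m k) (2^k) e) then 0 else Lp_norm v (2^k) (x k i))"
        unfolding mixed_norm_def
      proof (intro Lp_norm_mono)
        fix i assume i: "i \<in> {1..(2::nat)^k}"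
        show "norm (Lp_norm v (2^k) (y k i)) \<le> norm (if i \<in> set (top_rows (m k) (2^k) e) then 0 else Lp_norm v (2^k) (x k i))"
        proof (cases "i \<in> set (top_rows (m k) (2^k) e)")
          case True
          have "y k i j = 0" if "j \<in> {1..2^k}" for j
          proof -
            have "(k, i, j) \<in> set (sel \<omega> (map (entry x) (Q \<omega>)))"
              unfolding sel_def set_selected selected_rows_def using True that k
              by (intro UN_I[of k] image_eqI[of _ _ "(i, j)"]) (auto simp: e_def[abs_def] Q_def)
            then show ?thesis using V by (auto simp: y_def outside_def)
          qed
          then have "Lp_norm v (2^k) (y k i) = \<bar>0\<bar> * Lp_norm v (2^k) (y k i)"
            using exps by (intro Lp_norm_scale) auto
          then show ?thesis by simp
        next
          case False
          have "Lp_norm v (2^k) (y k i) \<le> Lp_norm v (2^k) (x k i)"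
            using exps by (intro Lp_norm_mono) (auto simp: y_def outside_def)
          then show ?thesis using False exps by (simp add: Lp_norm_nonneg)
        qed
      qed (use exps in auto)
      also have "\<dots> \<le> 64 * m k powr (- b) * 2 powr (a * real k) + 512 * (2^k / m k) powr a"
        by (rule unselected_target_norm[OF x m good e])
      finally show ?thesis unfolding C_def by (intro mult_left_mono) auto
    qed
    define c where "c l = (if l \<in> {k0<..k1} then C l + D l * indicator {\<omega>. \<omega> l \<in> failure r (m l) x l} \<omega> else 0)" for l
    define t where "t l = (if l < k1 then 0 else 2 powr ((a - \<alpha>) * real l))" for l
    have C0: "0 \<le> C l" "0 \<le> D l" for l by (auto simp: C_def D_def)
    have sc: "summable c" by (rule summable_finite[of "{k0<..k1}"]) (auto simp: c_def)
    have st: "summable t" unfolding t_def by (rule tail_decay(1)[OF neg])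
    have "Gnorm P (Sol P y) \<le> (\<Sum>l. c l + t l)"
    proof (rule embedding_error_le[OF y summable_add[OF sc st]])
      fix l
      have "0 \<le> t l" by (simp add: t_def)
      consider "l \<le> k0" | "l \<in> {k0<..k1}" "\<omega> l \<notin> failure r (m l) x l" | "l \<in> {k0<..k1}" "\<omega> l \<in> failure r (m l) x l"
        | "k0 < l" "k1 < l" by force
      then show "2 powr (- \<alpha> * real l) * target_norm l (y l) \<le> c l + t l"
      proof cases
        case 1
        then show ?thesis using low[of l] \<open>0 \<le> t l\<close> C0[of l] by (simp add: c_def)
      next
        case 2
        then show ?thesis using middle[of l] \<open>0 \<le> t l\<close> by (simp add: c_def)
      next
        case 3
        then show ?thesis using trivial[of l] \<open>0 \<le> t l\<close> C0[of l] by (simp add: c_def)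
      next
        case 4
        then show ?thesis using trivial[of l] by (simp add: c_def t_def D)
      qed
    qed
    also have "\<dots> = (\<Sum>l. c l) + (\<Sum>l. t l)" by (rule suminf_add[OF sc st, symmetric])
    also have "(\<Sum>l. c l) = (\<Sum>k\<in>{k0<..k1}. C k + D k * indicator {\<omega>. \<omega> k \<in> failure r (m k) x k} \<omega>)"
      by (subst suminf_finite[of "{k0<..k1}"]) (auto simp: c_def)
    also have "(\<Sum>l. t l) = tail" unfolding t_def tail_def by (rule tail_decay(2)[OF neg])
    finally show ?thesis by (simp add: F_def A_def fill_error y_def V_def)
  qed
  have expect: "(\<integral>\<^sup>+\<omega>. ennreal (F x \<omega>) \<partial>measure_pmf \<mu>) \<le> ennreal ((\<Sum>k\<in>{k0<..k1}. level_bound r (m k) k) + tail)" for x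
  proof -
    have int: "integrable (measure_pmf \<mu>) f" for f :: "_ \<Rightarrow> real"
      unfolding \<mu>_def by (intro integrable_measure_pmf_finite finite_set_choice_pmf)
    have tail0: "0 \<le> tail" unfolding tail_def by (intro mult_nonneg_nonneg suminf_nonneg s) auto
    have "(\<integral>\<^sup>+\<omega>. ennreal (F x \<omega>) \<partial>measure_pmf \<mu>) = ennreal (measure_pmf.expectation \<mu> (F x))"
      using tail0 by (intro nn_integral_eq_integral int AE_I2)
        (auto simp: F_def C_def D_def intro!: add_nonneg_nonneg sum_nonneg)
    also have "measure_pmf.expectation \<mu> (F x) = (\<Sum>k\<in>{k0<..k1}. C k + D k * measure_pmf.prob \<mu> {\<omega>. \<omega> k \<in> failure r (m k) x k}) + tail"
      unfolding F_def by (simp add: int Bochner_Integration.integral_sum)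
    also have "\<dots> \<le> (\<Sum>k\<in>{k0<..k1}. level_bound r (m k) k) + tail"
    proof (intro add_right_mono sum_mono)
      fix k assume k: "k \<in> {k0<..k1}"
      have "measure_pmf.prob \<mu> {\<omega>. \<omega> k \<in> failure r (m k) x k}
          = measure_pmf.prob (map_pmf (\<lambda>\<omega>. \<omega> k) \<mu>) (failure r (m k) x k)"
        by (simp add: vimage_def)
      also have "map_pmf (\<lambda>\<omega>. \<omega> k) \<mu> = columns_pmf r (m k) (2^k)"
        unfolding \<mu>_def choice_pmf_def using k by (subst Pi_pmf_component) auto
      also have "measure_pmf.prob \<dots> (failure r (m k) x k) \<le> 2 ^ k * (1 / 2) ^ r"
        by (rule prob_failure[OF m])
      finally have "D k * measure_pmf.prob \<mu> {\<omega>. \<omega> k \<in> failure r (m k) x k} \<le> D k * (2 ^ k * (1 / 2) ^ r)"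
        by (intro mult_left_mono) (auto simp: D_def)
      then show "C k + D k * measure_pmf.prob \<mu> {\<omega>. \<omega> k \<in> failure r (m k) x k} \<le> level_bound r (m k) k"
        by (simp add: C_def D_def level_bound_def distrib_left mult.assoc)
    qed
    finally show ?thesis by (simp add: ennreal_leI)
  qed
  have "e_ran P n \<le> ran_error P (measure_pmf \<mu>) A"
  proof (rule e_ran_le[OF ran_algorithm_pmf[OF A]])
    show "ran_cost P (measure_pmf \<mu>) A \<le> of_nat n"
      by (simp add: ran_cost_def A_def fill_cost SUP_least measure_pmf.emeasure_space_1)
  qed
  also have "\<dots> \<le> ennreal ((\<Sum>k\<in>{k0<..k1}. level_bound r (m k) k) + tail)"
    unfolding ran_error_def
  proof (intro SUP_least)
    fix x assume x: "x \<in> Fset P"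
    have "(\<integral>\<^sup>+\<omega>. ennreal (dev (A \<omega>) x) \<partial>measure_pmf \<mu>)
        \<le> (\<integral>\<^sup>+\<omega>. ennreal (F x \<omega>) \<partial>measure_pmf \<mu>)"
      using error[OF x] by (intro nn_integral_mono_AE) (auto simp: AE_measure_pmf_iff intro: ennreal_leI)
    also note expect
    finally show "(\<integral>\<^sup>+\<omega>. ennreal (dev (A \<omega>) x) \<partial>measure_pmf \<mu>)
        \<le> ennreal ((\<Sum>k\<in>{k0<..k1}. level_bound r (m k) k) + tail)" .
  qed
  finally show ?thesis by (simp add: tail_def)
qed

end

section \<open>Rates\<close>

lemma powr_level: "2 powr (s * real k) = (4 ^ k) powr (s / 2)"
proof -
  have "(4::real) ^ k = 2 powr (2 * real k)" by (simp add: powr_realpow[symmetric] flip: powr_powr)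
  then show ?thesis by (simp add: powr_powr mult.commute)
qed

lemma ex_level:
  fixes C n :: nat
  assumes "1 \<le> C" "C \<le> n"
  obtains k where "C * 4 ^ k \<le> n" "n < C * 4 ^ (k + 1)"
proof -
  have "C * 4 ^ 0 \<le> n" using assms by simp
  moreover have "k \<le> n" if "C * 4 ^ k \<le> n" for k
  proof -
    have "k < 4 ^ k" by (rule less_exp[THEN less_le_trans]) (simp add: power_mono)
    also have "\<dots> \<le> C * 4 ^ k" using assms by simp
    finally show ?thesis using that by simp
  qed
  ultimately obtain k where k: "C * 4 ^ k \<le> n" "\<And>l. C * 4 ^ l \<le> n \<Longrightarrow> l \<le> k"
    using Nat.ex_has_greatest_nat[of "\<lambda>k. C * 4 ^ k \<le> n" 0 n] by auto
  then have "n < C * 4 ^ (k + 1)" by (metis not_le not_less_eq_eq order_refl Suc_eq_plus1)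
  with k that show thesis by blast
qed

text \<open>
  A level with \<open>2 n \<le> 4 ^ k \<le> 8 n\<close> is large enough for \<open>n\<close> queries to miss half of it, and small enough to
  give the right order.
\<close>

lemma lower_rate:
  assumes n: "1 \<le> n" and s: "0 \<le> s" and E: "\<And>k. ennreal (2 powr (- s * real k) * (1 - real n / 4 ^ k)) \<le> E"
  shows "ennreal (8 powr (- s / 2) / 2 * real n powr (- s / 2)) \<le> E"
proof -
  obtain k where k: "1 * 4 ^ k \<le> n" "n < 1 * 4 ^ (k + 1)" using ex_level[of 1 n] n by auto
  have k1: "real n / 4 ^ (k + 2) \<le> 1 / 2"
  proof -
    have "real n < 4 ^ (k + 1)" using k(2) by (metis mult_1 of_nat_less_iff of_nat_numeral of_nat_power)
    then show ?thesis by (simp add: divide_le_eq)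
  qed
  have k2: "(4::real) ^ (k + 1) \<le> 8 * n"
  proof -
    have "(4::real) ^ k \<le> real n" using k(1) by (metis mult_1 of_nat_le_iff of_nat_numeral of_nat_power)
    then show ?thesis by (simp only: power_add power_one_right)
  qed
  show ?thesis
  proof (cases "2 * real n \<le> 4 ^ (k + 1)")
    case True
    have "8 powr (- s / 2) / 2 * real n powr (- s / 2) = (8 * n) powr (- s / 2) * (1 / 2)"
      by (simp add: powr_mult)
    also have "\<dots> \<le> (4 ^ (k + 1)) powr (- s / 2) * (1 - real n / 4 ^ (k + 1))"
      using k2 s True by (intro mult_mono powr_mono2') (auto simp: field_simps)
    also have "\<dots> = 2 powr (- s * real (k + 1)) * (1 - real n / 4 ^ (k + 1))" by (simp only: powr_level)
    finally show ?thesis by (rule order_trans[OF ennreal_leI E])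
  next
    case False
    have "8 powr (- s / 2) / 2 * real n powr (- s / 2) = (8 * n) powr (- s / 2) * (1 / 2)"
      by (simp add: powr_mult)
    also have "\<dots> \<le> (4 ^ (k + 2)) powr (- s / 2) * (1 - real n / 4 ^ (k + 2))"
      using k1 s False by (intro mult_mono powr_mono2') auto
    also have "\<dots> = 2 powr (- s * real (k + 2)) * (1 - real n / 4 ^ (k + 2))" by (simp only: powr_level)
    finally show ?thesis by (rule order_trans[OF ennreal_leI E])
  qed
qed

lemma upper_rate:
  assumes "1 \<le> C" "n < C * 4 ^ (k + 1)" "0 \<le> s" "1 \<le> n"
  shows "2 powr (- s * real k) \<le> (4 * real C) powr (s / 2) * real n powr (- s / 2)"
proof -
  have "real n \<le> real (C * 4 ^ (k + 1))" using assms(2) by linarith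
  then have "real n / (4 * real C) \<le> 4 ^ k" using assms by (simp add: divide_le_eq mult_ac)
  then have "(4 ^ k) powr (- s / 2) \<le> (real n / (4 * real C)) powr (- s / 2)"
    using assms by (intro powr_mono2') auto
  also have "\<dots> = (4 * real C) powr (s / 2) * real n powr (- s / 2)"
  proof -
    have "(4 * real C) powr (- s / 2) = inverse ((4 * real C) powr (s / 2))"
      using powr_minus[of "4 * real C" "s / 2"] by simp
    moreover have "(real n / (4 * real C)) powr (- s / 2) = real n powr (- s / 2) / (4 * real C) powr (- s / 2)"
      by (rule powr_divide)
    ultimately show ?thesis by (simp only: divide_inverse inverse_inverse_eq mult.commute)
  qed
  finally show ?thesis by (simp only: powr_level)
qed

lemma sum_decay_le:
  assumes "0 < \<epsilon>"
  shows "(\<Sum>k\<in>{k0<..k1}. 2 powr (- \<epsilon> * real (k - k0))) \<le> (\<Sum>l. 2 powr (- \<epsilon> * real l))"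
proof -
  have s: "summable (\<lambda>l. 2 powr (- \<epsilon> * real l))" using assms by (intro summable_decay) simp
  have "(\<Sum>k\<in>{k0<..k1}. 2 powr (- \<epsilon> * real (k - k0))) = (\<Sum>l\<in>(\<lambda>k. k - k0) ` {k0<..k1}. 2 powr (- \<epsilon> * real l))"
    by (subst sum.reindex) (auto simp: inj_on_def)
  also have "\<dots> \<le> (\<Sum>l. 2 powr (- \<epsilon> * real l))"
    by (intro sum_le_suminf s) auto
  finally show ?thesis .
qed

context mixed_embedding
begin

lemma e_det_non_rate:
  "\<exists>c>0. \<forall>n\<ge>2. e_det_non P n \<le> ennreal (c * real n powr ((a - \<alpha>) / 2))"
proof -
  define S where "S = (\<Sum>l. 2 powr ((a - \<alpha>) * real l))"
  have S: "0 < S"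
    unfolding S_def using ab \<alpha>2 by (intro suminf_pos summable_decay) auto
  have "e_det_non P n \<le> ennreal (8 powr ((\<alpha> - a) / 2) * S * real n powr ((a - \<alpha>) / 2))" if n: "n \<ge> 2" for n
  proof -
    obtain k where k: "2 * 4 ^ k \<le> n" "n < 2 * 4 ^ (k + 1)" using ex_level[of 2 n] n by auto
    have "e_det_non P n \<le> ennreal (2 powr ((a - \<alpha>) * real k) * S)"
      unfolding S_def by (rule e_det_non_upper[OF k(1)])
    also have "\<dots> \<le> ennreal (8 powr ((\<alpha> - a) / 2) * S * real n powr ((a - \<alpha>) / 2))"
      using upper_rate[of 2 n k "\<alpha> - a"] k n ab \<alpha>2 S
      by (intro ennreal_leI) (simp add: mult_right_mono mult.commute mult.left_commute)
    finally show ?thesis .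
  qed
  then show ?thesis using S by (intro exI[of _ "8 powr ((\<alpha> - a) / 2) * S"]) auto
qed

text \<open>
  The sample size decreases by the factor \<open>2 powr (-(1 + decay))\<close> from level to level, fast enough for the cost
  \<open>2 ^ k * effort\<close> to be summable and, as \<open>\<alpha> > 2\<close>, slowly enough for the errors to be summable.  Levels above
  about \<open>(1 + cutoff) * k0\<close> are ignored: \<open>cutoff\<close> is chosen such that the trivial bound \<open>2 powr ((a - \<alpha>) * k)\<close> reaches
  \<open>2 powr ((a - b - \<alpha>) * k0)\<close> there.
\<close>

definition decay :: real where "decay = (\<alpha> - 2) / 2"

definition cutoff :: real where "cutoff = b / (\<alpha> - a)"

definition top_level :: "nat \<Rightarrow> nat" where "top_level k0 = k0 + nat \<lceil>cutoff * real k0\<rceil>"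

definition effort :: "nat \<Rightarrow> nat \<Rightarrow> real" where
  "effort k0 k = 2 powr (real k0 - (1 + decay) * real (k - k0)) / real (k0 + 1)"

definition block_size :: "nat \<Rightarrow> nat \<Rightarrow> nat" where "block_size k0 k = nat \<lceil>effort k0 k\<rceil>"

lemma decay: "0 < decay" "a * (2 + decay) < \<alpha>" "a + b * (1 + decay) < \<alpha>"
proof -
  show d: "0 < decay" using \<alpha>2 by (simp add: decay_def)
  have \<alpha>: "2 + decay < \<alpha>" using \<alpha>2 by (simp add: decay_def field_simps)
  have "a * (2 + decay) \<le> 2 + decay" using mult_right_mono[of a 1 "2 + decay"] ab d by simp
  also note \<alpha>
  finally show "a * (2 + decay) < \<alpha>" .
  have "a + b * (1 + decay) \<le> 1 + (1 + decay)"
    using mult_right_mono[of b 1 "1 + decay"] ab d by (intro add_mono) auto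
  also have "\<dots> < \<alpha>" using \<alpha> by simp
  finally show "a + b * (1 + decay) < \<alpha>" .
qed

lemma cutoff: "0 < cutoff" "cutoff < 1"
proof -
  have "b < \<alpha> - a" using ab \<alpha>2 by linarith
  then show "0 < cutoff" "cutoff < 1" using ab by (simp_all add: cutoff_def)
qed

lemma top_level:
  "(1 + cutoff) * real k0 \<le> real (top_level k0)" "real (top_level k0) \<le> (1 + cutoff) * real k0 + 1"
proof -
  have "0 \<le> cutoff * real k0" using cutoff by simp
  then have "real (top_level k0) = real k0 + of_int \<lceil>cutoff * real k0\<rceil>"
    by (simp add: top_level_def)
  then show "(1 + cutoff) * real k0 \<le> real (top_level k0)" "real (top_level k0) \<le> (1 + cutoff) * real k0 + 1"
    by (auto simp: distrib_right)
qed

lemma effort_pos: "0 < effort k0 k" by (simp add: effort_def)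

lemma block_size: "1 \<le> block_size k0 k" "effort k0 k \<le> real (block_size k0 k)" "real (block_size k0 k) \<le> effort k0 k + 1"
proof -
  have "1 \<le> \<lceil>effort k0 k\<rceil>" using effort_pos[of k0 k] by (simp add: one_le_ceiling)
  then have "real (block_size k0 k) = of_int \<lceil>effort k0 k\<rceil>" "1 \<le> block_size k0 k"
    unfolding block_size_def by linarith+
  then show "1 \<le> block_size k0 k" "effort k0 k \<le> real (block_size k0 k)" "real (block_size k0 k) \<le> effort k0 k + 1"
    by linarith+
qed

lemma linear_le_exponential:
  assumes "0 < \<epsilon>" obtains c where "0 < c" "\<And>k. real (k + 1) \<le> c * 2 powr (\<epsilon> * real k)"
proof -
  define c where "c = 1 + 1 / (\<epsilon> * ln 2)"
  have c: "1 \<le> c" "1 \<le> c * (\<epsilon> * ln 2)" using assms by (auto simp: c_def field_simps)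
  have "real (k + 1) \<le> c * 2 powr (\<epsilon> * real k)" for k
  proof -
    have "real k * 1 + 1 \<le> real k * (c * (\<epsilon> * ln 2)) + c" using c by (intro add_mono mult_left_mono) auto
    also have "\<dots> = c * (1 + \<epsilon> * real k * ln 2)" by (simp add: algebra_simps)
    also have "\<dots> \<le> c * exp (\<epsilon> * real k * ln 2)"
      using c by (intro mult_left_mono exp_ge_add_one_self) auto
    finally show ?thesis by (simp add: powr_def)
  qed
  then show thesis using that[of c] c by simp
qed

text \<open>
  Rounding the block size up to an integer costs at most one additional column per block and one additional row per
  level.  This adds up to \<open>(k0 + 1) * 2 ^ top_level k0\<close>
  at most, up to constants, and is absorbed because \<open>cutoff < 1\<close> makes this smaller than \<open>4 ^ k0\<close> by an exponential factor.
\<close>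

lemma total_cost:
  obtains C :: nat where "2 \<le> C" "\<And>k0. 2 * 4 ^ k0
    + (\<Sum>k\<in>{k0<..top_level k0}. 2 ^ k * ((4 * (k0 + 1) + 1) * block_size k0 k)) \<le> C * 4 ^ k0"
proof -
  define S where "S = (\<Sum>l. 2 powr (- decay * real l))"
  obtain c where c: "0 < c" "\<And>k. real (k + 1) \<le> c * 2 powr ((1 - cutoff) * real k)"
    using linear_le_exponential[of "1 - cutoff"] cutoff by auto
  define C where "C = nat \<lceil>2 + 5 * S + 20 * c\<rceil>"
  have S: "0 \<le> S" unfolding S_def using decay(1) by (intro suminf_nonneg summable_decay) auto
  have C: "2 + 5 * S + 20 * c \<le> real C" unfolding C_def by linarith
  have "2 * 4 ^ k0 + (\<Sum>k\<in>{k0<..top_level k0}. 2 ^ k * ((4 * (k0 + 1) + 1) * block_size k0 k)) \<le> C * 4 ^ k0" for k0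
  proof -
    have summand: "2 ^ k * ((4 * (real k0 + 1) + 1) * real (block_size k0 k))
        \<le> 5 * (4 ^ k0 * 2 powr (- decay * real (k - k0))) + 5 * (real k0 + 1) * 2 ^ k" if k: "k \<in> {k0<..top_level k0}" for k
    proof -
      have "2 ^ k * ((4 * (real k0 + 1) + 1) * real (block_size k0 k)) \<le> 2 ^ k * (5 * (real k0 + 1) * (effort k0 k + 1))"
        using block_size[of k0 k] by (intro mult_left_mono mult_mono) auto
      also have "\<dots> = 5 * (2 ^ k * ((real k0 + 1) * effort k0 k)) + 5 * (real k0 + 1) * 2 ^ k" by (simp add: algebra_simps)
      also have "(real k0 + 1) * effort k0 k = 2 powr (real k0 - (1 + decay) * real (k - k0))"
        by (simp add: effort_def add.commute)
      also have "2 ^ k * \<dots> = 4 ^ k0 * 2 powr (- decay * real (k - k0))"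
      proof -
        have "(2::real) ^ k = 2 powr (real k0 + real (k - k0))" using k by (simp add: powr_realpow[symmetric])
        moreover have "(4::real) ^ k0 = 2 powr (2 * real k0)" by (simp add: powr_realpow[symmetric] flip: powr_powr)
        ultimately show ?thesis by (simp add: powr_add[symmetric] algebra_simps)
      qed
      finally show ?thesis .
    qed
    have geo: "(\<Sum>k\<in>{k0<..k1}. (2::real) ^ k) \<le> 2 ^ (k1 + 1)" for k1
    proof -
      have "(\<Sum>k\<in>{k0<..k1}. (2::real) ^ k) \<le> (\<Sum>k<k1 + 1. 2 ^ k)" by (intro sum_mono2) auto
      also have "\<dots> \<le> 2 ^ (k1 + 1)" by (subst geometric_sum) auto
      finally show ?thesis .
    qed
    have "2 ^ (top_level k0 + 1) = 2 powr (real (top_level k0) + 1)" by (simp add: powr_realpow[symmetric] powr_add)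
    also have "\<dots> \<le> 2 powr ((1 + cutoff) * real k0 + 2)" using top_level(2)[of k0] by simp
    also have "\<dots> = 4 * 2 powr ((1 + cutoff) * real k0)" by (simp add: powr_add)
    finally have top: "2 ^ (top_level k0 + 1) \<le> 4 * 2 powr ((1 + cutoff) * real k0)" .
    have "(real k0 + 1) * 2 ^ (top_level k0 + 1) \<le> (c * 2 powr ((1 - cutoff) * real k0)) * (4 * 2 powr ((1 + cutoff) * real k0))"
      using c(2)[of k0] top by (intro mult_mono) auto
    also have "\<dots> = 4 * c * 4 ^ k0"
    proof -
      have "(4::real) ^ k0 = 2 powr (2 * real k0)" by (simp add: powr_realpow[symmetric] flip: powr_powr)
      then show ?thesis by (simp add: powr_add[symmetric] algebra_simps)
    qed
    finally have second: "(real k0 + 1) * 2 ^ (top_level k0 + 1) \<le> 4 * c * 4 ^ k0" .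
    have "real (2 * 4 ^ k0 + (\<Sum>k\<in>{k0<..top_level k0}. 2 ^ k * ((4 * (k0 + 1) + 1) * block_size k0 k)))
        = 2 * 4 ^ k0 + (\<Sum>k\<in>{k0<..top_level k0}. 2 ^ k * ((4 * (real k0 + 1) + 1) * real (block_size k0 k)))"
      by (simp add: add.commute)
    also have "\<dots> \<le> 2 * 4 ^ k0 + (\<Sum>k\<in>{k0<..top_level k0}. 5 * (4 ^ k0 * 2 powr (- decay * real (k - k0))) + 5 * (real k0 + 1) * 2 ^ k)"
      by (intro add_left_mono sum_mono summand)
    also have "\<dots> = 2 * 4 ^ k0 + 5 * (4 ^ k0 * (\<Sum>k\<in>{k0<..top_level k0}. 2 powr (- decay * real (k - k0))))
        + 5 * (real k0 + 1) * (\<Sum>k\<in>{k0<..top_level k0}. 2 ^ k)"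
      by (simp add: sum.distrib sum_distrib_left)
    also have "\<dots> \<le> 2 * 4 ^ k0 + 5 * (4 ^ k0 * S) + 5 * (real k0 + 1) * 2 ^ (top_level k0 + 1)"
      unfolding S_def by (intro add_mono mult_left_mono sum_decay_le decay geo) auto
    also have "\<dots> = 2 * 4 ^ k0 + 5 * (4 ^ k0 * S) + 5 * ((real k0 + 1) * 2 ^ (top_level k0 + 1))"
      by (simp only: mult.assoc)
    also have "\<dots> \<le> 2 * 4 ^ k0 + 5 * (4 ^ k0 * S) + 5 * (4 * c * 4 ^ k0)"
      by (intro add_left_mono mult_left_mono second) auto
    also have "\<dots> = (2 + 5 * S + 20 * c) * 4 ^ k0" by (simp add: algebra_simps)
    also have "\<dots> \<le> real C * 4 ^ k0" using C by (intro mult_right_mono) auto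
    also have "\<dots> = real (C * 4 ^ k0)" by simp
    finally show ?thesis by (simp only: of_nat_le_iff)
  qed
  moreover have "2 \<le> C" using C S c by linarith
  ultimately show thesis using that by blast
qed

text \<open>
  In each summand the exponent of \<open>2\<close> is split into the part depending on \<open>k0\<close> and the part depending on the distance to \<open>k0\<close>; the
  latter is negative by the choice of \<open>decay\<close>.
\<close>

lemma level_bound_le:
  assumes k: "k \<in> {k0<..top_level k0}"
  shows "level_bound (4 * (k0 + 1)) (block_size k0 k) k
    \<le> 64 * (2 powr ((a - b - \<alpha>) * real k0) * real (k0 + 1) powr b) * 2 powr (- (\<alpha> - a - b * (1 + decay)) * real (k - k0))
    + 512 * (2 powr (- \<alpha> * real k0) * real (k0 + 1) powr a) * 2 powr (- (\<alpha> - a * (2 + decay)) * real (k - k0))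
    + (2 powr (- \<alpha> * real k0) * real (k0 + 1) powr a) * 2 powr (- \<alpha> * real (k - k0))"
proof -
  define l where "l = real (k - k0)"
  define \<kappa> where "\<kappa> = real k0"
  define N where "N = real (k0 + 1)"
  have kl: "real k = \<kappa> + l" using k by (simp add: l_def \<kappa>_def)
  have N: "1 \<le> N" by (simp add: N_def)
  have e: "effort k0 k = 2 powr (\<kappa> - (1 + decay) * l) / N" by (simp add: effort_def l_def \<kappa>_def N_def)
  have neg: "real (block_size k0 k) powr (- s) \<le> N powr s * 2 powr (- s * (\<kappa> - (1 + decay) * l))" if "0 \<le> s" for s
  proof -
    have "real (block_size k0 k) powr (- s) \<le> effort k0 k powr (- s)"
      using block_size[of k0 k] effort_pos that by (intro powr_mono2') auto
    also have "\<dots> = N powr s * 2 powr (- s * (\<kappa> - (1 + decay) * l))"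
    proof -
      have "effort k0 k powr (- s) = (2 powr (\<kappa> - (1 + decay) * l)) powr (- s) / N powr (- s)"
        unfolding e by (rule powr_divide)
      then show ?thesis by (simp only: powr_powr powr_minus[of N] divide_inverse inverse_inverse_eq mult.commute)
    qed
    finally show ?thesis .
  qed
  have t1: "2 powr (- \<alpha> * real k) * (64 * real (block_size k0 k) powr (- b) * 2 powr (a * real k))
      \<le> 64 * (2 powr ((a - b - \<alpha>) * \<kappa>) * N powr b) * 2 powr (- (\<alpha> - a - b * (1 + decay)) * l)"
  proof -
    have "2 powr (- \<alpha> * real k) * (64 * real (block_size k0 k) powr (- b) * 2 powr (a * real k))
      \<le> 2 powr (- \<alpha> * real k) * (64 * (N powr b * 2 powr (- b * (\<kappa> - (1 + decay) * l))) * 2 powr (a * real k))"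
      using neg[of b] ab by (intro mult_left_mono mult_right_mono) auto
    also have "\<dots> = 64 * N powr b * (2 powr (- \<alpha> * real k) * 2 powr (- b * (\<kappa> - (1 + decay) * l)) * 2 powr (a * real k))"
      by (simp only: mult_ac)
    also have "2 powr (- \<alpha> * real k) * 2 powr (- b * (\<kappa> - (1 + decay) * l)) * 2 powr (a * real k)
        = 2 powr ((a - b - \<alpha>) * \<kappa>) * 2 powr (- (\<alpha> - a - b * (1 + decay)) * l)"
      unfolding powr_add[symmetric] kl by (intro arg_cong[where f = "(powr) 2"]) (simp add: algebra_simps)
    finally show ?thesis by (simp only: mult_ac)
  qed
  have t2: "2 powr (- \<alpha> * real k) * (512 * (2^k / real (block_size k0 k)) powr a)
      \<le> 512 * (2 powr (- \<alpha> * \<kappa>) * N powr a) * 2 powr (- (\<alpha> - a * (2 + decay)) * l)"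
  proof -
    have "(2^k / real (block_size k0 k)) powr a = 2 powr (a * real k) * real (block_size k0 k) powr (- a)"
    proof -
      have "(2 ^ k) powr a = 2 powr (a * real k)"
        by (simp add: powr_realpow[symmetric] powr_powr mult.commute)
      then show ?thesis by (simp only: powr_divide powr_minus) (simp only: divide_inverse)
    qed
    also have "\<dots> \<le> 2 powr (a * real k) * (N powr a * 2 powr (- a * (\<kappa> - (1 + decay) * l)))"
      by (rule mult_left_mono[OF neg]) (use ab in auto)
    finally have "2 powr (- \<alpha> * real k) * (512 * (2^k / real (block_size k0 k)) powr a)
      \<le> 2 powr (- \<alpha> * real k) * (512 * (2 powr (a * real k) * (N powr a * 2 powr (- a * (\<kappa> - (1 + decay) * l)))))"
      by (intro mult_left_mono) auto
    also have "\<dots> = 512 * N powr a * (2 powr (- \<alpha> * real k) * 2 powr (a * real k) * 2 powr (- a * (\<kappa> - (1 + decay) * l)))"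
      by (simp only: mult_ac)
    also have "2 powr (- \<alpha> * real k) * 2 powr (a * real k) * 2 powr (- a * (\<kappa> - (1 + decay) * l))
        = 2 powr (- \<alpha> * \<kappa>) * 2 powr (- (\<alpha> - a * (2 + decay)) * l)"
      unfolding powr_add[symmetric] kl by (intro arg_cong[where f = "(powr) 2"]) (simp add: algebra_simps)
    finally show ?thesis by (simp only: mult_ac)
  qed
  have t3: "2 powr (- \<alpha> * real k) * (2 powr (a * real k) * (2 ^ k * (1 / 2) ^ (4 * (k0 + 1))))
      \<le> (2 powr (- \<alpha> * \<kappa>) * N powr a) * 2 powr (- \<alpha> * l)"
  proof -
    have "real k \<le> (1 + cutoff) * \<kappa> + 1" using k top_level(2)[of k0] by (simp add: \<kappa>_def)
    also have "\<dots> \<le> 2 * \<kappa> + 1" using cutoff by (intro add_right_mono mult_right_mono) (auto simp: \<kappa>_def)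
    finally have "2 * real k \<le> 4 * N" by (simp add: \<kappa>_def N_def)
    moreover have "(a + 1) * real k \<le> 2 * real k" using ab by (intro mult_right_mono) auto
    ultimately have le: "a * real k + real k - 4 * N \<le> 0" by (simp add: distrib_right)
    have "2 powr (a * real k) * (2 ^ k * (1 / 2) ^ (4 * (k0 + 1))) = 2 powr (a * real k + real k - 4 * N)"
    proof -
      have "(1 / 2 :: real) ^ (4 * (k0 + 1)) = 2 powr (- (4 * N))"
      proof -
        have "4 * N = real (4 * (k0 + 1))" by (simp add: N_def)
        then have "2 powr (- (4 * N)) = inverse (2 powr real (4 * (k0 + 1)))" by (simp only: powr_minus)
        also have "2 powr real (4 * (k0 + 1)) = 2 ^ (4 * (k0 + 1))" by (rule powr_realpow) simp
        finally show ?thesis by (simp only: power_one_over inverse_eq_divide)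
      qed
      moreover have "(2::real) ^ k = 2 powr real k" by (simp add: powr_realpow)
      ultimately show ?thesis by (simp only: powr_add[symmetric]) (simp add: algebra_simps)
    qed
    also have "\<dots> \<le> 2 powr 0" using le by (intro powr_mono) auto
    also have "\<dots> \<le> N powr a" using N ab by (simp add: ge_one_powr_ge_zero)
    finally have "2 powr (- \<alpha> * real k) * (2 powr (a * real k) * (2 ^ k * (1 / 2) ^ (4 * (k0 + 1)))) \<le> 2 powr (- \<alpha> * real k) * N powr a"
      by (intro mult_left_mono) auto
    also have "\<dots> = (2 powr (- \<alpha> * \<kappa>) * N powr a) * 2 powr (- \<alpha> * l)"
    proof -
      have "2 powr (- \<alpha> * real k) = 2 powr (- \<alpha> * \<kappa>) * 2 powr (- \<alpha> * l)"
        by (simp only: kl distrib_left powr_add)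
      then show ?thesis by (simp only: mult_ac)
    qed
    finally show ?thesis .
  qed
  show ?thesis
    using t1 t2 t3 unfolding level_bound_def distrib_left l_def \<kappa>_def N_def by linarith
qed

lemma e_ran_rate:
  "\<exists>c>0. \<exists>n0. \<forall>n\<ge>n0. e_ran P n \<le> ennreal (c * real n powr ((a - b - \<alpha>) / 2) * log 2 (real n + 1) powr b
     + c * real n powr (- \<alpha> / 2) * log 2 (real n + 1) powr a)"
proof -
  define S where "S \<epsilon> = (\<Sum>l. 2 powr (- \<epsilon> * real l))" for \<epsilon> :: real
  obtain C :: nat where C: "2 \<le> C" "\<And>k0. 2 * 4 ^ k0
    + (\<Sum>k\<in>{k0<..top_level k0}. 2 ^ k * ((4 * (k0 + 1) + 1) * block_size k0 k)) \<le> C * 4 ^ k0"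
    using total_cost by blast
  (* decay rates, in the distance to level k0, of the two main parts of the error *)
  define \<epsilon>1 \<epsilon>2 where "\<epsilon>1 = \<alpha> - a - b * (1 + decay)" and "\<epsilon>2 = \<alpha> - a * (2 + decay)"
  have \<epsilon>: "0 < \<epsilon>1" "0 < \<epsilon>2" "0 < \<alpha>" "0 < \<alpha> - a" using decay ab \<alpha>2 by (auto simp: \<epsilon>1_def \<epsilon>2_def)
  have S: "0 \<le> S \<epsilon>" if "0 < \<epsilon>" for \<epsilon>
    unfolding S_def using that by (intro suminf_nonneg summable_decay) auto
  define T1 T2 where "T1 = 64 * S \<epsilon>1 + S (\<alpha> - a)" and "T2 = 512 * S \<epsilon>2 + S \<alpha>"
  have T: "0 \<le> T1" "0 \<le> T2" using S \<epsilon> by (auto simp: T1_def T2_def)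
  define c where "c = 1 + T1 * (4 * real C) powr ((\<alpha> - a + b) / 2) + T2 * (4 * real C) powr (\<alpha> / 2)"
  have c: "0 < c" "T1 * (4 * real C) powr ((\<alpha> - a + b) / 2) \<le> c" "T2 * (4 * real C) powr (\<alpha> / 2) \<le> c"
  proof -
    have "0 \<le> T1 * (4 * real C) powr ((\<alpha> - a + b) / 2)" "0 \<le> T2 * (4 * real C) powr (\<alpha> / 2)"
      using T by auto
    then show "0 < c" "T1 * (4 * real C) powr ((\<alpha> - a + b) / 2) \<le> c" "T2 * (4 * real C) powr (\<alpha> / 2) \<le> c"
      unfolding c_def by linarith+
  qed
  have "e_ran P n \<le> ennreal (c * real n powr ((a - b - \<alpha>) / 2) * log 2 (real n + 1) powr b
     + c * real n powr (- \<alpha> / 2) * log 2 (real n + 1) powr a)" if n: "C \<le> n" for n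
  proof -
    obtain k0 where k: "C * 4 ^ k0 \<le> n" "n < C * 4 ^ (k0 + 1)" using ex_level[of C n] n C by auto
    define X1 X2 where "X1 = 2 powr ((a - b - \<alpha>) * real k0) * real (k0 + 1) powr b"
      and "X2 = 2 powr (- \<alpha> * real k0) * real (k0 + 1) powr a"
    define I where "I = {k0<..top_level k0}"
    have X: "0 \<le> X1" "0 \<le> X2" by (auto simp: X1_def X2_def)
    define tail where "tail = 2 powr ((a - \<alpha>) * real (top_level k0)) * (\<Sum>l. 2 powr ((a - \<alpha>) * real l))"
    have "e_ran P n \<le> ennreal ((\<Sum>k\<in>I. level_bound (4 * (k0 + 1)) (block_size k0 k) k) + tail)"
      unfolding I_def tail_def by (rule ran_upper[OF block_size(1)]) (use C(2)[of k0] k in linarith)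
    also have "\<dots> \<le> ennreal (T1 * X1 + T2 * X2)"
    proof (rule ennreal_leI)
      have "(\<Sum>k\<in>I. level_bound (4 * (k0 + 1)) (block_size k0 k) k)
          \<le> (\<Sum>k\<in>I. 64 * X1 * 2 powr (- \<epsilon>1 * real (k - k0)) + 512 * X2 * 2 powr (- \<epsilon>2 * real (k - k0)) + X2 * 2 powr (- \<alpha> * real (k - k0)))"
        unfolding X1_def X2_def \<epsilon>1_def \<epsilon>2_def I_def by (intro sum_mono level_bound_le)
      also have "\<dots> = 64 * X1 * (\<Sum>k\<in>I. 2 powr (- \<epsilon>1 * real (k - k0))) + 512 * X2 * (\<Sum>k\<in>I. 2 powr (- \<epsilon>2 * real (k - k0)))
          + X2 * (\<Sum>k\<in>I. 2 powr (- \<alpha> * real (k - k0)))"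
        by (simp add: sum.distrib sum_distrib_left)
      also have "\<dots> \<le> 64 * X1 * S \<epsilon>1 + 512 * X2 * S \<epsilon>2 + X2 * S \<alpha>"
        unfolding I_def S_def using X \<epsilon> by (intro add_mono mult_left_mono sum_decay_le) auto
      finally have main: "(\<Sum>k\<in>I. level_bound (4 * (k0 + 1)) (block_size k0 k) k) \<le> 64 * X1 * S \<epsilon>1 + 512 * X2 * S \<epsilon>2 + X2 * S \<alpha>" .
      have "2 powr ((a - \<alpha>) * real (top_level k0)) \<le> 2 powr ((a - \<alpha>) * ((1 + cutoff) * real k0))"
        using top_level(1)[of k0] \<epsilon> by (intro powr_mono mult_left_mono_neg) auto
      also have "(a - \<alpha>) * ((1 + cutoff) * real k0) = (a - b - \<alpha>) * real k0"
      proof -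
        have "(a - \<alpha>) * cutoff = - b" using \<epsilon> by (simp add: cutoff_def field_simps)
        then have "(a - \<alpha>) * (1 + cutoff) = a - b - \<alpha>" by (simp add: distrib_left)
        then show ?thesis by (simp add: mult.assoc[symmetric])
      qed
      also have "2 powr ((a - b - \<alpha>) * real k0) \<le> X1"
        using ge_one_powr_ge_zero[of "real (k0 + 1)" b] ab by (simp add: X1_def)
      finally have "2 powr ((a - \<alpha>) * real (top_level k0)) * S (\<alpha> - a) \<le> X1 * S (\<alpha> - a)"
        using S \<epsilon> by (intro mult_right_mono) auto
      then have "tail \<le> X1 * S (\<alpha> - a)" by (simp add: tail_def S_def)
      then show "(\<Sum>k\<in>I. level_bound (4 * (k0 + 1)) (block_size k0 k) k) + tail \<le> T1 * X1 + T2 * X2"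
        using main by (simp add: T1_def T2_def algebra_simps)
    qed
    also have "\<dots> \<le> ennreal (c * real n powr ((a - b - \<alpha>) / 2) * log 2 (real n + 1) powr b
        + c * real n powr (- \<alpha> / 2) * log 2 (real n + 1) powr a)"
    proof (intro ennreal_leI add_mono)
      have n1: "1 \<le> n" using n C by simp
      have "real (k0 + 1) \<le> log 2 (real n + 1)"
      proof -
        have "2 ^ (k0 + 1) \<le> C * (4::nat) ^ k0" using C(1) by (simp add: mult_mono power_mono)
        then have "(2::nat) ^ (k0 + 1) \<le> n" using k by linarith
        then have "(2::real) ^ (k0 + 1) \<le> real n" by (metis of_nat_le_iff of_nat_numeral of_nat_power)
        then have "2 powr real (k0 + 1) \<le> real n + 1" by (simp only: powr_realpow)
        then show ?thesis by (simp add: le_log_iff)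
      qed
      then have lg: "real (k0 + 1) powr s \<le> log 2 (real n + 1) powr s" if "0 \<le> s" for s
        using that by (intro powr_mono2) auto
      have rate: "2 powr (- s * real k0) \<le> (4 * real C) powr (s / 2) * real n powr (- s / 2)" if "0 \<le> s" for s
        using upper_rate[OF _ k(2) that n1] C by simp
      have "T1 * X1 \<le> T1 * (((4 * real C) powr ((\<alpha> - a + b) / 2) * real n powr ((a - b - \<alpha>) / 2)) * log 2 (real n + 1) powr b)"
        unfolding X1_def using rate[of "\<alpha> - a + b"] lg[of b] ab \<alpha>2 T
        by (intro mult_left_mono mult_mono) (auto simp: minus_add diff_diff_eq2 algebra_simps)
      also have "\<dots> = (T1 * (4 * real C) powr ((\<alpha> - a + b) / 2)) * (real n powr ((a - b - \<alpha>) / 2) * log 2 (real n + 1) powr b)"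
        by (simp only: mult_ac)
      also have "\<dots> \<le> c * (real n powr ((a - b - \<alpha>) / 2) * log 2 (real n + 1) powr b)"
        by (intro mult_right_mono c) auto
      finally show "T1 * X1 \<le> c * real n powr ((a - b - \<alpha>) / 2) * log 2 (real n + 1) powr b" by (simp only: mult_ac)
      have "T2 * X2 \<le> T2 * (((4 * real C) powr (\<alpha> / 2) * real n powr (- \<alpha> / 2)) * log 2 (real n + 1) powr a)"
        unfolding X2_def using rate[of \<alpha>] lg[of a] ab \<alpha>2 T by (intro mult_left_mono mult_mono) auto
      also have "\<dots> = (T2 * (4 * real C) powr (\<alpha> / 2)) * (real n powr (- \<alpha> / 2) * log 2 (real n + 1) powr a)"
        by (simp only: mult_ac)
      also have "\<dots> \<le> c * (real n powr (- \<alpha> / 2) * log 2 (real n + 1) powr a)"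
        by (intro mult_right_mono c) auto
      finally show "T2 * X2 \<le> c * real n powr (- \<alpha> / 2) * log 2 (real n + 1) powr a" by (simp only: mult_ac)
    qed
    finally show ?thesis .
  qed
  then show ?thesis using c(1) by blast
qed

end

theorem proposition5p6:
  fixes K :: "complex set" and \<alpha> :: real and p q u v p\<^sub>1 q\<^sub>1 :: ereal
  assumes "K = \<real> \<or> K = UNIV"
    and "1 \<le> p" "1 \<le> q" "1 \<le> u" "1 \<le> v" "1 \<le> p\<^sub>1" "1 \<le> q\<^sub>1"
    and "p < q" and "u > v" and "\<alpha> > 2"
  defines "P \<equiv> embedding_problem K \<alpha> p u p\<^sub>1 q v q\<^sub>1"
  shows "\<exists>c\<^sub>1>0. \<exists>c\<^sub>2>0. \<exists>c\<^sub>3>0. \<exists>c\<^sub>4>0. \<exists>n\<^sub>0\<ge>1. \<forall>n\<ge>n\<^sub>0.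
     ennreal (c\<^sub>1 * real n powr ((- \<alpha> + recip p - recip q + recip u - recip v) / 2)
              + c\<^sub>1 * real n powr (- \<alpha> / 2))
       \<le> e_ran P n \<and>
     e_ran P n
       \<le> ennreal (c\<^sub>2 * real n powr ((- \<alpha> + recip p - recip q + recip u - recip v) / 2)
                      * log 2 (real n + 1) powr (recip v - recip u)
                  + c\<^sub>2 * real n powr (- \<alpha> / 2) * log 2 (real n + 1) powr (recip p - recip q)) \<and>
     ennreal (c\<^sub>3 * real n powr ((- \<alpha> + recip p - recip q) / 2)) \<le> e_ran_non P n \<and>
     e_ran_non P n \<le> e_det_non P n \<and>
     e_det_non P n \<le> 2 * e_det P n \<and>
     2 * e_det P n \<le> ennreal (c\<^sub>4 * real n powr ((- \<alpha> + recip p - recip q) / 2))"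
proof -
  interpret E: mixed_embedding K \<alpha> p q u v p\<^sub>1 q\<^sub>1
    by (unfold_locales; use assms in simp)
  have P: "P = E.P" by (simp add: P_def E.P_def)
  have exps: "- \<alpha> + recip p - recip q + recip u - recip v = E.a - E.b - \<alpha>" "recip v - recip u = E.b"
    "recip p - recip q = E.a" "- \<alpha> + recip p - recip q = E.a - \<alpha>"
    by (simp_all add: E.a_def E.b_def)
  obtain c\<^sub>2 n\<^sub>2 where c2: "c\<^sub>2 > 0" "\<And>n. n \<ge> n\<^sub>2 \<Longrightarrow> e_ran P n
      \<le> ennreal (c\<^sub>2 * real n powr ((E.a - E.b - \<alpha>) / 2) * log 2 (real n + 1) powr E.b
                + c\<^sub>2 * real n powr (- \<alpha> / 2) * log 2 (real n + 1) powr E.a)"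
    using E.e_ran_rate unfolding P by blast
  obtain c where c: "c > 0" "\<And>n. n \<ge> 2 \<Longrightarrow> e_det_non P n \<le> ennreal (c * real n powr ((E.a - \<alpha>) / 2))"
    using E.e_det_non_rate unfolding P by blast
  define s where "s = \<alpha> - E.a + E.b"
  have s: "0 \<le> s" "0 \<le> \<alpha>" "0 \<le> \<alpha> - E.a" using E.ab assms(10) by (auto simp: s_def)
  define d where "d = min (8 powr (- s / 2)) (8 powr (- \<alpha> / 2)) / 4"
  have d: "0 < d" "2 * d \<le> 8 powr (- s / 2) / 2" "2 * d \<le> 8 powr (- \<alpha> / 2) / 2" by (auto simp: d_def)
  have es: "(E.a - E.b - \<alpha>) / 2 = - s / 2" "(E.a - \<alpha>) / 2 = - (\<alpha> - E.a) / 2" by (auto simp: s_def)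
  have lower: "ennreal (d * real n powr ((E.a - E.b - \<alpha>) / 2) + d * real n powr (- \<alpha> / 2)) \<le> e_ran P n" if n: "1 \<le> n" for n
  proof -
    have 1: "ennreal (8 powr (- s / 2) / 2 * real n powr (- s / 2)) \<le> e_ran P n"
      by (rule lower_rate[OF n s(1)]) (use E.ran_lower_single[of _ n] in \<open>simp add: P s_def algebra_simps\<close>)
    have 2: "ennreal (8 powr (- \<alpha> / 2) / 2 * real n powr (- \<alpha> / 2)) \<le> e_ran P n"
      by (rule lower_rate[OF n s(2)]) (use E.ran_lower_grid[of _ n] in \<open>simp add: P\<close>)
    have "d * real n powr (- s / 2) + d * real n powr (- \<alpha> / 2)
        \<le> max (2 * d * real n powr (- s / 2)) (2 * d * real n powr (- \<alpha> / 2))" by (simp add: max_def)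
    also have "\<dots> \<le> max (8 powr (- s / 2) / 2 * real n powr (- s / 2)) (8 powr (- \<alpha> / 2) / 2 * real n powr (- \<alpha> / 2))"
      by (intro max.mono mult_right_mono d) auto
    finally have "d * real n powr (- s / 2) + d * real n powr (- \<alpha> / 2) \<le> 8 powr (- s / 2) / 2 * real n powr (- s / 2)
        \<or> d * real n powr (- s / 2) + d * real n powr (- \<alpha> / 2) \<le> 8 powr (- \<alpha> / 2) / 2 * real n powr (- \<alpha> / 2)"
      by (simp only: le_max_iff_disj)
    then show ?thesis
      unfolding es using order_trans[OF ennreal_leI 1] order_trans[OF ennreal_leI 2] by blast
  qed
  have lower_non: "ennreal (8 powr (- (\<alpha> - E.a) / 2) / 2 * real n powr ((E.a - \<alpha>) / 2)) \<le> e_ran_non P n" if n: "1 \<le> n" for n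
    unfolding es by (rule lower_rate[OF n s(3)]) (use E.ran_non_lower_row[of _ n] in \<open>simp add: P algebra_simps\<close>)
  have det: "e_det_non P n \<le> 2 * e_det P n" for n
  proof -
    have "e_det_non P n \<le> 1 * e_det P n" using E.e_det_non_le_e_det by (simp add: P)
    also have "\<dots> \<le> 2 * e_det P n" by (intro mult_right_mono) auto
    finally show ?thesis .
  qed
  have det_upper: "2 * e_det P n \<le> ennreal (2 * c * real n powr ((E.a - \<alpha>) / 2))" if n: "2 \<le> n" for n
  proof -
    have "e_det P n \<le> e_det_non P n" unfolding e_det_def e_det_non_def by (intro INF_superset_mono) auto
    also have "\<dots> \<le> ennreal (c * real n powr ((E.a - \<alpha>) / 2))" by (rule c(2)[OF n])
    finally have "2 * e_det P n \<le> 2 * ennreal (c * real n powr ((E.a - \<alpha>) / 2))" by (intro mult_left_mono) auto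
    also have "\<dots> = ennreal (2 * c * real n powr ((E.a - \<alpha>) / 2))"
      using c(1) by (simp add: ennreal_mult' mult.assoc)
    finally show ?thesis .
  qed
  show ?thesis
    unfolding exps(1) unfolding exps(2-4)
  proof (rule exI[of _ d], intro conjI, rule d(1), rule exI[of _ "c\<^sub>2"], intro conjI, rule c2(1),
      rule exI[of _ "8 powr (- (\<alpha> - E.a) / 2) / 2"], intro conjI, simp, rule exI[of _ "2 * c"], intro conjI,
      use c(1) in simp, rule exI[of _ "max 2 n\<^sub>2"], intro conjI, simp, intro allI impI conjI)
    fix n assume "max 2 n\<^sub>2 \<le> n"
    then have n: "1 \<le> n" "2 \<le> n" "n\<^sub>2 \<le> n" by auto
    show "ennreal (d * real n powr ((E.a - E.b - \<alpha>) / 2) + d * real n powr (- \<alpha> / 2)) \<le> e_ran P n"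
      by (rule lower[OF n(1)])
    show "e_ran P n \<le> ennreal (c\<^sub>2 * real n powr ((E.a - E.b - \<alpha>) / 2) * log 2 (real n + 1) powr E.b
        + c\<^sub>2 * real n powr (- \<alpha> / 2) * log 2 (real n + 1) powr E.a)"
      by (rule c2(2)[OF n(3)])
    show "ennreal (8 powr (- (\<alpha> - E.a) / 2) / 2 * real n powr ((E.a - \<alpha>) / 2)) \<le> e_ran_non P n"
      by (rule lower_non[OF n(1)])
    show "e_ran_non P n \<le> e_det_non P n" unfolding P by (rule E.e_ran_non_le_e_det_non)
    show "e_det_non P n \<le> 2 * e_det P n" by (rule det)
    show "2 * e_det P n \<le> ennreal (2 * c * real n powr ((E.a - \<alpha>) / 2))" by (rule det_upper[OF n(2)])
  qed
qed

end
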